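(* Consider the six Dynkin diagrams $d\in D$ of $sl(2|1)$ (the objects of its Weyl groupoid) and the associated Lie superbialgebras $\mathfrak g(A_d,\tau^d)$. For $d_1,d_2\in D$, the Dynkin diagrams labelled by $d_1$ and $d_2$ are isomorphic as graphs if and only if the Lie superbialgebras $\mathfrak g(A_{d_1},\tau^{d_1})$ and $\mathfrak g(A_{d_2},\tau^{d_2})$ are isomorphic (by an even isomorphism of Lie superbialgebras).
   Context: $\Bbbk$ is an algebraically closed field of characteristic zero. For homogeneous $v,w$ put $\tau(v\otimes w)=(-1)^{|v||w|}w\otimes v$. A Lie superbialgebra is a Lie superalgebra $\mathfrak g$ over $\Bbbk$ with a parity-preserving linear map $\delta:\mathfrak g\to\mathfrak g\otimes\mathfrak g$ that is skew-symmetric ($\tau\circ\delta=-\delta$) and satisfies $(\delta\otimes \mathrm{id})\delta-(\mathrm{id}\otimes\delta)\delta=(\mathrm{id}\otimes\tau)(\delta\otimes \mathrm{id})\delta$ and, for homogeneous $x,y$, $\delta([x,y])=(\mathrm{ad}_x\otimes \mathrm{id}+\mathrm{id}\otimes \mathrm{ad}_x)\delta(y)-(-1)^{|x||y|}(\mathrm{ad}_y\otimes \mathrm{id}+\mathrm{id}\otimes \mathrm{ad}_y)\delta(x)$, with the usual sign rule for tensor products of homogeneous maps. An isomorphism of Lie superbialgebras is a bijective linear map $f$ (here required to be even) with $f([x,y])=[f(x),f(y)]$ and $(f\otimes f)\circ\delta=\delta\circ f$. Let $\epsilon_1,\epsilon_2,\delta_1$ be a basis of a vector space with symmetric bilinear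 form $(\epsilon_i,\epsilon_j)=\delta_{ij}$ (Kronecker delta), $(\epsilon_i,\delta_1)=0$, $(\delta_1,\delta_1)=-1$. The set $D$ (of size 6) labels all orderings $(\eta_1,\eta_2,\eta_3)$ of $\{\epsilon_1,\epsilon_2,\delta_1\}$; for $d\in D$ put $\tau^d=\{\alpha_{1,d}=\eta_1-\eta_2,\ \alpha_{2,d}=\eta_2-\eta_3\}$ and $A_d=(a_{ij})=((\alpha_{i,d},\alpha_{j,d}))_{i,j\in\{1,2\}}$. A root $\alpha_{i,d}$ is even ($|\alpha_{i,d}|=0$) if it is a difference of two $\epsilon$'s, and odd ($|\alpha_{i,d}|=1$) otherwise. Dynkin diagram of $d$: vertices $1,2$; vertex $i$ is white if $|\alpha_{i,d}|=0$ and grey if $|\alpha_{i,d}|=1$; the vertices are joined if $(\alpha_{1,d},\alpha_{2,d})\neq0$. Two Dynkin diagrams are called isomorphic (as graphs) if they have the same number of white dots and the same number of grey dots. $\mathfrak g(A_d,\tau^d)$ is the Lie superalgebra over $\Bbbk$ generated by $h_i,e_i,f_i$ ($i=1,2$), all even except that $e_i,f_i$ are odd when $|\alpha_{i,d}|=1$, with relations $[h_i,h_j]=0$, $[h_i,e_j]=a_{ij}e_j$, $[h_i,f_j]=-a_{ij}f_j$, $[e_i,f_j]=\delta_{ij}h_i$; $[e_i,e_i]=[f_i,f_i]=0$ if $|\alpha_{i,d}|=1$; $(\mathrm{ad}_{e_i})^{1+|a_{ij}|}e_j=(\mathrm{ad}_{f_i})^{1+|a_{ij}|}f_j=0$ if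 $i\ne j$ and $|\alpha_{i,d}|=0$. It is a Lie superbialgebra with $\delta$ determined on generators by $\delta(h_i)=0$, $\delta(e_i)=\frac12(h_i\otimes e_i-e_i\otimes h_i)$, $\delta(f_i)=\frac12(h_i\otimes f_i-f_i\otimes h_i)$ and extended to all of $\mathfrak g(A_d,\tau^d)$ by linearity and the compatibility condition $\delta([x,y])=(\mathrm{ad}_x\otimes \mathrm{id}+\mathrm{id}\otimes \mathrm{ad}_x)\delta(y)-(-1)^{|x||y|}(\mathrm{ad}_y\otimes \mathrm{id}+\mathrm{id}\otimes \mathrm{ad}_y)\delta(x)$ for homogeneous $x,y$. *)

theory Defs
  imports
    "HOL-Algebra.Module"
    "HOL-Algebra.Algebraic_Closure_Type"
    "HOL-Library.Poly_Mapping"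
    "HOL-Library.Z2"
begin

section \<open>Formal linear combinations\<close>

abbreviation "single \<equiv> Poly_Mapping.single"
abbreviation "lookup \<equiv> Poly_Mapping.lookup"
abbreviation "keys \<equiv> Poly_Mapping.keys"

definition fscale :: "'k::field \<Rightarrow> ('a \<Rightarrow>\<^sub>0 'k) \<Rightarrow> ('a \<Rightarrow>\<^sub>0 'k)"
  where "fscale c p = Poly_Mapping.map ((*) c) p"

lemma lookup_fscale: "lookup (fscale c p) a = c * lookup p a"
  by (cases "lookup p a = 0") (simp_all add: fscale_def Poly_Mapping.map.rep_eq)

interpretation fsum: vector_space fscale
  by unfold_locales
    (rule poly_mapping_eqI; simp add: lookup_fscale lookup_add algebra_simps)+

text \<open>The linear map determined by its values \<open>g a\<close> on the basis elements \<open>a\<close>.\<close>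

definition lin_ext :: "('a \<Rightarrow> 'b \<Rightarrow>\<^sub>0 'k) \<Rightarrow> ('a \<Rightarrow>\<^sub>0 'k::field) \<Rightarrow> ('b \<Rightarrow>\<^sub>0 'k)"
  where "lin_ext g p = (\<Sum>a\<in>keys p. fscale (lookup p a) (g a))"

section \<open>Lie superbialgebras\<close>

text \<open>Parities are elements of the field with two elements, and \<open>psign p\<close> is \<open>(-1)\<^sup>p\<close>.\<close>

definition psign :: "bit \<Rightarrow> 'k::field"
  where "psign p = (if p = 0 then 1 else - 1)"

text \<open>The scalars are a type \<open>'k\<close>; \<open>ring_of_type_algebra\<close> is this field as a ring record.
  The multiplication of the inherited ring record is the Lie bracket (it is neither
  associative nor unital, and the field \<open>one\<close> is not used).

  An element of \<open>V \<otimes> V\<close> is represented by a formal linear combination of pairs \<open>(v, w)\<close>,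
  each pair standing for \<open>v \<otimes> w\<close>; two combinations represent the same tensor iff they differ
  by an element of \<open>tensor2_null V\<close>. The cobracket yields such a representative, so every
  equation between tensors is stated modulo \<open>tensor2_null\<close> or \<open>tensor3_null\<close>.\<close>

record ('k, 'v) superspace = "('k, 'v) module" +
  part :: "bit \<Rightarrow> 'v set"

record (overloaded) ('k::zero, 'v) superbialgebra = "('k, 'v) superspace" +
  cobracket :: "'v \<Rightarrow> ('v \<times> 'v \<Rightarrow>\<^sub>0 'k)"

abbreviation bracket :: "('k, 'v, 'm) superspace_scheme \<Rightarrow> 'v \<Rightarrow> 'v \<Rightarrow> 'v"
  where "bracket L x y \<equiv> x \<otimes>\<^bsub>L\<^esub> y"

locale superspace = Module.module "ring_of_type_algebra :: 'k::field ring" V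
  for V :: "('k::field, 'v, 'm) superspace_scheme" (structure) +
  assumes part_submodule: "submodule (part V p) ring_of_type_algebra V"
    and part_direct_sum:
      "x \<in> carrier V \<Longrightarrow>
        \<exists>!ab. fst ab \<in> part V 0 \<and> snd ab \<in> part V 1 \<and> x = fst ab \<oplus> snd ab"

locale lie_superalgebra = superspace L
  for L :: "('k::field, 'v, 'm) superspace_scheme" (structure) +
  assumes bracket_closed:
      "\<lbrakk>x \<in> carrier L; y \<in> carrier L\<rbrakk> \<Longrightarrow> bracket L x y \<in> carrier L"
    and bracket_add_left:
      "\<lbrakk>x \<in> carrier L; y \<in> carrier L; z \<in> carrier L\<rbrakk>
        \<Longrightarrow> bracket L (x \<oplus> y) z = bracket L x z \<oplus> bracket L y z"
    and bracket_add_right: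
      "\<lbrakk>x \<in> carrier L; y \<in> carrier L; z \<in> carrier L\<rbrakk>
        \<Longrightarrow> bracket L x (y \<oplus> z) = bracket L x y \<oplus> bracket L x z"
    and bracket_smult_left:
      "\<lbrakk>x \<in> carrier L; y \<in> carrier L\<rbrakk> \<Longrightarrow> bracket L (s \<odot> x) y = s \<odot> bracket L x y"
    and bracket_smult_right:
      "\<lbrakk>x \<in> carrier L; y \<in> carrier L\<rbrakk> \<Longrightarrow> bracket L x (s \<odot> y) = s \<odot> bracket L x y"
    and bracket_part:
      "\<lbrakk>x \<in> part L p; y \<in> part L q\<rbrakk> \<Longrightarrow> bracket L x y \<in> part L (p + q)"
    and bracket_skew:
      "\<lbrakk>x \<in> part L p; y \<in> part L q\<rbrakk>
        \<Longrightarrow> bracket L x y = (- psign (p * q)) \<odot> bracket L y x"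
    and bracket_jacobi:
      "\<lbrakk>x \<in> part L p; y \<in> part L q; z \<in> part L r\<rbrakk>
        \<Longrightarrow> bracket L x (bracket L y z) =
            bracket L (bracket L x y) z \<oplus> psign (p * q) \<odot> bracket L y (bracket L x z)"

text \<open>The component of parity \<open>p\<close> of a vector.\<close>

definition homcomp :: "('k, 'v, 'm) superspace_scheme \<Rightarrow> bit \<Rightarrow> 'v \<Rightarrow> 'v"
  where "homcomp V p v =
    (THE a. a \<in> part V p \<and> (\<exists>b\<in>part V (p + 1). v = a \<oplus>\<^bsub>V\<^esub> b))"

definition tensor2_null ::
  "('k::field, 'v, 'm) superspace_scheme \<Rightarrow> ('v \<times> 'v \<Rightarrow>\<^sub>0 'k) set"
  where "tensor2_null V = fsum.span (
    {single (a \<oplus>\<^bsub>V\<^esub> b, c) 1 - single (a, c) 1 - single (b, c) 1 |a b c.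
       a \<in> carrier V \<and> b \<in> carrier V \<and> c \<in> carrier V} \<union>
    {single (c, a \<oplus>\<^bsub>V\<^esub> b) 1 - single (c, a) 1 - single (c, b) 1 |a b c.
       a \<in> carrier V \<and> b \<in> carrier V \<and> c \<in> carrier V} \<union>
    {single (s \<odot>\<^bsub>V\<^esub> a, c) 1 - single (a, c) s |s a c.
       a \<in> carrier V \<and> c \<in> carrier V} \<union>
    {single (c, s \<odot>\<^bsub>V\<^esub> a) 1 - single (c, a) s |s a c.
       a \<in> carrier V \<and> c \<in> carrier V})"

definition tensor3_null ::
  "('k::field, 'v, 'm) superspace_scheme \<Rightarrow> ('v \<times> 'v \<times> 'v \<Rightarrow>\<^sub>0 'k) set"
  where "tensor3_null V = fsum.span (
    {single (a \<oplus>\<^bsub>V\<^esub> b, c, d) 1 - single (a, c, d) 1 - single (b, c, d) 1 |a b c d.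
       a \<in> carrier V \<and> b \<in> carrier V \<and> c \<in> carrier V \<and> d \<in> carrier V} \<union>
    {single (c, a \<oplus>\<^bsub>V\<^esub> b, d) 1 - single (c, a, d) 1 - single (c, b, d) 1 |a b c d.
       a \<in> carrier V \<and> b \<in> carrier V \<and> c \<in> carrier V \<and> d \<in> carrier V} \<union>
    {single (c, d, a \<oplus>\<^bsub>V\<^esub> b) 1 - single (c, d, a) 1 - single (c, d, b) 1 |a b c d.
       a \<in> carrier V \<and> b \<in> carrier V \<and> c \<in> carrier V \<and> d \<in> carrier V} \<union>
    {single (s \<odot>\<^bsub>V\<^esub> a, c, d) 1 - single (a, c, d) s |s a c d.
       a \<in> carrier V \<and> c \<in> carrier V \<and> d \<in> carrier V} \<union>
    {single (c, s \<odot>\<^bsub>V\<^esub> a, d) 1 - single (c, a, d) s |s a c d.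
       a \<in> carrier V \<and> c \<in> carrier V \<and> d \<in> carrier V} \<union>
    {single (c, d, s \<odot>\<^bsub>V\<^esub> a) 1 - single (c, d, a) s |s a c d.
       a \<in> carrier V \<and> c \<in> carrier V \<and> d \<in> carrier V})"

definition tensor2_eq ::
  "('k::field, 'v, 'm) superspace_scheme \<Rightarrow> ('v \<times> 'v \<Rightarrow>\<^sub>0 'k) \<Rightarrow> ('v \<times> 'v \<Rightarrow>\<^sub>0 'k) \<Rightarrow> bool"
  where "tensor2_eq V s t \<longleftrightarrow> s - t \<in> tensor2_null V"

definition tensor3_eq ::
  "('k::field, 'v, 'm) superspace_scheme \<Rightarrow> ('v \<times> 'v \<times> 'v \<Rightarrow>\<^sub>0 'k)
    \<Rightarrow> ('v \<times> 'v \<times> 'v \<Rightarrow>\<^sub>0 'k) \<Rightarrow> bool"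
  where "tensor3_eq V s t \<longleftrightarrow> s - t \<in> tensor3_null V"

text \<open>Where a sign depends on the parity of a vector, the vector is first split into its
  homogeneous components: \<open>super_flip\<close> is \<open>\<tau>\<close>, and \<open>tensor_act V p x\<close> is
  \<open>ad\<^sub>x \<otimes> id + id \<otimes> ad\<^sub>x\<close> for \<open>x\<close> of parity \<open>p\<close>, with
  \<open>(id \<otimes> ad\<^sub>x)(v \<otimes> w) = (-1)\<^bsup>|x||v|\<^esup> v \<otimes> [x, w]\<close>.\<close>

definition super_flip ::
  "('k::field, 'v, 'm) superspace_scheme \<Rightarrow> ('v \<times> 'v \<Rightarrow>\<^sub>0 'k) \<Rightarrow> ('v \<times> 'v \<Rightarrow>\<^sub>0 'k)"
  where "super_flip V = lin_ext (\<lambda>(v, w).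
    \<Sum>p\<in>{0, 1}. \<Sum>q\<in>{0, 1}. single (homcomp V q w, homcomp V p v) (psign (p * q)))"

definition id_tensor_flip ::
  "('k::field, 'v, 'm) superspace_scheme \<Rightarrow> ('v \<times> 'v \<times> 'v \<Rightarrow>\<^sub>0 'k)
    \<Rightarrow> ('v \<times> 'v \<times> 'v \<Rightarrow>\<^sub>0 'k)"
  where "id_tensor_flip V = lin_ext (\<lambda>(u, v, w).
    \<Sum>p\<in>{0, 1}. \<Sum>q\<in>{0, 1}. single (u, homcomp V q w, homcomp V p v) (psign (p * q)))"

definition tensor_act ::
  "('k::field, 'v, 'm) superspace_scheme \<Rightarrow> bit \<Rightarrow> 'v \<Rightarrow> ('v \<times> 'v \<Rightarrow>\<^sub>0 'k)
    \<Rightarrow> ('v \<times> 'v \<Rightarrow>\<^sub>0 'k)"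
  where "tensor_act V p x = lin_ext (\<lambda>(v, w).
    single (bracket V x v, w) 1 +
    (\<Sum>q\<in>{0, 1}. single (homcomp V q v, bracket V x w) (psign (p * q))))"

definition cobracket_tensor_id ::
  "('k::field, 'v, 'm) superbialgebra_scheme \<Rightarrow> ('v \<times> 'v \<Rightarrow>\<^sub>0 'k)
    \<Rightarrow> ('v \<times> 'v \<times> 'v \<Rightarrow>\<^sub>0 'k)"
  where "cobracket_tensor_id L =
    lin_ext (\<lambda>(v, w). lin_ext (\<lambda>(a, b). single (a, b, w) 1) (cobracket L v))"

definition id_tensor_cobracket ::
  "('k::field, 'v, 'm) superbialgebra_scheme \<Rightarrow> ('v \<times> 'v \<Rightarrow>\<^sub>0 'k)
    \<Rightarrow> ('v \<times> 'v \<times> 'v \<Rightarrow>\<^sub>0 'k)"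
  where "id_tensor_cobracket L =
    lin_ext (\<lambda>(v, w). lin_ext (\<lambda>(a, b). single (v, a, b) 1) (cobracket L w))"

definition tensor_map ::
  "('v \<Rightarrow> 'w) \<Rightarrow> ('v \<times> 'v \<Rightarrow>\<^sub>0 'k::field) \<Rightarrow> ('w \<times> 'w \<Rightarrow>\<^sub>0 'k)"
  where "tensor_map f = lin_ext (\<lambda>(v, w). single (f v, f w) 1)"

locale lie_superbialgebra = lie_superalgebra L
  for L :: "('k::field, 'v, 'm) superbialgebra_scheme" (structure) +
  assumes cobracket_closed:
      "x \<in> carrier L \<Longrightarrow> keys (cobracket L x) \<subseteq> carrier L \<times> carrier L"
    and cobracket_add:
      "\<lbrakk>x \<in> carrier L; y \<in> carrier L\<rbrakk>
        \<Longrightarrow> tensor2_eq L (cobracket L (x \<oplus> y)) (cobracket L x + cobracket L y)"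
    and cobracket_smult:
      "x \<in> carrier L \<Longrightarrow> tensor2_eq L (cobracket L (s \<odot> x)) (fscale s (cobracket L x))"
    and cobracket_part:
      "x \<in> part L p \<Longrightarrow>
        \<exists>t. tensor2_eq L (cobracket L x) t \<and> keys t \<subseteq> (\<Union>q. part L q \<times> part L (p + q))"
    and cobracket_skew:
      "x \<in> carrier L \<Longrightarrow> tensor2_eq L (super_flip L (cobracket L x)) (- cobracket L x)"
    and cobracket_cojacobi:
      "x \<in> carrier L \<Longrightarrow> tensor3_eq L
        (cobracket_tensor_id L (cobracket L x) - id_tensor_cobracket L (cobracket L x))
        (id_tensor_flip L (cobracket_tensor_id L (cobracket L x)))"
    and cobracket_cocycle:
      "\<lbrakk>x \<in> part L p; y \<in> part L q\<rbrakk> \<Longrightarrow> tensor2_eq L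
        (cobracket L (bracket L x y))
        (tensor_act L p x (cobracket L y)
          - fscale (psign (p * q)) (tensor_act L q y (cobracket L x)))"

definition lie_superbialgebra_iso ::
  "('k::field, 'v, 'm) superbialgebra_scheme \<Rightarrow> ('k, 'w, 'n) superbialgebra_scheme
    \<Rightarrow> ('v \<Rightarrow> 'w) \<Rightarrow> bool"
  where "lie_superbialgebra_iso L M f \<longleftrightarrow>
    bij_betw f (carrier L) (carrier M) \<and>
    (\<forall>x\<in>carrier L. \<forall>y\<in>carrier L. f (x \<oplus>\<^bsub>L\<^esub> y) = f x \<oplus>\<^bsub>M\<^esub> f y) \<and>
    (\<forall>s. \<forall>x\<in>carrier L. f (s \<odot>\<^bsub>L\<^esub> x) = s \<odot>\<^bsub>M\<^esub> f x) \<and>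
    (\<forall>p. f ` part L p \<subseteq> part M p) \<and>
    (\<forall>x\<in>carrier L. \<forall>y\<in>carrier L. f (bracket L x y) = bracket M (f x) (f y)) \<and>
    (\<forall>x\<in>carrier L. tensor2_eq M (tensor_map f (cobracket L x)) (cobracket M (f x)))"

definition lie_superbialgebras_isomorphic ::
  "('k::field, 'v, 'm) superbialgebra_scheme \<Rightarrow> ('k, 'w, 'n) superbialgebra_scheme \<Rightarrow> bool"
  where "lie_superbialgebras_isomorphic L M \<longleftrightarrow>
    lie_superbialgebra L \<and> lie_superbialgebra M \<and> (\<exists>f. lie_superbialgebra_iso L M f)"

section \<open>Lie superbialgebras given by generators and relations\<close>

text \<open>Nonassociative monomials in the generators are a basis of the free (nonassociative)
  superalgebra. The Lie superalgebra with relators \<open>R\<close> is its quotient by the ideal generated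
  by \<open>R\<close> together with super skew-symmetry and the super Jacobi identity. The relators in
  \<open>R\<close> are meant to be homogeneous.\<close>

datatype 'x monomial = Gen 'x | Br "'x monomial" "'x monomial"

primrec mparity :: "('x \<Rightarrow> bit) \<Rightarrow> 'x monomial \<Rightarrow> bit"
  where
    "mparity par (Gen a) = par a"
  | "mparity par (Br u v) = mparity par u + mparity par v"

abbreviation mon :: "'x monomial \<Rightarrow> ('x monomial \<Rightarrow>\<^sub>0 'k::field)"
  where "mon u \<equiv> single u 1"

definition free_bracket ::
  "('x monomial \<Rightarrow>\<^sub>0 'k::field) \<Rightarrow> ('x monomial \<Rightarrow>\<^sub>0 'k) \<Rightarrow> ('x monomial \<Rightarrow>\<^sub>0 'k)"
  where "free_bracket x y = lin_ext (\<lambda>u. lin_ext (\<lambda>v. mon (Br u v)) y) x"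

definition free_part :: "('x \<Rightarrow> bit) \<Rightarrow> bit \<Rightarrow> ('x monomial \<Rightarrow>\<^sub>0 'k::field) set"
  where "free_part par p = {x. \<forall>u\<in>keys x. mparity par u = p}"

inductive_set presented_ideal ::
  "('x \<Rightarrow> bit) \<Rightarrow> ('x monomial \<Rightarrow>\<^sub>0 'k::field) set \<Rightarrow> ('x monomial \<Rightarrow>\<^sub>0 'k) set"
  for par R
  where
    relator: "x \<in> R \<Longrightarrow> x \<in> presented_ideal par R"
  | skew: "\<lbrakk>x \<in> free_part par p; y \<in> free_part par q\<rbrakk> \<Longrightarrow>
      free_bracket x y + fscale (psign (p * q)) (free_bracket y x) \<in> presented_ideal par R"
  | jacobi: "\<lbrakk>x \<in> free_part par p; y \<in> free_part par q; z \<in> free_part par r\<rbrakk> \<Longrightarrow>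
      free_bracket x (free_bracket y z) - free_bracket (free_bracket x y) z
        - fscale (psign (p * q)) (free_bracket y (free_bracket x z)) \<in> presented_ideal par R"
  | zero: "0 \<in> presented_ideal par R"
  | add: "\<lbrakk>x \<in> presented_ideal par R; y \<in> presented_ideal par R\<rbrakk>
      \<Longrightarrow> x + y \<in> presented_ideal par R"
  | scale: "x \<in> presented_ideal par R \<Longrightarrow> fscale s x \<in> presented_ideal par R"
  | left: "x \<in> presented_ideal par R \<Longrightarrow> free_bracket y x \<in> presented_ideal par R"
  | right: "x \<in> presented_ideal par R \<Longrightarrow> free_bracket x y \<in> presented_ideal par R"

text \<open>A cobracket prescribed on the generators by \<open>c\<close> extends to monomials by the cocycle
  condition, which is the second equation of \<open>mcobracket\<close>.\<close>

definition mact ::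
  "('x \<Rightarrow> bit) \<Rightarrow> 'x monomial \<Rightarrow> ('x monomial \<times> 'x monomial \<Rightarrow>\<^sub>0 'k::field)
    \<Rightarrow> ('x monomial \<times> 'x monomial \<Rightarrow>\<^sub>0 'k)"
  where "mact par u = lin_ext (\<lambda>(v, w).
    single (Br u v, w) 1 + single (v, Br u w) (psign (mparity par u * mparity par v)))"

primrec mcobracket ::
  "('x \<Rightarrow> bit) \<Rightarrow> ('x \<Rightarrow> ('x monomial \<times> 'x monomial \<Rightarrow>\<^sub>0 'k::field))
    \<Rightarrow> 'x monomial \<Rightarrow> ('x monomial \<times> 'x monomial \<Rightarrow>\<^sub>0 'k)"
  where
    "mcobracket par c (Gen a) = c a"
  | "mcobracket par c (Br u v) =
      mact par u (mcobracket par c v)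
        - fscale (psign (mparity par u * mparity par v)) (mact par v (mcobracket par c u))"

definition coset_of :: "('a \<Rightarrow>\<^sub>0 'k::field) set \<Rightarrow> ('a \<Rightarrow>\<^sub>0 'k) \<Rightarrow> ('a \<Rightarrow>\<^sub>0 'k) set"
  where "coset_of I x = {y. y - x \<in> I}"

definition rep :: "'a set \<Rightarrow> 'a"
  where "rep S = (SOME x. x \<in> S)"

text \<open>The structure on the quotient is computed on representatives. For the cobracket this is
  independent of the choice, up to equality of tensors, whenever the cobracket
  prescribed on the generators is compatible with the relators.\<close>

definition presented_superbialgebra ::
  "('x \<Rightarrow> bit) \<Rightarrow> ('x monomial \<Rightarrow>\<^sub>0 'k::field) set
    \<Rightarrow> ('x \<Rightarrow> ('x monomial \<times> 'x monomial \<Rightarrow>\<^sub>0 'k))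
    \<Rightarrow> ('k, ('x monomial \<Rightarrow>\<^sub>0 'k) set) superbialgebra"
  where "presented_superbialgebra par R c = (let cl = coset_of (presented_ideal par R) in
    \<lparr>carrier = range cl,
     monoid.mult = (\<lambda>S T. cl (free_bracket (rep S) (rep T))),
     one = cl 0,
     ring.zero = cl 0,
     add = (\<lambda>S T. cl (rep S + rep T)),
     module.smult = (\<lambda>s S. cl (fscale s (rep S))),
     part = (\<lambda>p. cl ` free_part par p),
     cobracket = (\<lambda>S. lin_ext (\<lambda>(u, v). single (cl (mon u), cl (mon v)) 1)
                        (lin_ext (mcobracket par c) (rep S)))\<rparr>)"

section \<open>The Dynkin diagrams of $sl(2|1)$\<close>

datatype letter = Eps1 | Eps2 | Del1

datatype vertex = V1 | V2

text \<open>Vectors are given by their coordinates in the basis \<open>\<epsilon>\<^sub>1, \<epsilon>\<^sub>2, \<delta>\<^sub>1\<close>. All the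
  vectors needed have integer coordinates.\<close>

definition inner :: "(letter \<Rightarrow> int) \<Rightarrow> (letter \<Rightarrow> int) \<Rightarrow> int"
  where "inner u v = u Eps1 * v Eps1 + u Eps2 * v Eps2 - u Del1 * v Del1"

definition basis_diff :: "letter \<Rightarrow> letter \<Rightarrow> (letter \<Rightarrow> int)"
  where "basis_diff a b = (\<lambda>c. of_bool (c = a) - of_bool (c = b))"

definition orderings :: "letter list set"
  where "orderings = {d. distinct d \<and> set d = UNIV}"

primrec simple_root :: "letter list \<Rightarrow> vertex \<Rightarrow> (letter \<Rightarrow> int)"
  where
    "simple_root d V1 = basis_diff (d ! 0) (d ! 1)"
  | "simple_root d V2 = basis_diff (d ! 1) (d ! 2)"

definition root_parity :: "(letter \<Rightarrow> int) \<Rightarrow> bit"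
  where "root_parity \<alpha> =
    (if \<exists>a\<in>{Eps1, Eps2}. \<exists>b\<in>{Eps1, Eps2}. \<alpha> = basis_diff a b then 0 else 1)"

definition cartan_matrix :: "letter list \<Rightarrow> vertex \<Rightarrow> vertex \<Rightarrow> int"
  where "cartan_matrix d i j = inner (simple_root d i) (simple_root d j)"

definition simple_parity :: "letter list \<Rightarrow> vertex \<Rightarrow> bit"
  where "simple_parity d i = root_parity (simple_root d i)"

datatype colour = White | Grey

record dynkin_diagram =
  colour_of :: "vertex \<Rightarrow> colour"
  joined :: bool

definition dynkin :: "letter list \<Rightarrow> dynkin_diagram"
  where "dynkin d =
    \<lparr>colour_of = (\<lambda>i. if simple_parity d i = 0 then White else Grey),
     joined = (inner (simple_root d V1) (simple_root d V2) \<noteq> 0)\<rparr>"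

text \<open>By convention, isomorphism of these diagrams only compares the numbers of dots of each
  colour: neither the edge nor the order of the vertices is taken into account.\<close>

definition dynkin_isomorphic :: "dynkin_diagram \<Rightarrow> dynkin_diagram \<Rightarrow> bool"
  where "dynkin_isomorphic S T \<longleftrightarrow>
    card {i. colour_of S i = White} = card {i. colour_of T i = White} \<and>
    card {i. colour_of S i = Grey} = card {i. colour_of T i = Grey}"

section \<open>The Lie superbialgebra of a Dynkin diagram\<close>

datatype generator = H vertex | E vertex | F vertex

primrec gen_parity :: "(vertex \<Rightarrow> bit) \<Rightarrow> generator \<Rightarrow> bit"
  where
    "gen_parity par (H i) = 0"
  | "gen_parity par (E i) = par i"
  | "gen_parity par (F i) = par i"

abbreviation gen :: "generator \<Rightarrow> (generator monomial \<Rightarrow>\<^sub>0 'k::field)"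
  where "gen x \<equiv> mon (Gen x)"

definition relators ::
  "(vertex \<Rightarrow> vertex \<Rightarrow> int) \<Rightarrow> (vertex \<Rightarrow> bit) \<Rightarrow> (generator monomial \<Rightarrow>\<^sub>0 'k::field) set"
  where "relators A par =
    {free_bracket (gen (H i)) (gen (H j)) |i j. True} \<union>
    {free_bracket (gen (H i)) (gen (E j)) - fscale (of_int (A i j)) (gen (E j)) |i j. True} \<union>
    {free_bracket (gen (H i)) (gen (F j)) + fscale (of_int (A i j)) (gen (F j)) |i j. True} \<union>
    {free_bracket (gen (E i)) (gen (F j)) - (if i = j then gen (H i) else 0) |i j. True} \<union>
    {free_bracket (gen (E i)) (gen (E i)) |i. par i = 1} \<union>
    {free_bracket (gen (F i)) (gen (F i)) |i. par i = 1} \<union>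
    {(free_bracket (gen (E i)) ^^ nat (1 + \<bar>A i j\<bar>)) (gen (E j)) |i j. i \<noteq> j \<and> par i = 0} \<union>
    {(free_bracket (gen (F i)) ^^ nat (1 + \<bar>A i j\<bar>)) (gen (F j)) |i j. i \<noteq> j \<and> par i = 0}"

definition half_wedge ::
  "generator \<Rightarrow> generator \<Rightarrow> (generator monomial \<times> generator monomial \<Rightarrow>\<^sub>0 'k::field)"
  where "half_wedge x y = fscale (1 / 2) (single (Gen x, Gen y) 1 - single (Gen y, Gen x) 1)"

primrec gen_cobracket ::
  "generator \<Rightarrow> (generator monomial \<times> generator monomial \<Rightarrow>\<^sub>0 'k::field)"
  where
    "gen_cobracket (H i) = 0"
  | "gen_cobracket (E i) = half_wedge (H i) (E i)"
  | "gen_cobracket (F i) = half_wedge (H i) (F i)"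

definition g_superbialgebra ::
  "letter list \<Rightarrow> ('k::field, (generator monomial \<Rightarrow>\<^sub>0 'k) set) superbialgebra"
  where "g_superbialgebra d =
    presented_superbialgebra (gen_parity (simple_parity d))
      (relators (cartan_matrix d) (simple_parity d)) gen_cobracket"

end

theory Submission
  imports Defs
begin

text \<open>If \<open>\<delta>\<^sub>1\<close> stands at an end of the ordering, one simple root is even and the other is odd, and
  all such orderings have the same Cartan matrix up to the names of the vertices. If \<open>\<delta>\<^sub>1\<close> stands
  in the middle, both simple roots are odd, and both such orderings have the same Cartan matrix. So
  diagrams with equal numbers of dots have presentations that differ only by a permutation of the
  vertices, which induces an isomorphism (\<open>equal_Cartan_data_isomorphic\<close>).

  Conversely, an even simple root gives an even vector \<open>e \<noteq> 0\<close> and an even \<open>h\<close> with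
  \<open>[h, e] = 2 e\<close>, \<open>\<delta>(h) = 0\<close> and \<open>\<delta>(e) = (h \<otimes> e - e \<otimes> h) / 2\<close>. An even isomorphism would carry them to
  even elements \<open>k\<close> and \<open>y\<close> of the algebra with two odd simple roots, with cobrackets in the
  tensor square of the even part. But there the even part is spanned by \<open>h\<^sub>1\<close>, \<open>h\<^sub>2\<close>,
  \<open>[e\<^sub>1, e\<^sub>2]\<close> and \<open>[f\<^sub>1, f\<^sub>2]\<close>, and the cobrackets of the last two contain nonzero multiples of
  \<open>e\<^sub>1 \<otimes> e\<^sub>2\<close> and \<open>f\<^sub>1 \<otimes> f\<^sub>2\<close>, products of odd vectors. Hence \<open>k\<close> and \<open>y\<close> are
  combinations of \<open>h\<^sub>1\<close> and \<open>h\<^sub>2\<close>, they commute, and \<open>2 y = [k, y] = 0\<close>, although \<open>e \<noteq> 0\<close>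
  (\<open>white_grey_not_isomorphic\<close>). That \<open>e\<close> and the odd simple root vectors do not vanish is read
  off the natural representation by matrices on three letters.

  It also has to be shown that the presentations define Lie superbialgebras at all, that is, that
  the cobracket prescribed on generators descends to the quotient by the relations and satisfies the
  axioms there (\<open>Q_lie_superbialgebra\<close>). All congruences modulo an ideal or between tensors are
  checked by duality. A vector lies in a span iff every functional that kills the span kills
  the vector (\<open>in_span_iff_pair\<close>); functionals on a space of formal combinations are
  arbitrary functions on the basis; and two formal combinations of pairs are equal as tensors iff all
  bilinear forms agree on them (\<open>tensor2_eq_iff\<close>). So every axiom becomes an identity between
  scalars, about functions on monomials that vanish on the ideal. The transposed
  cobracket sends bilinear forms on the quotient to functionals on the quotient
  (\<open>cob_annihilator\<close>), and the failure of the co-Jacobi identity behaves like a cocycle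
  (\<open>cojacobiator_Br\<close>), so that it vanishes everywhere once it vanishes on the generators.\<close>

section \<open>Formal combinations and functionals\<close>

text \<open>The value on a formal combination of the functional with values \<open>\<phi>\<close> on the basis. Every
  functional arises from a unique function \<open>\<phi>\<close> in this way.\<close>

definition pair :: "('a \<Rightarrow> 'k) \<Rightarrow> ('a \<Rightarrow>\<^sub>0 'k::field) \<Rightarrow> 'k"
  where "pair \<phi> p = (\<Sum>a\<in>keys p. lookup p a * \<phi> a)"

lemma pair_superset:
  "finite A \<Longrightarrow> keys p \<subseteq> A \<Longrightarrow> pair \<phi> p = (\<Sum>a\<in>A. lookup p a * \<phi> a)"
  unfolding pair_def by (rule sum.mono_neutral_left) (auto simp: in_keys_iff)

lemma pair_cong: "(\<And>a. a \<in> keys p \<Longrightarrow> \<phi> a = \<psi> a) \<Longrightarrow> pair \<phi> p = pair \<psi> p"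
  by (simp add: pair_def)

lemma pair_zero [simp]: "pair \<phi> 0 = 0"
  by (simp add: pair_def)

lemma pair_single [simp]: "pair \<phi> (single a c) = c * \<phi> a"
  by (simp add: pair_def)

lemma pair_plus [simp]: "pair \<phi> (p + q) = pair \<phi> p + pair \<phi> q"
proof -
  have "pair \<phi> (p + q) = (\<Sum>a\<in>keys p \<union> keys q. lookup (p + q) a * \<phi> a)"
    by (rule pair_superset) (simp_all add: Poly_Mapping.keys_add)
  also have "\<dots> = (\<Sum>a\<in>keys p \<union> keys q. lookup p a * \<phi> a)
      + (\<Sum>a\<in>keys p \<union> keys q. lookup q a * \<phi> a)"
    by (simp add: lookup_add distrib_right sum.distrib)
  finally show ?thesis by (simp flip: pair_superset)
qed

lemma keys_fscale: "keys (fscale c p) \<subseteq> keys p"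
  by (auto simp: in_keys_iff lookup_fscale)

lemma pair_fscale [simp]: "pair \<phi> (fscale c p) = c * pair \<phi> p"
  by (subst pair_superset[of "keys p"]) (simp_all add: keys_fscale lookup_fscale pair_def
      sum_distrib_left mult.assoc)

lemma pair_uminus [simp]: "pair \<phi> (- p) = - pair \<phi> p"
proof -
  have "pair \<phi> (- p) + pair \<phi> p = pair \<phi> (- p + p)" by (simp only: pair_plus)
  then show ?thesis by (simp add: eq_neg_iff_add_eq_0)
qed

lemma pair_minus [simp]: "pair \<phi> (p - q) = pair \<phi> p - pair \<phi> q"
  using pair_plus[of \<phi> p "- q"] by simp

lemma pair_sum [simp]: "pair \<phi> (\<Sum>i\<in>I. f i) = (\<Sum>i\<in>I. pair \<phi> (f i))"
  by (induction I rule: infinite_finite_induct) simp_all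

lemma pair_lin_ext [simp]: "pair \<phi> (lin_ext g p) = pair (\<lambda>a. pair \<phi> (g a)) p"
  by (simp add: lin_ext_def) (simp add: pair_def)

lemma pair_add_left: "pair (\<lambda>a. \<phi> a + \<psi> a) p = pair \<phi> p + pair \<psi> p"
  by (simp add: pair_def distrib_left sum.distrib)

lemma pair_minus_left: "pair (\<lambda>a. \<phi> a - \<psi> a) p = pair \<phi> p - pair \<psi> p"
  by (simp add: pair_def right_diff_distrib sum_subtractf)

lemma pair_uminus_left: "pair (\<lambda>a. - \<phi> a) p = - pair \<phi> p"
  by (simp add: pair_def sum_negf)

lemma pair_scale_left: "pair (\<lambda>a. c * \<phi> a) p = c * pair \<phi> p"
  by (simp add: pair_def sum_distrib_left mult.left_commute)

lemma pair_zero_left [simp]: "pair (\<lambda>a. 0) p = 0"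
  by (simp add: pair_def)

lemma pair_swap: "pair (\<lambda>a. pair (\<lambda>b. f a b) q) p = pair (\<lambda>b. pair (\<lambda>a. f a b) p) q"
  by (simp add: pair_def sum_distrib_left mult.left_commute) (subst sum.swap, simp)

lemma pair_coefficient: "pair (\<lambda>b. if b = a then 1 else 0) p = lookup p a"
  by (auto simp: pair_def if_distrib cong: if_cong) (simp add: in_keys_iff)

lemma eq_iff_pair: "p = q \<longleftrightarrow> (\<forall>\<phi>. pair \<phi> p = pair \<phi> q)"
proof
  assume *: "\<forall>\<phi>. pair \<phi> p = pair \<phi> q"
  show "p = q"
    by (rule poly_mapping_eqI) (metis * pair_coefficient)
qed simp

text \<open>Every subspace of a vector space is an intersection of kernels: a basis of the span can be
  extended by any vector outside of it, and a functional may be prescribed on that basis. This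
  turns every congruence below into an identity between scalars.\<close>

lemma in_span_iff_pair:
  "x \<in> fsum.span G \<longleftrightarrow> (\<forall>\<phi>. (\<forall>g\<in>G. pair \<phi> g = 0) \<longrightarrow> pair \<phi> x = (0 :: 'k::field))"
proof
  assume x: "x \<in> fsum.span G"
  have "pair \<phi> x = 0" if "\<forall>g\<in>G. pair \<phi> g = 0" for \<phi>
    using x by (induction rule: fsum.span_induct_alt) (use that in simp_all)
  then show "\<forall>\<phi>. (\<forall>g\<in>G. pair \<phi> g = 0) \<longrightarrow> pair \<phi> x = 0" by blast
next
  assume *: "\<forall>\<phi>. (\<forall>g\<in>G. pair \<phi> g = 0) \<longrightarrow> pair \<phi> x = 0"
  show "x \<in> fsum.span G"
  proof (rule ccontr)
    assume x: "x \<notin> fsum.span G"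
    interpret scalars: vector_space "(*) :: 'k \<Rightarrow> 'k \<Rightarrow> 'k"
      by unfold_locales (simp_all add: algebra_simps)
    interpret vector_space_pair "fscale :: 'k \<Rightarrow> ('a \<Rightarrow>\<^sub>0 'k) \<Rightarrow> _" "(*) :: 'k \<Rightarrow> 'k \<Rightarrow> 'k"
      by unfold_locales
    obtain B where B: "B \<subseteq> G" "fsum.independent B" "G \<subseteq> fsum.span B"
      using fsum.maximal_independent_subset by blast
    have "fsum.span G = fsum.span B"
      using B by (metis fsum.span_eq fsum.span_superset subset_trans)
    with x have x': "x \<notin> fsum.span B" by simp
    then obtain g where g: "Vector_Spaces.linear fscale (*) g" "\<forall>b\<in>insert x B. g b = (if b = x then 1 else 0)"
      using linear_independent_extend[OF fsum.independent_insertI[OF x' B(2)],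
          of "\<lambda>b. if b = x then 1 else 0"] by blast
    interpret g: Vector_Spaces.linear fscale "(*)" g by fact
    have g_pair: "pair (\<lambda>a. g (single a 1)) y = g y" for y
    proof -
      have "y = (\<Sum>a\<in>keys y. fscale (lookup y a) (single a 1))"
        by (subst eq_iff_pair) (simp, simp add: pair_def)
      then have "g y = g (\<Sum>a\<in>keys y. fscale (lookup y a) (single a 1))" by simp
      also have "\<dots> = pair (\<lambda>a. g (single a 1)) y"
        by (simp add: g.sum g.scale pair_def)
      finally show ?thesis by simp
    qed
    have "g b = 0" if "b \<in> fsum.span B" for b
      using that
    proof (induction rule: fsum.span_induct_alt)
      case base then show ?case by (rule g.zero)
    next
      case (step c y z)
      have "y \<noteq> x" using x' fsum.span_base[OF step(1)] by blast
      then show ?case using step g(2) by (simp add: g.add g.scale)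
    qed
    then have "\<forall>b\<in>G. pair (\<lambda>a. g (single a 1)) b = 0"
      using B(3) g_pair by auto
    then have "g x = 0" using * g_pair by metis
    with g(2) show False by simp
  qed
qed

section \<open>Tensors and multilinear forms\<close>

definition bilinear_form :: "('k::field, 'v, 'm) superspace_scheme \<Rightarrow> ('v \<Rightarrow> 'v \<Rightarrow> 'k) \<Rightarrow> bool"
  where "bilinear_form V B \<longleftrightarrow>
    (\<forall>a\<in>carrier V. \<forall>b\<in>carrier V. \<forall>c\<in>carrier V.
      B (a \<oplus>\<^bsub>V\<^esub> b) c = B a c + B b c \<and> B c (a \<oplus>\<^bsub>V\<^esub> b) = B c a + B c b) \<and>
    (\<forall>s. \<forall>a\<in>carrier V. \<forall>c\<in>carrier V.
      B (s \<odot>\<^bsub>V\<^esub> a) c = s * B a c \<and> B c (s \<odot>\<^bsub>V\<^esub> a) = s * B c a)"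

definition trilinear_form ::
  "('k::field, 'v, 'm) superspace_scheme \<Rightarrow> ('v \<Rightarrow> 'v \<Rightarrow> 'v \<Rightarrow> 'k) \<Rightarrow> bool"
  where "trilinear_form V T \<longleftrightarrow>
    (\<forall>c\<in>carrier V. bilinear_form V (\<lambda>a b. T a b c) \<and> bilinear_form V (\<lambda>a b. T c a b))"

lemma bilinear_formD:
  assumes "bilinear_form V B"
  shows "a \<in> carrier V \<Longrightarrow> b \<in> carrier V \<Longrightarrow> c \<in> carrier V \<Longrightarrow>
      B (a \<oplus>\<^bsub>V\<^esub> b) c = B a c + B b c"
    "a \<in> carrier V \<Longrightarrow> b \<in> carrier V \<Longrightarrow> c \<in> carrier V \<Longrightarrow>
      B c (a \<oplus>\<^bsub>V\<^esub> b) = B c a + B c b"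
    "a \<in> carrier V \<Longrightarrow> c \<in> carrier V \<Longrightarrow> B (k \<odot>\<^bsub>V\<^esub> a) c = k * B a c"
    "a \<in> carrier V \<Longrightarrow> c \<in> carrier V \<Longrightarrow> B c (k \<odot>\<^bsub>V\<^esub> a) = k * B c a"
  using assms by (auto simp: bilinear_form_def)

text \<open>The functionals that kill the generators of the null space are the bilinear forms.\<close>

lemma tensor2_eq_iff:
  fixes V :: "('k::field, 'v, 'm) superspace_scheme"
  shows
  "tensor2_eq V s t \<longleftrightarrow>
    (\<forall>B. bilinear_form V B \<longrightarrow> pair (\<lambda>(v, w). B v w) s = pair (\<lambda>(v, w). B v w) t)"
proof -
  define G where "G =
    {single (a \<oplus>\<^bsub>V\<^esub> b, c) 1 - single (a, c) 1 - single (b, c) (1::'k) |a b c.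
       a \<in> carrier V \<and> b \<in> carrier V \<and> c \<in> carrier V} \<union>
    {single (c, a \<oplus>\<^bsub>V\<^esub> b) 1 - single (c, a) 1 - single (c, b) 1 |a b c.
       a \<in> carrier V \<and> b \<in> carrier V \<and> c \<in> carrier V} \<union>
    {single (s \<odot>\<^bsub>V\<^esub> a, c) 1 - single (a, c) s |s a c.
       a \<in> carrier V \<and> c \<in> carrier V} \<union>
    {single (c, s \<odot>\<^bsub>V\<^esub> a) 1 - single (c, a) s |s a c.
       a \<in> carrier V \<and> c \<in> carrier V}"
  have G: "(\<forall>g\<in>G. pair (\<lambda>(v, w). B v w) g = 0) \<longleftrightarrow> bilinear_form V B" for B
  proof
    assume *: "\<forall>g\<in>G. pair (\<lambda>(v, w). B v w) g = 0"
    have "B (a \<oplus>\<^bsub>V\<^esub> b) c = B a c + B b c \<and> B c (a \<oplus>\<^bsub>V\<^esub> b) = B c a + B c b"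
      if "a \<in> carrier V" "b \<in> carrier V" "c \<in> carrier V" for a b c
    proof -
      have "single (a \<oplus>\<^bsub>V\<^esub> b, c) 1 - single (a, c) 1 - single (b, c) (1::'k) \<in> G"
        "single (c, a \<oplus>\<^bsub>V\<^esub> b) 1 - single (c, a) 1 - single (c, b) (1::'k) \<in> G"
        unfolding G_def using that by blast+
      then show ?thesis using * by (auto simp: algebra_simps)
    qed
    moreover have "B (s \<odot>\<^bsub>V\<^esub> a) c = s * B a c \<and> B c (s \<odot>\<^bsub>V\<^esub> a) = s * B c a"
      if "a \<in> carrier V" "c \<in> carrier V" for s a c
    proof -
      have "single (s \<odot>\<^bsub>V\<^esub> a, c) 1 - single (a, c) s \<in> G"
        "single (c, s \<odot>\<^bsub>V\<^esub> a) 1 - single (c, a) s \<in> G"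
        unfolding G_def using that by blast+
      then show ?thesis using * by (auto simp: algebra_simps)
    qed
    ultimately show "bilinear_form V B" by (simp add: bilinear_form_def)
  next
    assume B: "bilinear_form V B"
    show "\<forall>g\<in>G. pair (\<lambda>(v, w). B v w) g = 0"
      unfolding G_def by (auto simp: bilinear_formD[OF B])
  qed
  have "tensor2_eq V s t \<longleftrightarrow> s - t \<in> fsum.span G"
    by (simp only: tensor2_eq_def tensor2_null_def G_def)
  also have "\<dots> \<longleftrightarrow> (\<forall>\<phi>. (\<forall>g\<in>G. pair \<phi> g = 0) \<longrightarrow> pair \<phi> (s - t) = 0)"
    by (rule in_span_iff_pair)
  also have "\<dots> \<longleftrightarrow> (\<forall>B. (\<forall>g\<in>G. pair (\<lambda>(v, w). B v w) g = 0) \<longrightarrow> pair (\<lambda>(v, w). B v w) (s - t) = 0)"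
    by (metis case_prod_curry curry_def case_prod_Pair_iden)
  finally show ?thesis by (simp add: G)
qed

lemma tensor3_eqI:
  fixes V :: "('k::field, 'v, 'm) superspace_scheme"
  assumes "\<And>T. trilinear_form V T \<Longrightarrow>
    pair (\<lambda>(u, v, w). T u v w) s = pair (\<lambda>(u, v, w). T u v w) t"
  shows "tensor3_eq V s t"
proof -
  define G1 :: "(_ \<Rightarrow>\<^sub>0 'k) set" where "G1 =
    {single (a \<oplus>\<^bsub>V\<^esub> b, c, d) 1 - single (a, c, d) 1 - single (b, c, d) 1 |a b c d.
       a \<in> carrier V \<and> b \<in> carrier V \<and> c \<in> carrier V \<and> d \<in> carrier V}"
  define G2 :: "(_ \<Rightarrow>\<^sub>0 'k) set" where "G2 =
    {single (c, a \<oplus>\<^bsub>V\<^esub> b, d) 1 - single (c, a, d) 1 - single (c, b, d) 1 |a b c d.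
       a \<in> carrier V \<and> b \<in> carrier V \<and> c \<in> carrier V \<and> d \<in> carrier V}"
  define G3 :: "(_ \<Rightarrow>\<^sub>0 'k) set" where "G3 =
    {single (c, d, a \<oplus>\<^bsub>V\<^esub> b) 1 - single (c, d, a) 1 - single (c, d, b) 1 |a b c d.
       a \<in> carrier V \<and> b \<in> carrier V \<and> c \<in> carrier V \<and> d \<in> carrier V}"
  define G4 :: "(_ \<Rightarrow>\<^sub>0 'k) set" where "G4 =
    {single (s \<odot>\<^bsub>V\<^esub> a, c, d) 1 - single (a, c, d) s |s a c d.
       a \<in> carrier V \<and> c \<in> carrier V \<and> d \<in> carrier V}"
  define G5 :: "(_ \<Rightarrow>\<^sub>0 'k) set" where "G5 =
    {single (c, s \<odot>\<^bsub>V\<^esub> a, d) 1 - single (c, a, d) s |s a c d.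
       a \<in> carrier V \<and> c \<in> carrier V \<and> d \<in> carrier V}"
  define G6 :: "(_ \<Rightarrow>\<^sub>0 'k) set" where "G6 =
    {single (c, d, s \<odot>\<^bsub>V\<^esub> a) 1 - single (c, d, a) s |s a c d.
       a \<in> carrier V \<and> c \<in> carrier V \<and> d \<in> carrier V}"
  define G where "G = G1 \<union> G2 \<union> G3 \<union> G4 \<union> G5 \<union> G6"
  note G_defs = G1_def G2_def G3_def G4_def G5_def G6_def
  have G: "trilinear_form V T" if *: "\<forall>g\<in>G. pair (\<lambda>(u, v, w). T u v w) g = 0" for T
  proof -
    have *: "\<And>g. g \<in> G1 \<Longrightarrow> pair (\<lambda>(u, v, w). T u v w) g = 0"
      "\<And>g. g \<in> G2 \<Longrightarrow> pair (\<lambda>(u, v, w). T u v w) g = 0"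
      "\<And>g. g \<in> G3 \<Longrightarrow> pair (\<lambda>(u, v, w). T u v w) g = 0"
      "\<And>g. g \<in> G4 \<Longrightarrow> pair (\<lambda>(u, v, w). T u v w) g = 0"
      "\<And>g. g \<in> G5 \<Longrightarrow> pair (\<lambda>(u, v, w). T u v w) g = 0"
      "\<And>g. g \<in> G6 \<Longrightarrow> pair (\<lambda>(u, v, w). T u v w) g = 0"
      using * by (simp_all add: G_def)
    have "T (a \<oplus>\<^bsub>V\<^esub> b) c d = T a c d + T b c d \<and> T c (a \<oplus>\<^bsub>V\<^esub> b) d = T c a d + T c b d
        \<and> T c d (a \<oplus>\<^bsub>V\<^esub> b) = T c d a + T c d b"
      if "a \<in> carrier V" "b \<in> carrier V" "c \<in> carrier V" "d \<in> carrier V" for a b c d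
    proof -
      have "single (a \<oplus>\<^bsub>V\<^esub> b, c, d) 1 - single (a, c, d) 1 - single (b, c, d) (1::'k) \<in> G1"
        "single (c, a \<oplus>\<^bsub>V\<^esub> b, d) 1 - single (c, a, d) 1 - single (c, b, d) (1::'k) \<in> G2"
        "single (c, d, a \<oplus>\<^bsub>V\<^esub> b) 1 - single (c, d, a) 1 - single (c, d, b) (1::'k) \<in> G3"
        unfolding G_defs using that by blast+
      from this(1)[THEN *(1)] this(2)[THEN *(2)] this(3)[THEN *(3)]
      show ?thesis by (simp add: algebra_simps)
    qed
    moreover have "T (s \<odot>\<^bsub>V\<^esub> a) c d = s * T a c d \<and> T c (s \<odot>\<^bsub>V\<^esub> a) d = s * T c a d
        \<and> T c d (s \<odot>\<^bsub>V\<^esub> a) = s * T c d a"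
      if "a \<in> carrier V" "c \<in> carrier V" "d \<in> carrier V" for s a c d
    proof -
      have "single (s \<odot>\<^bsub>V\<^esub> a, c, d) 1 - single (a, c, d) s \<in> G4"
        "single (c, s \<odot>\<^bsub>V\<^esub> a, d) 1 - single (c, a, d) s \<in> G5"
        "single (c, d, s \<odot>\<^bsub>V\<^esub> a) 1 - single (c, d, a) s \<in> G6"
        unfolding G_defs using that by blast+
      from this(1)[THEN *(4)] this(2)[THEN *(5)] this(3)[THEN *(6)]
      show ?thesis by (simp add: algebra_simps)
    qed
    ultimately show ?thesis by (simp add: trilinear_form_def bilinear_form_def)
  qed
  have "pair \<phi> (s - t) = 0" if "\<forall>g\<in>G. pair \<phi> g = 0" for \<phi>
  proof -
    define T where "T = (\<lambda>u v w. \<phi> (u, v, w))"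
    have T: "\<phi> = (\<lambda>(u, v, w). T u v w)" by (auto simp: T_def)
    have "trilinear_form V T" using that by (intro G) (simp only: T)
    from assms[OF this] show ?thesis by (simp add: T)
  qed
  then have "s - t \<in> fsum.span G" by (simp add: in_span_iff_pair)
  then show ?thesis by (simp only: tensor3_eq_def tensor3_null_def G_def G_defs)
qed

section \<open>The free superalgebra and the ideal of a presentation\<close>

text \<open>Sums of parities stay sums, to match the additivity of the parity under brackets.\<close>

declare add_bit_eq_xor [simp del] mult_bit_eq_and [simp del]

lemma bit_add_self [simp]: "p + p = 0" "p + (p + q) = (q :: bit)"
  by (cases p; cases q; simp add: add_bit_eq_xor)+

lemma psign_simps [simp]:
  "psign 0 = 1" "psign 1 = -1" "psign p * psign p = (1::'k::field)"
  "psign p * (psign p * c) = (c::'k)"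
  by (auto simp: psign_def)

lemma psign_mult_add: "psign (p * (q + r)) = (psign (p * q) * psign (p * r) :: 'k::field)"
  by (cases p; cases q; cases r) simp_all

lemma fscale_simps [simp]: "fscale 1 x = x" "fscale (-1) x = - x" "fscale 0 x = 0"
  by (simp_all add: eq_iff_pair)

lemma pair_free_bracket [simp]:
  "pair \<phi> (free_bracket x y) = pair (\<lambda>u. pair (\<lambda>v. \<phi> (Br u v)) y) x"
  by (simp add: free_bracket_def)

lemma free_bracket_linear:
  "free_bracket (x + y) z = free_bracket x z + free_bracket y z"
  "free_bracket x (y + z) = free_bracket x y + free_bracket x z"
  "free_bracket (x - y) z = free_bracket x z - free_bracket y z"
  "free_bracket x (y - z) = free_bracket x y - free_bracket x z"
  "free_bracket (fscale s x) y = fscale s (free_bracket x y)"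
  "free_bracket x (fscale s y) = fscale s (free_bracket x y)"
  by (simp_all add: eq_iff_pair pair_add_left pair_minus_left pair_scale_left)

lemma free_part_pair_cong:
  "x \<in> free_part par p \<Longrightarrow> (\<And>u. mparity par u = p \<Longrightarrow> \<phi> u = \<psi> u) \<Longrightarrow> pair \<phi> x = pair \<psi> x"
  by (rule pair_cong) (simp add: free_part_def)

lemma free_partI:
  fixes x :: "'x monomial \<Rightarrow>\<^sub>0 'k::field"
  assumes "\<And>\<phi>. (\<And>u. mparity par u = p \<Longrightarrow> \<phi> u = 0) \<Longrightarrow> pair \<phi> x = 0"
  shows "x \<in> free_part par p"
proof -
  have "lookup x u = 0" if u: "mparity par u \<noteq> p" for u
  proof -
    have "pair (\<lambda>v. if v = u then 1 else 0) x = 0" by (rule assms) (use u in auto)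
    then show ?thesis by (simp add: pair_coefficient)
  qed
  then show ?thesis by (auto simp: free_part_def in_keys_iff)
qed

lemma free_part_zero [simp]: "0 \<in> free_part par p"
  by (simp add: free_part_def)

lemma free_part_mon [simp]: "mon u \<in> free_part par p \<longleftrightarrow> mparity par u = p"
  by (simp add: free_part_def)

lemma free_part_linear:
  assumes "x \<in> free_part par p" "y \<in> free_part par p"
  shows "x + y \<in> free_part par p" "x - y \<in> free_part par p"
  using assms by (auto intro!: free_partI simp: free_part_pair_cong[where \<psi> = "\<lambda>_. 0"])

lemma free_part_fscale: "x \<in> free_part par p \<Longrightarrow> fscale s x \<in> free_part par p"
  by (auto intro!: free_partI simp: free_part_pair_cong[where \<psi> = "\<lambda>_. 0"])

lemma free_part_bracket:
  assumes "x \<in> free_part par p" "y \<in> free_part par q"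
  shows "free_bracket x y \<in> free_part par (p + q)"
proof (rule free_partI)
  fix \<phi> :: "'a monomial \<Rightarrow> 'b" assume \<phi>: "\<And>u. mparity par u = p + q \<Longrightarrow> \<phi> u = 0"
  have "pair (\<lambda>v. \<phi> (Br u v)) y = 0" if "mparity par u = p" for u
    using free_part_pair_cong[OF assms(2), of "\<lambda>v. \<phi> (Br u v)" "\<lambda>_. 0"] \<phi> that by simp
  then show "pair \<phi> (free_bracket x y) = 0"
    using free_part_pair_cong[OF assms(1), of "\<lambda>u. pair (\<lambda>v. \<phi> (Br u v)) y" "\<lambda>_. 0"] by simp
qed

lemma free_part_bracket_flip:
  "x \<in> free_part par p \<Longrightarrow> y \<in> free_part par q \<Longrightarrow> free_bracket y x \<in> free_part par (p + q)"
  using free_part_bracket[of y par q x p] by (simp add: add.commute)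

definition component :: "('x \<Rightarrow> bit) \<Rightarrow> bit \<Rightarrow> ('x monomial \<Rightarrow>\<^sub>0 'k::field) \<Rightarrow> ('x monomial \<Rightarrow>\<^sub>0 'k)"
  where "component par p = lin_ext (\<lambda>u. if mparity par u = p then mon u else 0)"

lemma pair_component [simp]:
  "pair \<phi> (component par p x) = pair (\<lambda>u. if mparity par u = p then \<phi> u else 0) x"
  by (simp add: component_def if_distrib cong: if_cong)

lemma component_free_part: "component par p x \<in> free_part par p"
  by (rule free_partI) (simp cong: if_cong)

lemma component_decomposition: "x = component par p x + component par (p + 1) x"
proof -
  have "(if mparity par u = p then c else 0) + (if mparity par u = p + 1 then c else 0) = c"
    for u and c :: 'b
    by (cases "mparity par u"; cases p) simp_all
  then show ?thesis by (simp add: eq_iff_pair flip: pair_add_left)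
qed

lemma component_homogeneous:
  assumes "x \<in> free_part par q"
  shows "component par p x = (if p = q then x else 0)"
proof -
  have "pair (\<lambda>u. if mparity par u = p then \<phi> u else 0) x = (if p = q then pair \<phi> x else 0)" for \<phi>
    using free_part_pair_cong[OF assms, of "\<lambda>u. if mparity par u = p then \<phi> u else 0"
        "\<lambda>u. if p = q then \<phi> u else 0"] by simp
  then show ?thesis by (simp add: eq_iff_pair)
qed

text \<open>The dual space of the quotient by the ideal.\<close>

definition annihilator ::
  "('x \<Rightarrow> bit) \<Rightarrow> ('x monomial \<Rightarrow>\<^sub>0 'k::field) set \<Rightarrow> ('x monomial \<Rightarrow> 'k) set"
  where "annihilator par R = {\<phi>. \<forall>x\<in>presented_ideal par R. pair \<phi> x = 0}"

lemma annihilatorD: "\<phi> \<in> annihilator par R \<Longrightarrow> x \<in> presented_ideal par R \<Longrightarrow> pair \<phi> x = 0"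
  by (simp add: annihilator_def)

lemma in_presented_ideal_iff:
  "x \<in> presented_ideal par R \<longleftrightarrow> (\<forall>\<phi>\<in>annihilator par R. pair \<phi> x = 0)"
proof -
  have "fsum.subspace (presented_ideal par R)"
    by (rule fsum.subspaceI) (auto intro: presented_ideal.intros)
  then have "fsum.span (presented_ideal par R) = presented_ideal par R"
    by simp
  with in_span_iff_pair[of x "presented_ideal par R"] show ?thesis
    by (auto simp: annihilator_def)
qed

lemma annihilator_Br:
  assumes "\<phi> \<in> annihilator par R"
  shows "(\<lambda>v. \<phi> (Br u v)) \<in> annihilator par R" "(\<lambda>v. \<phi> (Br v u)) \<in> annihilator par R"
  using annihilatorD[OF assms presented_ideal.left[where y = "mon u"]]
    annihilatorD[OF assms presented_ideal.right[where y = "mon u"]]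
  by (auto simp: annihilator_def)

lemma annihilator_linear:
  assumes "\<phi> \<in> annihilator par R" "\<psi> \<in> annihilator par R"
  shows "(\<lambda>u. \<phi> u + \<psi> u) \<in> annihilator par R" "(\<lambda>u. \<phi> u - \<psi> u) \<in> annihilator par R"
  using assms by (auto simp: annihilator_def pair_add_left pair_minus_left)

lemma annihilator_scale:
  assumes "\<phi> \<in> annihilator par R"
  shows "(\<lambda>u. k * \<phi> u) \<in> annihilator par R" "(\<lambda>u. - \<phi> u) \<in> annihilator par R"
  using assms by (auto simp: annihilator_def pair_scale_left pair_uminus_left)

lemma annihilator_pair:
  "(\<And>a. a \<in> keys p \<Longrightarrow> \<phi> a \<in> annihilator par R) \<Longrightarrow> (\<lambda>u. pair (\<lambda>a. \<phi> a u) p) \<in> annihilator par R"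
  by (auto simp: annihilator_def pair_swap[of _ p] cong: pair_cong)

lemma annihilator_zero [simp]: "(\<lambda>u. 0) \<in> annihilator par R"
  by (simp add: annihilator_def)

lemma annihilator_skew:
  fixes \<phi> :: "'x monomial \<Rightarrow> 'k::field"
  assumes "\<phi> \<in> annihilator par R"
  shows "\<phi> (Br u v) = - psign (mparity par u * mparity par v) * \<phi> (Br v u)"
proof -
  have "free_bracket (mon u) (mon v)
      + fscale (psign (mparity par u * mparity par v)) (free_bracket (mon v) (mon u :: _ \<Rightarrow>\<^sub>0 'k))
      \<in> presented_ideal par R"
    by (rule presented_ideal.skew) simp_all
  from annihilatorD[OF assms this] show ?thesis by (simp add: eq_neg_iff_add_eq_0)
qed

lemma annihilator_jacobi:
  fixes \<phi> :: "'x monomial \<Rightarrow> 'k::field"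
  assumes "\<phi> \<in> annihilator par R"
  shows "\<phi> (Br u (Br v w)) =
    \<phi> (Br (Br u v) w) + psign (mparity par u * mparity par v) * \<phi> (Br v (Br u w))"
proof -
  have "free_bracket (mon u) (free_bracket (mon v) (mon w))
      - free_bracket (free_bracket (mon u) (mon v)) (mon w)
      - fscale (psign (mparity par u * mparity par v))
          (free_bracket (mon v) (free_bracket (mon u) (mon w :: _ \<Rightarrow>\<^sub>0 'k)))
      \<in> presented_ideal par R"
    by (rule presented_ideal.jacobi[where r = "mparity par w"]) simp_all
  from annihilatorD[OF assms this] show ?thesis by (simp add: algebra_simps)
qed

lemma annihilator_relator: "\<phi> \<in> annihilator par R \<Longrightarrow> x \<in> R \<Longrightarrow> pair \<phi> x = 0"
  by (blast intro: annihilatorD presented_ideal.relator)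

text \<open>The ideal is homogeneous: truncating a functional to one parity commutes, up to a shift of that
  parity, with bracketing by a monomial, and the other generators of the ideal are homogeneous.\<close>

lemma annihilator_homogeneous:
  assumes R: "\<And>x. x \<in> R \<Longrightarrow> \<exists>p. x \<in> free_part par p"
    and \<phi>: "\<phi> \<in> annihilator par R"
  shows "(\<lambda>u. if mparity par u = p then \<phi> u else 0) \<in> annihilator par R"
proof -
  have hom: "pair (\<lambda>u. if mparity par u = p then \<phi> u else 0) x = 0"
    if "x \<in> presented_ideal par R" "x \<in> free_part par q" "\<phi> \<in> annihilator par R" for x p q \<phi>
    using component_homogeneous[OF that(2), of p] annihilatorD[OF that(3,1)]
    by (simp flip: pair_component)
  have "pair (\<lambda>u. if mparity par u = p then \<phi> u else 0) x = 0"
    if "x \<in> presented_ideal par R" "\<phi> \<in> annihilator par R" for x p \<phi>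
    using that
  proof (induction arbitrary: \<phi> p rule: presented_ideal.induct)
    case (relator x)
    then show ?case using R hom presented_ideal.relator by blast
  next
    case skew
    show ?case
      by (rule hom[OF presented_ideal.skew[OF skew(1,2)] free_part_linear(1)[OF
              free_part_bracket[OF skew(1,2)]
              free_part_fscale[OF free_part_bracket_flip[OF skew(1,2)]]] skew(3)])
  next
    case (jacobi x a y b z r)
    have "free_bracket y (free_bracket x z) \<in> free_part par (a + (b + r))"
      using free_part_bracket[OF jacobi(2) free_part_bracket[OF jacobi(1,3)]]
      by (simp add: add.left_commute)
    moreover have "free_bracket (free_bracket x y) z \<in> free_part par (a + (b + r))"
      using free_part_bracket[OF free_part_bracket[OF jacobi(1,2)] jacobi(3)]
      by (simp add: add.assoc)
    ultimately show ?case using jacobi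
      by (intro hom[where q = "a + (b + r)"] presented_ideal.jacobi free_part_linear free_part_fscale)
        (auto intro: free_part_bracket)
  next
    case (left x y)
    have "pair (\<lambda>v. if mparity par (Br u v) = p then \<phi> (Br u v) else 0) x = 0" for u
    proof -
      have *: "mparity par (Br u v) = p \<longleftrightarrow> mparity par v = p + mparity par u" for v
        by (cases "mparity par u"; cases "mparity par v"; cases p) simp_all
      show ?thesis
        unfolding * by (rule left.IH) (rule annihilator_Br[OF left.prems])
    qed
    then show ?case by simp
  next
    case (right x y)
    have "pair (\<lambda>v. if mparity par (Br v u) = p then \<phi> (Br v u) else 0) x = 0" for u
    proof -
      have *: "mparity par (Br v u) = p \<longleftrightarrow> mparity par v = p + mparity par u" for v
        by (cases "mparity par u"; cases "mparity par v"; cases p) simp_all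
      show ?thesis
        unfolding * by (rule right.IH) (rule annihilator_Br[OF right.prems])
    qed
    then show ?case by (subst pair_free_bracket, subst pair_swap) simp
  qed simp_all
  with \<phi> show ?thesis by (auto simp: annihilator_def)
qed

section \<open>The quotient as a Lie superalgebra\<close>

locale presentation =
  fixes par :: "'x \<Rightarrow> bit" and R :: "('x monomial \<Rightarrow>\<^sub>0 'k::field) set"
    and c :: "'x \<Rightarrow> ('x monomial \<times> 'x monomial \<Rightarrow>\<^sub>0 'k)"
  assumes relators_homogeneous: "x \<in> R \<Longrightarrow> \<exists>p. x \<in> free_part par p"
begin

abbreviation "I \<equiv> presented_ideal par R"
abbreviation "Ann \<equiv> annihilator par R"
abbreviation "cl \<equiv> coset_of I"
abbreviation "Q \<equiv> presented_superbialgebra par R c"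

lemma cl_eq_iff: "cl x = cl y \<longleftrightarrow> x - y \<in> I"
proof
  assume "cl x = cl y"
  then have "x \<in> cl y" using presented_ideal.zero by (force simp: coset_of_def)
  then show "x - y \<in> I" by (simp add: coset_of_def)
next
  assume "x - y \<in> I"
  then have "z - x \<in> I \<longleftrightarrow> z - y \<in> I" for z
    by (auto simp: in_presented_ideal_iff)
  then show "cl x = cl y" by (simp add: coset_of_def)
qed

lemma cl_eq_iff_pair: "cl x = cl y \<longleftrightarrow> (\<forall>\<phi>\<in>Ann. pair \<phi> x = pair \<phi> y)"
  by (simp add: cl_eq_iff in_presented_ideal_iff)

lemma pair_rep_cl: "\<phi> \<in> Ann \<Longrightarrow> pair \<phi> (rep (cl x)) = pair \<phi> x"
proof -
  have "x \<in> cl x" using presented_ideal.zero by (simp add: coset_of_def)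
  then have "rep (cl x) \<in> cl x" unfolding rep_def by (rule someI)
  then have "rep (cl x) - x \<in> I" by (simp add: coset_of_def)
  then show "\<phi> \<in> Ann \<Longrightarrow> pair \<phi> (rep (cl x)) = pair \<phi> x"
    by (simp add: in_presented_ideal_iff)
qed

lemma Q_simps:
  "carrier Q = range cl" "\<zero>\<^bsub>Q\<^esub> = cl 0" "part Q p = cl ` free_part par p"
  by (simp_all add: presented_superbialgebra_def Let_def)

lemma Q_add: "cl x \<oplus>\<^bsub>Q\<^esub> cl y = cl (x + y)"
  by (simp add: presented_superbialgebra_def Let_def cl_eq_iff_pair pair_rep_cl)

lemma Q_smult: "s \<odot>\<^bsub>Q\<^esub> cl x = cl (fscale s x)"
  by (simp add: presented_superbialgebra_def Let_def cl_eq_iff_pair pair_rep_cl)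

lemma Q_bracket: "bracket Q (cl x) (cl y) = cl (free_bracket x y)"
proof -
  have "pair \<phi> (free_bracket (rep (cl x)) (rep (cl y))) = pair \<phi> (free_bracket x y)"
    if "\<phi> \<in> Ann" for \<phi>
    using that by (simp add: pair_rep_cl annihilator_Br annihilator_pair)
  then show ?thesis
    by (simp add: presented_superbialgebra_def Let_def cl_eq_iff_pair del: pair_free_bracket)
qed

lemmas Q_ops = Q_add Q_smult Q_bracket

lemma Q_partE:
  assumes "S \<in> part Q p" obtains x where "x \<in> free_part par p" "S = cl x"
  using assms by (auto simp: Q_simps)

lemma Q_carrierE:
  assumes "S \<in> carrier Q" obtains x where "S = cl x"
  using assms by (auto simp: Q_simps)

lemma cl_in_carrier [simp]: "cl x \<in> carrier Q"
  by (simp add: Q_simps)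

lemma cl_in_part: "x \<in> free_part par p \<Longrightarrow> cl x \<in> part Q p"
  by (simp add: Q_simps)

lemma component_in_ideal: "x \<in> I \<Longrightarrow> component par p x \<in> I"
  unfolding in_presented_ideal_iff
  by (auto intro!: annihilator_homogeneous relators_homogeneous)

text \<open>Homogeneous components are determined by the class modulo the ideal, because the ideal contains
  the components of its elements.\<close>

lemma Q_homogeneous_eqD:
  assumes "a \<in> free_part par p" "b \<in> free_part par (p + 1)"
    and "a' \<in> free_part par p" "b' \<in> free_part par (p + 1)"
    and "cl (a + b) = cl (a' + b')"
  shows "cl a = cl a'"
proof -
  have "component par p (a + b - (a' + b')) \<in> I"
    using assms(5) by (intro component_in_ideal) (simp add: cl_eq_iff)
  moreover have "component par p (a + b - (a' + b')) = a - a'"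
  proof -
    have "component par p (a + b - (a' + b'))
        = component par p a + component par p b - component par p a' - component par p b'"
      by (simp add: eq_iff_pair)
    then show ?thesis using assms(1-4) by (simp add: component_homogeneous)
  qed
  ultimately show ?thesis by (simp add: cl_eq_iff)
qed

lemma homcomp_cl:
  assumes "x \<in> free_part par p"
  shows "homcomp Q q (cl x) = (if q = p then cl x else cl 0)"
proof -
  have "homcomp Q q (cl x) = cl (component par q x)"
    unfolding homcomp_def
  proof (rule the_equality)
    show "cl (component par q x) \<in> part Q q \<and>
        (\<exists>b\<in>part Q (q + 1). cl x = cl (component par q x) \<oplus>\<^bsub>Q\<^esub> b)"
      using component_free_part component_decomposition[of x par q]
      by (auto simp: Q_simps Q_ops intro!: bexI[of _ "component par (q + 1) x"])
  next
    fix S assume "S \<in> part Q q \<and> (\<exists>b\<in>part Q (q + 1). cl x = S \<oplus>\<^bsub>Q\<^esub> b)"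
    then obtain a b where ab: "S = cl a" "a \<in> free_part par q" "b \<in> free_part par (q + 1)"
      "cl x = cl (a + b)"
      by (auto simp: Q_simps Q_ops)
    then show "S = cl (component par q x)"
      using Q_homogeneous_eqD[OF ab(2,3) component_free_part component_free_part, of x x]
        component_decomposition[of x par q] by simp
  qed
  then show ?thesis using component_homogeneous[OF assms] by simp
qed

lemma ring_of_type_simps [simp]:
  "carrier (ring_of_type_algebra :: 'k ring) = UNIV"
  "x \<oplus>\<^bsub>ring_of_type_algebra\<^esub> y = (x + y :: 'k)"
  "x \<otimes>\<^bsub>ring_of_type_algebra\<^esub> y = (x * y :: 'k)"
  "\<one>\<^bsub>ring_of_type_algebra\<^esub> = (1 :: 'k)"
  by (simp_all add: ring_of_type_algebra_def)

lemma Q_module: "Module.module (ring_of_type_algebra :: 'k ring) Q"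
proof (rule moduleI)
  show "cring (ring_of_type_algebra :: 'k ring)" by (rule cring_from_type_algebra)
  show "abelian_group Q"
  proof (rule abelian_groupI)
    fix S assume "S \<in> carrier Q"
    then obtain x where "S = cl x" by (rule Q_carrierE)
    then have "cl (- x) \<oplus>\<^bsub>Q\<^esub> S = \<zero>\<^bsub>Q\<^esub>" by (simp add: Q_simps Q_ops)
    then show "\<exists>T\<in>carrier Q. T \<oplus>\<^bsub>Q\<^esub> S = \<zero>\<^bsub>Q\<^esub>" by (auto simp: Q_simps)
  qed (auto simp: Q_simps Q_ops ac_simps)
qed (auto simp: Q_simps Q_ops cl_eq_iff_pair algebra_simps)

lemma Q_superspace: "superspace Q"
proof (intro superspace.intro superspace_axioms.intro Q_module)
  interpret M: Module.module "ring_of_type_algebra :: 'k ring" Q by (rule Q_module)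
  show "submodule (part Q p) (ring_of_type_algebra :: 'k ring) Q" for p
  proof (rule M.submoduleI)
    fix S assume "S \<in> part Q p"
    then obtain x where x: "S = cl x" "x \<in> free_part par p" by (auto simp: Q_simps)
    have "\<ominus>\<^bsub>Q\<^esub> cl x = cl (fscale (- 1) x)"
      by (rule M.minus_equality) (simp_all add: Q_simps Q_ops)
    then show "\<ominus>\<^bsub>Q\<^esub> S \<in> part Q p"
      using x free_part_fscale[of x par p "- 1"] by (simp add: Q_simps del: fscale_simps)
  qed (auto simp: Q_simps Q_ops intro: free_part_linear free_part_fscale)
  fix S assume "S \<in> carrier Q"
  then obtain x where S: "S = cl x" by (rule Q_carrierE)
  show "\<exists>!ab. fst ab \<in> part Q 0 \<and> snd ab \<in> part Q 1 \<and> S = fst ab \<oplus>\<^bsub>Q\<^esub> snd ab"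
  proof (rule ex1I[of _ "(cl (component par 0 x), cl (component par 1 x))"])
    show "fst (cl (component par 0 x), cl (component par 1 x)) \<in> part Q 0 \<and>
      snd (cl (component par 0 x), cl (component par 1 x)) \<in> part Q 1 \<and>
      S = fst (cl (component par 0 x), cl (component par 1 x)) \<oplus>\<^bsub>Q\<^esub>
        snd (cl (component par 0 x), cl (component par 1 x))"
      using component_decomposition[of x par 0]
      by (simp add: S Q_ops cl_in_part component_free_part)
  next
    fix ab assume *: "fst ab \<in> part Q 0 \<and> snd ab \<in> part Q 1 \<and> S = fst ab \<oplus>\<^bsub>Q\<^esub> snd ab"
    obtain A B where ab: "ab = (A, B)" by (cases ab)
    from * obtain a b where a: "A = cl a" "B = cl b" "a \<in> free_part par 0" "b \<in> free_part par 1"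
      and "cl (component par 0 x + component par 1 x) = cl (a + b)"
      using component_decomposition[of x par 0] by (auto simp: ab Q_simps Q_ops S)
    then have "cl (component par 0 x) = cl a" "cl (component par 1 x) = cl b"
      using Q_homogeneous_eqD[of "component par 0 x" 0 "component par 1 x" a b]
        Q_homogeneous_eqD[of "component par 1 x" 1 "component par 0 x" b a]
      by (simp_all add: component_free_part add.commute)
    with a show "ab = (cl (component par 0 x), cl (component par 1 x))" by (simp add: ab)
  qed
qed

lemma Q_lie_superalgebra: "lie_superalgebra Q"
proof (intro lie_superalgebra.intro lie_superalgebra_axioms.intro Q_superspace)
  fix S T p q assume "S \<in> part Q p" "T \<in> part Q q"
  then obtain x y where xy: "x \<in> free_part par p" "y \<in> free_part par q" "S = cl x" "T = cl y"
    by (auto elim!: Q_partE)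
  then show "bracket Q S T \<in> part Q (p + q)"
    by (simp add: Q_ops cl_in_part free_part_bracket)
  show "bracket Q S T = (- psign (p * q)) \<odot>\<^bsub>Q\<^esub> bracket Q T S"
    using presented_ideal.skew[OF xy(1,2), of R]
    by (simp add: xy Q_ops cl_eq_iff fsum.scale_minus_left)
  fix U r assume "U \<in> part Q r"
  then obtain z where z: "z \<in> free_part par r" "U = cl z" by (rule Q_partE)
  show "bracket Q S (bracket Q T U) =
      bracket Q (bracket Q S T) U \<oplus>\<^bsub>Q\<^esub> psign (p * q) \<odot>\<^bsub>Q\<^esub> bracket Q T (bracket Q S U)"
    using presented_ideal.jacobi[OF xy(1,2) z(1), of R]
    by (simp add: xy z Q_ops cl_eq_iff diff_diff_eq)
qed (auto simp: Q_simps Q_ops free_bracket_linear)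

end

section \<open>Cobrackets on monomials\<close>

text \<open>A tensor of monomials is known through the values of all functions \<open>B\<close> of two monomials on it.
  So the cobracket is studied through \<open>cob u B\<close>, the value of \<open>B\<close> on the cobracket of \<open>u\<close>, and
  the action of \<open>u\<close> on tensors through its transpose \<open>act u\<close>; the recursive equation of the
  cobracket turns into \<open>cob_Br\<close>.\<close>

locale super_cobracket =
  fixes par :: "'x \<Rightarrow> bit" and c :: "'x \<Rightarrow> ('x monomial \<times> 'x monomial \<Rightarrow>\<^sub>0 'k::field)"
begin

abbreviation deg :: "'x monomial \<Rightarrow> bit" where "deg \<equiv> mparity par"

abbreviation s :: "'x monomial \<Rightarrow> 'x monomial \<Rightarrow> 'k" where "s u v \<equiv> psign (deg u * deg v)"

definition cob :: "'x monomial \<Rightarrow> ('x monomial \<Rightarrow> 'x monomial \<Rightarrow> 'k) \<Rightarrow> 'k"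
  where "cob u B = pair (\<lambda>(a, b). B a b) (mcobracket par c u)"

definition act :: "'x monomial \<Rightarrow> ('x monomial \<Rightarrow> 'x monomial \<Rightarrow> 'k) \<Rightarrow> 'x monomial \<Rightarrow> 'x monomial \<Rightarrow> 'k"
  where "act u B = (\<lambda>a b. B (Br u a) b + s u a * B a (Br u b))"

lemma cob_Gen: "cob (Gen g) B = pair (\<lambda>(a, b). B a b) (c g)"
  by (simp add: cob_def)

lemma cob_Br: "cob (Br u v) B = cob v (act u B) - s u v * cob u (act v B)"
  by (simp add: cob_def mact_def act_def case_prod_beta')

lemma cob_linear:
  "cob u (\<lambda>a b. B a b + B' a b) = cob u B + cob u B'"
  "cob u (\<lambda>a b. B a b - B' a b) = cob u B - cob u B'"
  "cob u (\<lambda>a b. - B a b) = - cob u B"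
  "cob u (\<lambda>a b. k * B a b) = k * cob u B"
  by (simp_all add: cob_def case_prod_beta' pair_add_left pair_minus_left pair_uminus_left
      pair_scale_left)

lemma cob_zero [simp]: "cob u (\<lambda>a b. 0) = 0"
  by (simp add: cob_def case_prod_beta')

lemma cob_swap: "cob u (\<lambda>a b. cob v (\<lambda>p q. K a b p q)) = cob v (\<lambda>p q. cob u (\<lambda>a b. K a b p q))"
  by (simp add: cob_def case_prod_beta' pair_swap[of _ "mcobracket par c v"])

end

locale even_cobracket = super_cobracket par c
  for par :: "'x \<Rightarrow> bit" and c :: "'x \<Rightarrow> ('x monomial \<times> 'x monomial \<Rightarrow>\<^sub>0 'k::field)" +
  assumes c_even: "(u, v) \<in> keys (c g) \<Longrightarrow> mparity par u + mparity par v = par g"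
    and c_skew: "pair (\<lambda>(u, v). B u v) (c g) =
      - pair (\<lambda>(u, v). psign (mparity par u * mparity par v) * B v u) (c g)"
begin

text \<open>The cobracket is even, so only pairs of the right total parity matter.\<close>

lemma cob_cong:
  "(\<And>a b. deg a + deg b = deg u \<Longrightarrow> B a b = B' a b) \<Longrightarrow> cob u B = cob u B'"
proof (induction u arbitrary: B B')
  case (Gen g)
  then show ?case unfolding cob_Gen by (intro pair_cong) (auto dest: c_even)
next
  case (Br u v)
  have "cob v (act u B) = cob v (act u B')"
    by (rule Br.IH) (auto simp: act_def Br.prems ac_simps)
  moreover have "cob u (act v B) = cob u (act v B')"
    by (rule Br.IH) (auto simp: act_def Br.prems ac_simps)
  ultimately show ?case by (simp add: cob_Br)
qed

lemma mcobracket_even: "(a, b) \<in> keys (mcobracket par c u) \<Longrightarrow> deg a + deg b = deg u"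
proof (rule ccontr)
  assume ab: "(a, b) \<in> keys (mcobracket par c u)" "deg a + deg b \<noteq> deg u"
  have "cob u (\<lambda>a' b'. if (a', b') = (a, b) then 1 else 0) = cob u (\<lambda>_ _. 0)"
    by (rule cob_cong) (use ab in auto)
  moreover have "cob u (\<lambda>a' b'. if (a', b') = (a, b) then 1 else 0)
      = lookup (mcobracket par c u) (a, b)"
    unfolding cob_def pair_coefficient[symmetric] by (rule pair_cong) (auto split: if_splits)
  ultimately show False
    using ab(1) by (simp add: in_keys_iff)
qed

text \<open>Skew-symmetry passes from the generators to all monomials because the action of a monomial commutes
  with the flip.\<close>

lemma cob_skew: "cob u B = - cob u (\<lambda>a b. s a b * B b a)"
proof (induction u arbitrary: B)
  case (Gen g)
  show ?case unfolding cob_Gen by (rule c_skew)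
next
  case (Br u v)
  have flip: "(\<lambda>a b. s a b * act w B b a) = act w (\<lambda>a b. s a b * B b a)" for w
  proof (intro ext)
    fix a b
    show "s a b * act w B b a = act w (\<lambda>a b. s a b * B b a) a b"
      by (cases "deg w"; cases "deg a"; cases "deg b") (simp_all add: act_def)
  qed
  show ?case
    unfolding cob_Br using Br.IH(1)[of "act v B"] Br.IH(2)[of "act u B"] by (simp add: flip)
qed

text \<open>The transposed action on the tensor cube.\<close>

definition act3 where "act3 u T = (\<lambda>a b d. T (Br u a) b d + s u a * T a (Br u b) d
  + s u a * s u b * T a b (Br u d))"

definition cojacobi_left where
  "cojacobi_left u T = cob u (\<lambda>v w. cob v (\<lambda>a b. T a b w))"

definition cojacobi_right where
  "cojacobi_right u T = cob u (\<lambda>v w. cob w (\<lambda>a b. T v a b))"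

text \<open>The transpose of \<open>id \<otimes> \<tau>\<close>.\<close>

definition flip23 where "flip23 T = (\<lambda>a b d. s b d * T a d b)"

definition cojacobiator where
  "cojacobiator u T = cojacobi_left u T - cojacobi_right u T - cojacobi_left u (flip23 T)"

lemma act3_flip23: "act3 u (flip23 T) = flip23 (act3 u T)"
proof (intro ext)
  fix a b d
  show "act3 u (flip23 T) a b d = flip23 (act3 u T) a b d"
    by (cases "deg u"; cases "deg a"; cases "deg b"; cases "deg d")
      (simp_all add: act3_def flip23_def)
qed

text \<open>Acting by \<open>u\<close> before the second cobracket differs from acting on the resulting
  triple tensor: the cobracket of a bracket with \<open>u\<close> also contains the cobracket of \<open>u\<close>. The last
  term is that contribution.\<close>

lemma cojacobi_left_act:
  "act u (\<lambda>v w. cob v (\<lambda>a b. T a b w)) p q = cob p (\<lambda>a b. act3 u T a b q)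
    - s u p * cob u (\<lambda>a b. act p (\<lambda>a b. T a b q) a b)"
proof -
  have "s u p * cob p (\<lambda>a b. T a b (Br u q)) = cob p (\<lambda>a b. s u a * s u b * T a b (Br u q))"
    unfolding cob_linear(4)[symmetric]
    by (rule cob_cong) (simp flip: psign_mult_add)
  then show ?thesis
    by (simp add: act_def[of u "\<lambda>v w. cob v (\<lambda>a b. T a b w)"] cob_Br act3_def cob_linear)
      (simp add: act_def cob_linear)
qed

lemma cojacobi_left_Br:
  "cojacobi_left (Br u v) T = cojacobi_left v (act3 u T) - s u v * cojacobi_left u (act3 v T)
    - cob v (\<lambda>p q. cob u (\<lambda>a b. s u p * act p (\<lambda>a b. T a b q) a b))
    + s u v * cob u (\<lambda>a b. cob v (\<lambda>p q. s v a * act a (\<lambda>p q. T p q b) p q))"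
  by (simp add: cojacobi_left_def cob_Br cojacobi_left_act[abs_def] cob_linear right_diff_distrib)

lemma cojacobi_right_act:
  "act u (\<lambda>v w. cob w (\<lambda>a b. T v a b)) p q = cob q (\<lambda>a b. act3 u T p a b)
    - s u p * s u q * cob u (\<lambda>a b. act q (\<lambda>a b. T p a b) a b)"
  by (simp add: act_def[of u "\<lambda>v w. cob w (\<lambda>a b. T v a b)"] cob_Br act3_def cob_linear)
    (simp add: act_def cob_linear distrib_left right_diff_distrib mult.assoc)

lemma cojacobi_right_Br:
  "cojacobi_right (Br u v) T = cojacobi_right v (act3 u T) - s u v * cojacobi_right u (act3 v T)
    - cob v (\<lambda>p q. cob u (\<lambda>a b. s u p * s u q * act q (\<lambda>a b. T p a b) a b))
    + s u v * cob u (\<lambda>a b. cob v (\<lambda>p q. s v a * s v b * act b (\<lambda>p q. T a p q) p q))"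
  by (simp add: cojacobi_right_def cob_Br cojacobi_right_act[abs_def] cob_linear
      right_diff_distrib)

end

section \<open>Multilinear forms on the quotient\<close>

locale cobracket_presentation = presentation par R c + even_cobracket par c
  for par :: "'x \<Rightarrow> bit" and R :: "('x monomial \<Rightarrow>\<^sub>0 'k::field) set"
    and c :: "'x \<Rightarrow> ('x monomial \<times> 'x monomial \<Rightarrow>\<^sub>0 'k)"
begin

text \<open>The bilinear and trilinear forms on the quotient, as functions of monomials.\<close>

definition Ann2 :: "('x monomial \<Rightarrow> 'x monomial \<Rightarrow> 'k) set"
  where "Ann2 = {B. \<forall>w. (\<lambda>u. B u w) \<in> Ann \<and> (\<lambda>u. B w u) \<in> Ann}"

definition Ann3 :: "('x monomial \<Rightarrow> 'x monomial \<Rightarrow> 'x monomial \<Rightarrow> 'k) set"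
  where "Ann3 = {T. \<forall>v w. (\<lambda>u. T u v w) \<in> Ann \<and> (\<lambda>u. T v u w) \<in> Ann \<and> (\<lambda>u. T v w u) \<in> Ann}"

lemma annihilator_sign:
  assumes "\<phi> \<in> Ann"
  shows "(\<lambda>u. psign (p * deg u) * \<phi> u) \<in> Ann" "(\<lambda>u. psign (deg u * p) * \<phi> u) \<in> Ann"
proof -
  have "(\<lambda>u. psign (p * deg u) * \<phi> u) = (\<lambda>u. (if deg u = 0 then \<phi> u else 0)
      + psign p * (if deg u = 1 then \<phi> u else 0))"
    by (rule ext, case_tac "deg u") simp_all
  also have "\<dots> \<in> Ann"
    by (intro annihilator_linear(1) annihilator_scale(1) annihilator_homogeneous
        relators_homogeneous assms)
  finally show "(\<lambda>u. psign (p * deg u) * \<phi> u) \<in> Ann" .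
  then show "(\<lambda>u. psign (deg u * p) * \<phi> u) \<in> Ann" by (simp only: mult.commute)
qed

lemma Ann2D: "B \<in> Ann2 \<Longrightarrow> (\<lambda>u. B u w) \<in> Ann" "B \<in> Ann2 \<Longrightarrow> (\<lambda>u. B w u) \<in> Ann"
  by (simp_all add: Ann2_def)

lemmas Ann2_Br = annihilator_Br[OF Ann2D(1)] annihilator_Br[OF Ann2D(2)]

lemma Ann3D: "T \<in> Ann3 \<Longrightarrow> (\<lambda>u. T u v w) \<in> Ann" "T \<in> Ann3 \<Longrightarrow> (\<lambda>u. T v u w) \<in> Ann"
   "T \<in> Ann3 \<Longrightarrow> (\<lambda>u. T v w u) \<in> Ann"
  by (simp_all add: Ann3_def)

lemma annihilator_cob: "(\<And>a b. (\<lambda>u. K u a b) \<in> Ann) \<Longrightarrow> (\<lambda>u. cob v (K u)) \<in> Ann"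
  unfolding cob_def by (rule annihilator_pair) auto

lemmas annihilator_intros = annihilator_linear annihilator_scale annihilator_sign

lemma act_Ann2:
  assumes "B \<in> Ann2"
  shows "act u B \<in> Ann2"
  by (simp add: Ann2_def act_def annihilator_intros Ann2D[OF assms] Ann2_Br[OF assms])

lemma act_annihilator:
  assumes "B \<in> Ann2"
  shows "(\<lambda>u. act u B a b) \<in> Ann"
  by (simp add: act_def annihilator_intros Ann2_Br[OF assms])

lemma act3_Ann3:
  assumes "T \<in> Ann3"
  shows "act3 u T \<in> Ann3"
  by (simp add: Ann3_def act3_def annihilator_intros mult.assoc Ann3D[OF assms]
      annihilator_Br[OF Ann3D(1)[OF assms]] annihilator_Br[OF Ann3D(2)[OF assms]]
      annihilator_Br[OF Ann3D(3)[OF assms]])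

text \<open>On the quotient the adjoint action is a representation, by the Jacobi identity.\<close>

lemma act_Br:
  assumes "B \<in> Ann2"
  shows "act (Br u v) B = (\<lambda>a b. act v (act u B) a b - s u v * act u (act v B) a b)"
proof (intro ext)
  fix a b
  show "act (Br u v) B a b = act v (act u B) a b - s u v * act u (act v B) a b"
    using annihilator_jacobi[OF Ann2D(1)[OF assms, of b], of u v a]
      annihilator_jacobi[OF Ann2D(2)[OF assms, of a], of u v b]
    by (cases "deg u"; cases "deg v"; cases "deg a") (simp_all add: act_def)
qed

lemma cob_skew_relation: "cob (Br u v) B + s u v * cob (Br v u) B = 0"
  by (cases "deg u"; cases "deg v") (simp_all add: cob_Br)

lemma cob_jacobi_relation:
  assumes "B \<in> Ann2"
  shows "cob (Br u (Br v w)) B - cob (Br (Br u v) w) B - s u v * cob (Br v (Br u w)) B = 0"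
  by (cases "deg u"; cases "deg v"; cases "deg w")
    (simp_all add: cob_Br act_Br[OF assms] cob_linear algebra_simps)

text \<open>The two contributions to the cobrackets of \<open>u\<close> and \<open>v\<close> that are not of the form of an action on
  the tensor cube cancel: those whose bracket stands in the first or second slot by the
  skew-symmetry of the bracket, those in the third slot by the skew-symmetry of the
  cobrackets of \<open>u\<close> and \<open>v\<close> as well.\<close>

lemma cojacobiator_Br:
  assumes T: "T \<in> Ann3"
  shows "cojacobiator (Br u v) T =
    cojacobiator v (act3 u T) - s u v * cojacobiator u (act3 v T)"
proof -
  define S where "S K = cob v (\<lambda>p q. cob u (\<lambda>a b. K p q a b))" for K
  have S_cong: "S K = S G"
    if "\<And>p q a b. deg p + deg q = deg v \<Longrightarrow> deg a + deg b = deg u \<Longrightarrow> K p q a b = G p q a b"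
    for K G
    unfolding S_def using that by (intro cob_cong) auto
  have S_linear: "S (\<lambda>p q a b. K p q a b + G p q a b) = S K + S G"
    "S (\<lambda>p q a b. K p q a b - G p q a b) = S K - S G"
    "S (\<lambda>p q a b. k * K p q a b) = k * S K" for K G k
    by (simp_all add: S_def cob_linear)
  have skew_v: "S K = - S (\<lambda>p q a b. s p q * K q p a b)" for K
    unfolding S_def by (subst cob_skew) (simp add: cob_linear)
  have skew_u: "S K = - S (\<lambda>p q a b. s a b * K p q b a)" for K
    unfolding S_def by (subst cob_skew) (simp add: cob_linear)
  \<comment> \<open>Here \<open>p, q\<close> run over the cobracket of \<open>v\<close> and \<open>a, b\<close> over that of \<open>u\<close>; \<open>?E\<close> collects
    the contributions of both, and \<open>?F1\<close>, \<open>?F2\<close>, \<open>?G1\<close>, \<open>?G2\<close> are those with a bracket in the third slot.\<close>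
  let ?E = "\<lambda>p q a b.
      ((s u v * (s v a * act a (\<lambda>p q. T p q b) p q) - s u p * act p (\<lambda>a b. T a b q) a b)
      + (s u p * s u q * act q (\<lambda>a b. T p a b) a b
        - s u v * (s v a * s v b * act b (\<lambda>p q. T a p q) p q)))
      + (s u p * act p (\<lambda>a b. flip23 T a b q) a b
        - s u v * (s v a * act a (\<lambda>p q. flip23 T p q b) p q))"
  let ?F1 = "\<lambda>p q a b. s a p * s b p * s b q * T p a (Br q b)"
  let ?F2 = "\<lambda>p q a b. s p b * s p a * s a b * T p b (Br a q)"
  let ?G1 = "\<lambda>p q a b. s p b * s p q * s b q * T a q (Br p b)"
  let ?G2 = "\<lambda>p q a b. s b p * T a p (Br b q)"
  have "S ?E = S (\<lambda>p q a b. (?F1 p q a b - ?F2 p q a b) + (?G1 p q a b - ?G2 p q a b))"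
  proof (rule S_cong)
    fix p q a b assume d: "deg p + deg q = deg v" "deg a + deg b = deg u"
    show "?E p q a b = (?F1 p q a b - ?F2 p q a b) + (?G1 p q a b - ?G2 p q a b)"
      unfolding d[symmetric] act_def flip23_def
      using annihilator_skew[OF Ann3D(1)[OF T, of b q], of p a]
        annihilator_skew[OF Ann3D(1)[OF T, of q b], of p a]
        annihilator_skew[OF Ann3D(2)[OF T, of a q], of p b]
        annihilator_skew[OF Ann3D(2)[OF T, of p b], of q a]
      by (cases "deg p"; cases "deg q"; cases "deg a"; cases "deg b") simp_all
  qed
  also have "\<dots> = (S ?F1 - S ?F2) + (S ?G1 - S ?G2)"
    by (simp only: S_linear)
  also have "S ?F2 = S ?F1"
  proof -
    have "S ?F1 = S (\<lambda>p q a b. - 1 * (s a b * ?F2 p q b a))"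
    proof (rule S_cong)
      fix p q a b
      show "?F1 p q a b = - 1 * (s a b * ?F2 p q b a)"
        using annihilator_skew[OF Ann3D(3)[OF T, of p a], of q b]
        by (cases "deg p"; cases "deg q"; cases "deg a"; cases "deg b") simp_all
    qed
    also have "\<dots> = S ?F2" unfolding S_linear by (subst (2) skew_u) simp
    finally show ?thesis ..
  qed
  also have "S ?G2 = S ?G1"
  proof -
    have "S ?G2 = S (\<lambda>p q a b. - 1 * (s p q * ?G1 q p a b))"
    proof (rule S_cong)
      fix p q a b
      show "?G2 p q a b = - 1 * (s p q * ?G1 q p a b)"
        using annihilator_skew[OF Ann3D(3)[OF T, of a p], of q b]
        by (cases "deg p"; cases "deg q"; cases "deg a"; cases "deg b") simp_all
    qed
    also have "\<dots> = S ?G1" unfolding S_linear by (subst (2) skew_v) simp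
    finally show ?thesis .
  qed
  finally have E: "S ?E = 0" by simp
  have left: "cojacobi_left (Br u v) T =
      cojacobi_left v (act3 u T) - s u v * cojacobi_left u (act3 v T)
      - S (\<lambda>p q a b. s u p * act p (\<lambda>a b. T a b q) a b)
      + s u v * S (\<lambda>p q a b. s v a * act a (\<lambda>p q. T p q b) p q)" for T
    by (simp only: cojacobi_left_Br cob_swap[of u v] S_def)
  have right: "cojacobi_right (Br u v) T =
      cojacobi_right v (act3 u T) - s u v * cojacobi_right u (act3 v T)
      - S (\<lambda>p q a b. s u p * s u q * act q (\<lambda>a b. T p a b) a b)
      + s u v * S (\<lambda>p q a b. s v a * s v b * act b (\<lambda>p q. T a p q) p q)"
    by (simp only: cojacobi_right_Br cob_swap[of u v] S_def)
  have collect: "(l1 - k * l2 - x1 + k * x2) - (r1 - k * r2 - y1 + k * y2)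
      - (m1 - k * m2 - z1 + k * z2) =
      (l1 - r1 - m1) - k * (l2 - r2 - m2) + (((k * x2 - x1) + (y1 - k * y2)) + (z1 - k * z2))"
    for k l1 l2 r1 r2 m1 m2 x1 x2 y1 y2 z1 z2 :: 'k
    by (simp add: algebra_simps)
  have "cojacobiator (Br u v) T =
      cojacobiator v (act3 u T) - s u v * cojacobiator u (act3 v T) + S ?E"
    by (simp only: cojacobiator_def left right act3_flip23 collect S_linear)
  with E show ?thesis by simp
qed

end

section \<open>The cobracket on the quotient\<close>

text \<open>Two conditions remain for a presentation with an even and skew-symmetric cobracket on the
  generators: the cobracket of each relator is zero on the quotient, and the generators satisfy the
  co-Jacobi identity.\<close>

locale superbialgebra_presentation = cobracket_presentation par R c
  for par :: "'x \<Rightarrow> bit" and R :: "('x monomial \<Rightarrow>\<^sub>0 'k::field) set"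
    and c :: "'x \<Rightarrow> ('x monomial \<times> 'x monomial \<Rightarrow>\<^sub>0 'k)" +
  assumes cob_relator: "x \<in> R \<Longrightarrow> B \<in> Ann2 \<Longrightarrow> pair (\<lambda>u. cob u B) x = 0"
    and cojacobiator_Gen: "cojacobiator (Gen g) T = 0"
begin

lemma cojacobiator_zero: "T \<in> Ann3 \<Longrightarrow> cojacobiator u T = 0"
  by (induction u arbitrary: T) (simp_all add: cojacobiator_Gen cojacobiator_Br act3_Ann3)

text \<open>The cobracket is well defined on the quotient: the cobracket of the ideal is killed by every
  bilinear form on the quotient. The cobracket of a bracket with an element of the ideal has two
  terms; in one the cobracket of that element is acted upon, in the other the element itself acts, as
  zero on the quotient.\<close>

lemma cob_annihilator:
  assumes "B \<in> Ann2"
  shows "(\<lambda>u. cob u B) \<in> Ann"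
proof -
  have "pair (\<lambda>u. cob u B) x = 0" if "x \<in> I" "B \<in> Ann2" for x B
    using that
  proof (induction arbitrary: B rule: presented_ideal.induct)
    case (relator x)
    then show ?case by (rule cob_relator)
  next
    case (skew x p y q)
    have "pair (\<lambda>u. pair (\<lambda>v. cob (Br u v) B + psign (p * q) * cob (Br v u) B) y) x
        = pair (\<lambda>u. pair (\<lambda>v. cob (Br u v) B + s u v * cob (Br v u) B) y) x"
      by (intro free_part_pair_cong[OF skew(1)] free_part_pair_cong[OF skew(2)]) simp
    then show ?case
      by (simp add: cob_skew_relation pair_add_left pair_scale_left
          pair_swap[of "\<lambda>u v. cob (Br v u) B"])
  next
    case (jacobi x p y q z r)
    have "pair (\<lambda>u. pair (\<lambda>v. pair (\<lambda>w. cob (Br u (Br v w)) B - cob (Br (Br u v) w) B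
          - psign (p * q) * cob (Br v (Br u w)) B) z) y) x
        = pair (\<lambda>u. pair (\<lambda>v. pair (\<lambda>w. cob (Br u (Br v w)) B - cob (Br (Br u v) w) B
          - s u v * cob (Br v (Br u w)) B) z) y) x"
      by (intro free_part_pair_cong[OF jacobi(1)] free_part_pair_cong[OF jacobi(2)]) simp
    then show ?case
      by (simp add: cob_jacobi_relation[OF jacobi(4)] pair_minus_left pair_scale_left
          pair_swap[of "\<lambda>u v. pair (\<lambda>w. cob (Br v (Br u w)) B) z"])
  next
    case (left x y)
    have "pair (\<lambda>v. cob v (act u B)) x = 0" for u
      by (rule left.IH) (rule act_Ann2[OF left.prems])
    moreover have "pair (\<lambda>v. s u v * cob u (act v B)) x = 0" for u
      by (rule annihilatorD[OF _ left.hyps])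
        (intro annihilator_sign annihilator_cob act_annihilator left.prems)
    ultimately show ?case by (simp add: cob_Br pair_minus_left)
  next
    case (right x y)
    have "pair (\<lambda>u. cob v (act u B)) x = 0" for v
      by (rule annihilatorD[OF _ right.hyps])
        (intro annihilator_cob act_annihilator right.prems)
    moreover have "pair (\<lambda>u. s u v * cob u (act v B)) x = 0" for v
    proof -
      \<comment> \<open>The sign depends on the parity of \<open>u\<close>. As the cobracket is even it can be distributed over both
        slots, which again gives a form on the quotient.\<close>
      let ?B = "\<lambda>a b. psign (deg a * deg v) * (psign (deg b * deg v) * act v B a b)"
      have "s u v * cob u (act v B) = cob u ?B" for u
      proof (unfold cob_linear(4)[symmetric], rule cob_cong)
        fix a b assume "deg a + deg b = deg u"
        then show "s u v * act v B a b = ?B a b"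
          by (elim subst) (cases "deg a"; cases "deg b"; simp)
      qed
      moreover have "?B \<in> Ann2"
        using Ann2D[OF act_Ann2[OF right.prems]] by (simp add: Ann2_def annihilator_intros)
      ultimately show ?thesis using right.IH by simp
    qed
    ultimately show ?case
      by (simp add: cob_Br pair_minus_left pair_swap[of _ y x])
  qed (simp_all)
  with assms show ?thesis by (simp add: annihilator_def)
qed

lemma pair_linear_form:
  assumes "\<And>S T. S \<in> carrier Q \<Longrightarrow> T \<in> carrier Q \<Longrightarrow> f (S \<oplus>\<^bsub>Q\<^esub> T) = f S + f T"
    and "\<And>k S. S \<in> carrier Q \<Longrightarrow> f (k \<odot>\<^bsub>Q\<^esub> S) = k * f S"
  shows "pair (\<lambda>u. f (cl (mon u))) x = f (cl x)"
proof -
  have f: "f (cl (x + y)) = f (cl x) + f (cl y)" "f (cl (fscale k x)) = k * f (cl x)" for x y k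
    using assms(1)[of "cl x" "cl y"] assms(2)[of "cl x" k] by (simp_all add: Q_ops)
  have f0: "f (cl 0) = 0" using f(2)[of 0 0] by simp
  have "f (cl (\<Sum>u\<in>A. fscale (lookup x u) (mon u))) = (\<Sum>u\<in>A. lookup x u * f (cl (mon u)))"
    if "finite A" for A
    using that by (induction A) (simp_all add: f f0)
  from this[of "keys x"]
  have "f (cl (\<Sum>u\<in>keys x. fscale (lookup x u) (mon u))) = pair (\<lambda>u. f (cl (mon u))) x"
    by (simp add: pair_def)
  moreover have "x = (\<Sum>u\<in>keys x. fscale (lookup x u) (mon u))"
    by (subst eq_iff_pair) (simp, simp add: pair_def)
  then have "f (cl x) = f (cl (\<Sum>u\<in>keys x. fscale (lookup x u) (mon u)))"
    by (rule arg_cong)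
  ultimately show ?thesis by (simp only:)
qed

lemma pair_bilinear_form:
  assumes "bilinear_form Q B" "S \<in> carrier Q"
  shows "pair (\<lambda>u. B (cl (mon u)) S) x = B (cl x) S" "pair (\<lambda>u. B S (cl (mon u))) x = B S (cl x)"
proof -
  note B = bilinear_formD[OF assms(1)]
  show "pair (\<lambda>u. B (cl (mon u)) S) x = B (cl x) S"
    by (rule pair_linear_form[where f = "\<lambda>T. B T S"]) (simp_all add: B assms(2))
  show "pair (\<lambda>u. B S (cl (mon u))) x = B S (cl x)"
    by (rule pair_linear_form[where f = "\<lambda>T. B S T"]) (simp_all add: B assms(2))
qed

lemma bilinear_form_zero:
  assumes "bilinear_form Q B" "S \<in> carrier Q"
  shows "B (cl 0) S = 0" "B S (cl 0) = 0"
  using pair_bilinear_form[OF assms, of 0] by simp_all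

lemma bilinear_form_Ann2:
  assumes "bilinear_form Q B"
  shows "(\<lambda>u v. B (cl (mon u)) (cl (mon v))) \<in> Ann2"
proof -
  have "cl x = cl 0" if "x \<in> I" for x using that by (simp add: cl_eq_iff)
  then show ?thesis
    by (auto simp: Ann2_def annihilator_def pair_bilinear_form[OF assms]
        bilinear_form_zero[OF assms])
qed

lemma trilinear_form_Ann3:
  assumes "trilinear_form Q T"
  shows "(\<lambda>u v w. T (cl (mon u)) (cl (mon v)) (cl (mon w))) \<in> Ann3"
proof -
  have "bilinear_form Q (\<lambda>a b. T a b (cl (mon w)))" "bilinear_form Q (\<lambda>a b. T (cl (mon w)) a b)" for w
    using assms by (simp_all add: trilinear_form_def)
  from this[THEN bilinear_form_Ann2] show ?thesis
    by (simp add: Ann3_def Ann2_def)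
qed

lemma cobracket_Q:
  "cobracket Q S = lin_ext (\<lambda>(u, v). single (cl (mon u), cl (mon v)) 1)
    (lin_ext (mcobracket par c) (rep S))"
  by (simp add: presented_superbialgebra_def Let_def)

text \<open>For an arbitrary function of two vectors the chosen representative matters; for forms on the quotient
  it can be replaced by any other.\<close>

lemma pair_cobracket_rep:
  "pair B (cobracket Q S) = pair (\<lambda>u. cob u (\<lambda>a b. B (cl (mon a), cl (mon b)))) (rep S)"
  by (simp add: cobracket_Q cob_def case_prod_beta')

lemma pair_cobracket:
  assumes "(\<lambda>a b. B (cl (mon a), cl (mon b))) \<in> Ann2"
  shows "pair B (cobracket Q (cl x)) = pair (\<lambda>u. cob u (\<lambda>a b. B (cl (mon a), cl (mon b)))) x"
  unfolding pair_cobracket_rep by (rule pair_rep_cl) (rule cob_annihilator[OF assms])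

lemma keys_lin_ext: "keys (lin_ext g p) \<subseteq> (\<Union>a\<in>keys p. keys (g a))"
proof
  fix b assume b: "b \<in> keys (lin_ext g p)"
  show "b \<in> (\<Union>a\<in>keys p. keys (g a))"
  proof (rule ccontr)
    assume "b \<notin> (\<Union>a\<in>keys p. keys (g a))"
    then have "pair (\<lambda>a. lookup (g a) b) p = pair (\<lambda>_. 0) p"
      by (intro pair_cong) (auto simp: in_keys_iff)
    moreover have "lookup (lin_ext g p) b = pair (\<lambda>a. lookup (g a) b) p"
      using pair_lin_ext[of "\<lambda>x. if x = b then 1 else 0" g p] by (simp only: pair_coefficient)
    ultimately show False using b by (simp add: in_keys_iff)
  qed
qed

lemma homcomp_mon: "homcomp Q q (cl (mon u)) = (if q = deg u then cl (mon u) else cl 0)"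
  by (rule homcomp_cl) simp

text \<open>The recursive definition of the cobracket on monomials is the cocycle condition; it only has to be
  transported through the representatives and extended linearly.\<close>

lemma Q_cobracket_cocycle:
  assumes x: "x \<in> free_part par p" and y: "y \<in> free_part par q"
  shows "tensor2_eq Q (cobracket Q (bracket Q (cl x) (cl y)))
    (tensor_act Q p (cl x) (cobracket Q (cl y))
      - fscale (psign (p * q)) (tensor_act Q q (cl y) (cobracket Q (cl x))))"
  unfolding tensor2_eq_iff
proof (intro allI impI)
  fix B assume B: "bilinear_form Q B"
  let ?B = "\<lambda>a b. B (cl (mon a)) (cl (mon b))"
  have B': "?B \<in> Ann2" by (rule bilinear_form_Ann2[OF B])
  have action: "pair (\<lambda>(v, w). B v w) (tensor_act Q p (cl x) (cobracket Q (cl y)))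
      = pair (\<lambda>u. pair (\<lambda>v. cob v (act u ?B)) y) x"
    if x: "x \<in> free_part par p" for x p y
  proof -
    let ?G = "\<lambda>(v, w). B (bracket Q (cl x) v) w
      + (\<Sum>q\<in>{0, 1}. psign (p * q) * B (homcomp Q q v) (bracket Q (cl x) w))"
    have G: "?G (cl (mon a), cl (mon b)) = pair (\<lambda>u. act u ?B a b) x" for a b
    proof -
      \<comment> \<open>Of the two summands over the parity of \<open>a\<close> one contains the zero vector.\<close>
      have "?G (cl (mon a), cl (mon b)) =
          B (cl (free_bracket x (mon a))) (cl (mon b))
          + psign (p * deg a) * B (cl (mon a)) (cl (free_bracket x (mon b)))"
        by (cases "deg a") (simp_all add: homcomp_mon Q_ops bilinear_form_zero[OF B])
      also have "\<dots> = pair (\<lambda>u. ?B (Br u a) b + psign (p * deg a) * ?B a (Br u b)) x"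
        using pair_bilinear_form(1)[OF B, of "cl (mon b)" "free_bracket x (mon a)"]
          pair_bilinear_form(2)[OF B, of "cl (mon a)" "free_bracket x (mon b)"]
        by (simp add: pair_add_left pair_scale_left)
      also have "\<dots> = pair (\<lambda>u. act u ?B a b) x"
        by (rule free_part_pair_cong[OF x]) (simp add: act_def)
      finally show ?thesis .
    qed
    have "pair (\<lambda>(v, w). B v w) (tensor_act Q p (cl x) (cobracket Q (cl y)))
        = pair ?G (cobracket Q (cl y))"
      by (simp add: tensor_act_def case_prod_beta')
    also have "\<dots> = pair (\<lambda>v. cob v (\<lambda>a b. ?G (cl (mon a), cl (mon b)))) y"
    proof (rule pair_cobracket)
      show "(\<lambda>a b. ?G (cl (mon a), cl (mon b))) \<in> Ann2"
        unfolding G using Ann2D[OF act_Ann2[OF B']]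
        by (auto simp: Ann2_def intro!: annihilator_pair)
    qed
    also have "\<dots> = pair (\<lambda>v. pair (\<lambda>u. cob v (act u ?B)) x) y"
      unfolding G by (simp add: cob_def case_prod_beta' pair_swap[of _ x])
    finally show ?thesis by (simp add: pair_swap[of _ x])
  qed
  have "pair (\<lambda>(v, w). B v w) (cobracket Q (bracket Q (cl x) (cl y)))
      = pair (\<lambda>u. pair (\<lambda>v. cob (Br u v) ?B) y) x"
    using pair_cobracket[of "\<lambda>(v, w). B v w", OF _] B' by (simp add: Q_ops)
  also have "\<dots> = pair (\<lambda>u. pair (\<lambda>v. cob v (act u ?B) - psign (p * q) * cob u (act v ?B)) y) x"
    unfolding cob_Br by (intro free_part_pair_cong[OF x] free_part_pair_cong[OF y]) simp
  also have "\<dots> = pair (\<lambda>u. pair (\<lambda>v. cob v (act u ?B)) y) x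
      - psign (p * q) * pair (\<lambda>v. pair (\<lambda>u. cob u (act v ?B)) x) y"
    by (simp add: pair_minus_left pair_scale_left pair_swap[of _ y x])
  finally show "pair (\<lambda>(v, w). B v w) (cobracket Q (bracket Q (cl x) (cl y)))
      = pair (\<lambda>(v, w). B v w) (tensor_act Q p (cl x) (cobracket Q (cl y))
        - fscale (psign (p * q)) (tensor_act Q q (cl y) (cobracket Q (cl x))))"
    by (simp add: action[OF x] action[OF y])
qed

lemma Q_cobracket_skew:
  "tensor2_eq Q (super_flip Q (cobracket Q (cl x))) (- cobracket Q (cl x))"
  unfolding tensor2_eq_iff
proof (intro allI impI)
  fix B assume B: "bilinear_form Q B"
  let ?G = "\<lambda>(v, w). \<Sum>p\<in>{0, 1}. \<Sum>q\<in>{0, 1}.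
    psign (p * q) * B (homcomp Q q w) (homcomp Q p v)"
  have G: "?G (cl (mon a), cl (mon b)) = s a b * B (cl (mon b)) (cl (mon a))" for a b
    by (cases "deg a"; cases "deg b") (simp_all add: homcomp_mon bilinear_form_zero[OF B])
  have "pair (\<lambda>(v, w). B v w) (super_flip Q (cobracket Q (cl x))) = pair ?G (cobracket Q (cl x))"
    by (simp add: super_flip_def case_prod_beta')
  also have "\<dots> = - pair (\<lambda>u. cob u (\<lambda>a b. B (cl (mon a)) (cl (mon b)))) (rep (cl x))"
    unfolding pair_cobracket_rep G pair_uminus_left[symmetric]
    by (rule pair_cong) (subst (2) cob_skew, simp)
  finally show "pair (\<lambda>(v, w). B v w) (super_flip Q (cobracket Q (cl x)))
      = pair (\<lambda>(v, w). B v w) (- cobracket Q (cl x))"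
    by (simp add: pair_cobracket_rep)
qed

lemma Q_cobracket_cojacobi:
  "tensor3_eq Q
    (cobracket_tensor_id Q (cobracket Q (cl x)) - id_tensor_cobracket Q (cobracket Q (cl x)))
    (id_tensor_flip Q (cobracket_tensor_id Q (cobracket Q (cl x))))"
proof (rule tensor3_eqI)
  fix T assume T: "trilinear_form Q T"
  define T' where "T' = (\<lambda>a b d. T (cl (mon a)) (cl (mon b)) (cl (mon d)))"
  have T': "T' \<in> Ann3" unfolding T'_def by (rule trilinear_form_Ann3[OF T])
  have left: "pair K (cobracket_tensor_id Q (cobracket Q (cl x)))
      = pair (\<lambda>u. cojacobi_left u (\<lambda>a b d. K (cl (mon a), cl (mon b), cl (mon d)))) (rep (cl x))"
    if "\<And>d. (\<lambda>a b. K (cl (mon a), cl (mon b), cl (mon d))) \<in> Ann2" for K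
    using that
    by (simp add: cobracket_tensor_id_def case_prod_beta' pair_cobracket_rep[of _ "cl x"]
        pair_cobracket cojacobi_left_def)
  have "pair (\<lambda>(u, v, w). T u v w) (id_tensor_cobracket Q (cobracket Q (cl x)))
      = pair (\<lambda>u. cojacobi_right u T') (rep (cl x))"
  proof -
    have "(\<lambda>b d. T (cl (mon a)) (cl (mon b)) (cl (mon d))) \<in> Ann2" for a
      using Ann3D[OF T'] by (simp add: Ann2_def T'_def)
    then show ?thesis
      by (simp add: id_tensor_cobracket_def case_prod_beta' pair_cobracket_rep[of _ "cl x"]
        pair_cobracket cojacobi_right_def T'_def)
  qed
  moreover have "pair (\<lambda>(u, v, w). T u v w) (cobracket_tensor_id Q (cobracket Q (cl x)))
      = pair (\<lambda>u. cojacobi_left u T') (rep (cl x))"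
    using Ann3D[OF T'] by (subst left) (simp_all add: Ann2_def T'_def)
  moreover have "pair (\<lambda>(u, v, w). T u v w)
        (id_tensor_flip Q (cobracket_tensor_id Q (cobracket Q (cl x))))
      = pair (\<lambda>u. cojacobi_left u (flip23 T')) (rep (cl x))"
  proof -
    let ?K = "\<lambda>(u, v, w). \<Sum>p\<in>{0, 1}. \<Sum>q\<in>{0, 1}.
      psign (p * q) * T u (homcomp Q q w) (homcomp Q p v)"
    have K: "?K (cl (mon a), cl (mon b), cl (mon d)) = flip23 T' a b d" for a b d
    proof -
      have "bilinear_form Q (T (cl (mon a)))" using T by (simp add: trilinear_form_def)
      note zero = bilinear_form_zero[OF this]
      show ?thesis
        by (cases "deg b"; cases "deg d")
          (simp_all add: homcomp_mon zero flip23_def T'_def)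
    qed
    have "pair (\<lambda>(u, v, w). T u v w)
        (id_tensor_flip Q (cobracket_tensor_id Q (cobracket Q (cl x))))
      = pair ?K (cobracket_tensor_id Q (cobracket Q (cl x)))"
      by (simp add: id_tensor_flip_def case_prod_beta')
    also have "\<dots> = pair (\<lambda>u. cojacobi_left u (flip23 T')) (rep (cl x))"
      by (subst left; unfold K)
        (simp_all add: Ann2_def flip23_def annihilator_intros Ann3D[OF T'])
    finally show ?thesis .
  qed
  moreover have "pair (\<lambda>u. cojacobi_left u T' - cojacobi_right u T' - cojacobi_left u (flip23 T'))
      (rep (cl x)) = 0"
    using cojacobiator_zero[OF T'] by (simp add: cojacobiator_def)
  ultimately show "pair (\<lambda>(u, v, w). T u v w)
      (cobracket_tensor_id Q (cobracket Q (cl x)) - id_tensor_cobracket Q (cobracket Q (cl x)))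
    = pair (\<lambda>(u, v, w). T u v w)
      (id_tensor_flip Q (cobracket_tensor_id Q (cobracket Q (cl x))))"
    by (simp add: pair_minus_left)
qed

theorem Q_lie_superbialgebra: "lie_superbialgebra Q"
proof (intro lie_superbialgebra.intro lie_superbialgebra_axioms.intro Q_lie_superalgebra)
  fix S assume "S \<in> carrier Q"
  then obtain x where S: "S = cl x" by (rule Q_carrierE)
  show "keys (cobracket Q S) \<subseteq> carrier Q \<times> carrier Q"
    unfolding cobracket_Q by (rule subset_trans[OF keys_lin_ext]) auto
  show "tensor2_eq Q (cobracket Q (k \<odot>\<^bsub>Q\<^esub> S)) (fscale k (cobracket Q S))" for k
    unfolding tensor2_eq_iff S Q_ops
    using pair_cobracket[of "\<lambda>(v, w). B v w" for B] by (simp add: bilinear_form_Ann2)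
  show "tensor2_eq Q (super_flip Q (cobracket Q S)) (- cobracket Q S)"
    unfolding S by (rule Q_cobracket_skew)
  show "tensor3_eq Q
      (cobracket_tensor_id Q (cobracket Q S) - id_tensor_cobracket Q (cobracket Q S))
      (id_tensor_flip Q (cobracket_tensor_id Q (cobracket Q S)))"
    unfolding S by (rule Q_cobracket_cojacobi)
  fix T assume "T \<in> carrier Q"
  then obtain y where T: "T = cl y" by (rule Q_carrierE)
  show "tensor2_eq Q (cobracket Q (S \<oplus>\<^bsub>Q\<^esub> T)) (cobracket Q S + cobracket Q T)"
    unfolding tensor2_eq_iff S T Q_ops
    using pair_cobracket[of "\<lambda>(v, w). B v w" for B] by (simp add: bilinear_form_Ann2)
next
  fix S p assume "S \<in> part Q p"
  then obtain x where x: "x \<in> free_part par p" "S = cl x" by (rule Q_partE)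
  let ?t = "lin_ext (\<lambda>(u, v). single (cl (mon u), cl (mon v)) 1) (lin_ext (mcobracket par c) x)"
  have "tensor2_eq Q (cobracket Q S) ?t"
    unfolding tensor2_eq_iff x
    using pair_cobracket[of "\<lambda>(v, w). B v w" for B]
    by (simp add: bilinear_form_Ann2 cob_def case_prod_beta')
  moreover have "keys ?t \<subseteq> (\<Union>q. part Q q \<times> part Q (p + q))"
  proof
    fix t assume "t \<in> keys ?t"
    then obtain u a b where u: "u \<in> keys x" "(a, b) \<in> keys (mcobracket par c u)"
      "t = (cl (mon a), cl (mon b))"
      by (auto dest!: subsetD[OF keys_lin_ext] split: if_splits)
    then have "deg a + deg b = p"
      using mcobracket_even[OF u(2)] x(1) by (simp add: free_part_def)
    then have "deg b = p + deg a" by (auto simp: ac_simps)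
    then show "t \<in> (\<Union>q. part Q q \<times> part Q (p + q))"
      unfolding u(3) by (intro UN_I[of "deg a"]) (auto intro!: cl_in_part)
  qed
  ultimately show "\<exists>t. tensor2_eq Q (cobracket Q S) t
      \<and> keys t \<subseteq> (\<Union>q. part Q q \<times> part Q (p + q))" by blast
next
  fix S T p q assume "S \<in> part Q p" "T \<in> part Q q"
  then show "tensor2_eq Q (cobracket Q (bracket Q S T))
      (tensor_act Q p S (cobracket Q T)
        - fscale (psign (p * q)) (tensor_act Q q T (cobracket Q S)))"
    by (auto elim!: Q_partE intro: Q_cobracket_cocycle)
qed

end

section \<open>Isomorphisms\<close>

text \<open>The homomorphism of free superalgebras induced by a map of generators.\<close>

definition relabel :: "('x \<Rightarrow> 'y) \<Rightarrow> ('x monomial \<Rightarrow>\<^sub>0 'k::field) \<Rightarrow> ('y monomial \<Rightarrow>\<^sub>0 'k)"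
  where "relabel \<sigma> = lin_ext (\<lambda>u. mon (map_monomial \<sigma> u))"

lemma pair_relabel [simp]: "pair \<phi> (relabel \<sigma> x) = pair (\<lambda>u. \<phi> (map_monomial \<sigma> u)) x"
  by (simp add: relabel_def)

lemma relabel_linear:
  "relabel \<sigma> (x + y) = relabel \<sigma> x + relabel \<sigma> y"
  "relabel \<sigma> (x - y) = relabel \<sigma> x - relabel \<sigma> y"
  "relabel \<sigma> (fscale k x) = fscale k (relabel \<sigma> x)"
  "relabel \<sigma> 0 = 0"
  "relabel \<sigma> (mon u) = mon (map_monomial \<sigma> u)"
  by (simp_all add: eq_iff_pair)

lemma relabel_bracket:
  "relabel \<sigma> (free_bracket x y) = free_bracket (relabel \<sigma> x) (relabel \<sigma> y)"
  by (simp add: eq_iff_pair)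

lemma mparity_map: "mparity par (map_monomial \<sigma> u) = mparity (\<lambda>a. par (\<sigma> a)) u"
  by (induction u) simp_all

lemma relabel_free_part:
  fixes x :: "'x monomial \<Rightarrow>\<^sub>0 'k::field" and par :: "'y \<Rightarrow> bit"
  assumes "x \<in> free_part (\<lambda>a. par (\<sigma> a)) p"
  shows "relabel \<sigma> x \<in> free_part par p"
proof (rule free_partI)
  fix \<phi> :: "'y monomial \<Rightarrow> 'k" assume "\<And>u. mparity par u = p \<Longrightarrow> \<phi> u = 0"
  then have "pair (\<lambda>u. \<phi> (map_monomial \<sigma> u)) x = pair (\<lambda>_. 0) x"
    by (intro free_part_pair_cong[OF assms]) (simp add: mparity_map)
  then show "pair \<phi> (relabel \<sigma> x) = 0" by simp
qed

lemma relabel_ideal: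
  assumes R: "\<And>x. x \<in> R \<Longrightarrow> relabel \<sigma> x \<in> presented_ideal par' R'"
    and par: "par = (\<lambda>a. par' (\<sigma> a))"
    and x: "x \<in> presented_ideal par R"
  shows "relabel \<sigma> x \<in> presented_ideal par' R'"
  using x
proof (induction rule: presented_ideal.induct)
  case (skew x p y q)
  then have "relabel \<sigma> x \<in> free_part par' p" "relabel \<sigma> y \<in> free_part par' q"
    unfolding par by (simp_all add: relabel_free_part)
  then show ?case
    unfolding relabel_linear relabel_bracket by (rule presented_ideal.skew)
next
  case (jacobi x p y q z r)
  then have "relabel \<sigma> x \<in> free_part par' p" "relabel \<sigma> y \<in> free_part par' q"
    "relabel \<sigma> z \<in> free_part par' r"
    unfolding par by (simp_all add: relabel_free_part)
  then show ?case
    unfolding relabel_linear relabel_bracket by (rule presented_ideal.jacobi)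
qed (simp_all add: R relabel_linear relabel_bracket presented_ideal.zero presented_ideal.add
    presented_ideal.scale presented_ideal.left presented_ideal.right)

text \<open>A bijection of the generators that matches parities, relators and prescribed cobrackets maps one
  ideal onto the other and commutes with the recursion that defines the cobracket.\<close>

theorem relabelled_presentations_isomorphic:
  fixes c :: "'x \<Rightarrow> ('x monomial \<times> 'x monomial \<Rightarrow>\<^sub>0 'k::field)"
    and c' :: "'y \<Rightarrow> ('y monomial \<times> 'y monomial \<Rightarrow>\<^sub>0 'k)"
  assumes P: "superbialgebra_presentation par R c" and P': "superbialgebra_presentation par' R' c'"
    and inverse: "\<And>a. \<rho> (\<sigma> a) = a" "\<And>b. \<sigma> (\<rho> b) = b"
    and par: "\<And>a. par' (\<sigma> a) = par a"
    and R: "\<And>x. x \<in> R \<Longrightarrow> relabel \<sigma> x \<in> R'"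
    and R': "\<And>x. x \<in> R' \<Longrightarrow> relabel \<rho> x \<in> R"
    and c: "\<And>a B. pair (\<lambda>(u, v). B u v) (c' (\<sigma> a)) =
      pair (\<lambda>(u, v). B (map_monomial \<sigma> u) (map_monomial \<sigma> v)) (c a)"
  shows "lie_superbialgebras_isomorphic
    (presented_superbialgebra par R c) (presented_superbialgebra par' R' c')"
proof -
  interpret L: superbialgebra_presentation par R c by fact
  interpret M: superbialgebra_presentation par' R' c' by fact
  define f where "f S = M.cl (relabel \<sigma> (rep S))" for S
  define g where "g S = L.cl (relabel \<rho> (rep S))" for S
  have par_\<sigma>: "par = (\<lambda>a. par' (\<sigma> a))" by (simp add: par)
  have par_\<rho>: "par' = (\<lambda>b. par (\<rho> b))"
  proof
    fix b show "par' b = par (\<rho> b)" using par[of "\<rho> b"] unfolding inverse(2) .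
  qed
  have ideal_\<sigma>: "relabel \<sigma> x \<in> M.I" if "x \<in> L.I" for x
    by (rule relabel_ideal[where \<sigma> = \<sigma> and par = par and par' = par', OF
          presented_ideal.relator[OF R] par_\<sigma> that])
  have ideal_\<rho>: "relabel \<rho> x \<in> L.I" if "x \<in> M.I" for x
    by (rule relabel_ideal[where \<sigma> = \<rho> and par = par' and par' = par, OF
          presented_ideal.relator[OF R'] par_\<rho> that])
  have f_cl: "f (L.cl x) = M.cl (relabel \<sigma> x)" for x
    unfolding f_def M.cl_eq_iff
    by (fold relabel_linear(2), rule ideal_\<sigma>)
      (simp add: in_presented_ideal_iff L.pair_rep_cl)
  have g_cl: "g (M.cl x) = L.cl (relabel \<rho> x)" for x
    unfolding g_def L.cl_eq_iff
    by (fold relabel_linear(2), rule ideal_\<rho>)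
      (simp add: in_presented_ideal_iff M.pair_rep_cl)
  have map_inverse: "map_monomial \<rho> (map_monomial \<sigma> u) = u"
    "map_monomial \<sigma> (map_monomial \<rho> v) = v" for u v
    by (simp_all add: monomial.map_comp o_def inverse monomial.map_ident)
  have relabel_inverse: "relabel \<rho> (relabel \<sigma> x) = x" "relabel \<sigma> (relabel \<rho> y) = y" for x y
    by (simp_all add: eq_iff_pair map_inverse)
  have cob: "L.cob u (\<lambda>a b. B (map_monomial \<sigma> a) (map_monomial \<sigma> b)) = M.cob (map_monomial \<sigma> u) B"
    for u B
  proof (induction u arbitrary: B)
    case (Gen a)
    show ?case by (simp add: L.cob_Gen M.cob_Gen c)
  next
    case (Br u v)
    have "L.act w (\<lambda>a b. B (map_monomial \<sigma> a) (map_monomial \<sigma> b))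
        = (\<lambda>a b. M.act (map_monomial \<sigma> w) B (map_monomial \<sigma> a) (map_monomial \<sigma> b))" for w
      by (simp add: L.act_def M.act_def mparity_map par)
    then have act_cob: "L.cob u (L.act v (\<lambda>a b. B (map_monomial \<sigma> a) (map_monomial \<sigma> b)))
        = M.cob (map_monomial \<sigma> u) (M.act (map_monomial \<sigma> v) B)"
      "L.cob v (L.act u (\<lambda>a b. B (map_monomial \<sigma> a) (map_monomial \<sigma> b)))
        = M.cob (map_monomial \<sigma> v) (M.act (map_monomial \<sigma> u) B)"
      using Br.IH(1)[of "M.act (map_monomial \<sigma> v) B"] Br.IH(2)[of "M.act (map_monomial \<sigma> u) B"]
      by simp_all
    show ?case unfolding L.cob_Br act_cob by (simp add: M.cob_Br mparity_map par)
  qed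
  have "lie_superbialgebra_iso L.Q M.Q f"
    unfolding lie_superbialgebra_iso_def
  proof (intro conjI ballI allI)
    show "bij_betw f (carrier L.Q) (carrier M.Q)"
      by (rule bij_betw_byWitness[where f' = g])
        (auto simp: L.Q_simps M.Q_simps f_cl g_cl relabel_inverse)
    show "f ` part L.Q p \<subseteq> part M.Q p" for p
      using relabel_free_part[where par = par' and \<sigma> = \<sigma>, folded par_\<sigma>]
      by (auto simp: L.Q_simps M.Q_simps f_cl intro!: imageI)
    fix S assume "S \<in> carrier L.Q"
    then obtain x where S: "S = L.cl x" by (rule L.Q_carrierE)
    show "f (k \<odot>\<^bsub>L.Q\<^esub> S) = k \<odot>\<^bsub>M.Q\<^esub> f S" for k
      by (simp add: S f_cl L.Q_ops M.Q_ops relabel_linear)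
    show "tensor2_eq M.Q (tensor_map f (cobracket L.Q S)) (cobracket M.Q (f S))"
      unfolding tensor2_eq_iff
    proof (intro allI impI)
      fix B assume B: "bilinear_form M.Q B"
      let ?B = "\<lambda>a b. B (M.cl (mon a)) (M.cl (mon b))"
      have "pair (\<lambda>(v, w). B v w) (tensor_map f (cobracket L.Q S))
          = pair (\<lambda>u. M.cob u ?B) (relabel \<sigma> (rep S))"
        by (simp add: tensor_map_def case_prod_beta' L.pair_cobracket_rep f_cl relabel_linear
            cob[symmetric])
      also have "\<dots> = pair (\<lambda>(v, w). B v w) (cobracket M.Q (f S))"
        using M.pair_cobracket[of "\<lambda>(v, w). B v w"] M.bilinear_form_Ann2[OF B]
        by (simp add: f_def)
      finally show "pair (\<lambda>(v, w). B v w) (tensor_map f (cobracket L.Q S))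
          = pair (\<lambda>(v, w). B v w) (cobracket M.Q (f S))" .
    qed
    fix T assume "T \<in> carrier L.Q"
    then obtain y where T: "T = L.cl y" by (rule L.Q_carrierE)
    show "f (S \<oplus>\<^bsub>L.Q\<^esub> T) = f S \<oplus>\<^bsub>M.Q\<^esub> f T"
      by (simp add: S T f_cl L.Q_ops M.Q_ops relabel_linear)
    show "f (bracket L.Q S T) = bracket M.Q (f S) (f T)"
      by (simp add: S T f_cl L.Q_ops M.Q_ops relabel_bracket)
  qed
  then show ?thesis
    using L.Q_lie_superbialgebra M.Q_lie_superbialgebra
    by (auto simp: lie_superbialgebras_isomorphic_def)
qed

lemma (in superspace) part_carrier: "x \<in> part V p \<Longrightarrow> x \<in> carrier V"
  using part_submodule[of p] by (auto simp: submodule_def subgroup_def dest: subsetD)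

lemma (in superspace) part_zero: "\<zero> \<in> part V p"
  using part_submodule[of p] by (auto simp: submodule_def subgroup_def)

lemma (in superspace) part_unique:
  assumes "a \<in> part V 0" "b \<in> part V 1" "a' \<in> part V 0" "b' \<in> part V 1" "a \<oplus> b = a' \<oplus> b'"
  shows "a = a'" "b = b'"
proof -
  have "a \<oplus> b \<in> carrier V" using assms(1,2) by (simp add: part_carrier)
  from part_direct_sum[OF this] assms have "(a, b) = (a', b')"
    by (metis fst_conv snd_conv)
  then show "a = a'" "b = b'" by auto
qed

text \<open>The inverse map preserves parities because decompositions into homogeneous components are unique,
  and it respects the cobrackets because forms can be composed with it.\<close>

lemma lie_superbialgebras_isomorphic_sym:
  assumes "lie_superbialgebras_isomorphic L M"
  shows "lie_superbialgebras_isomorphic M L"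
proof -
  from assms obtain f where L: "lie_superbialgebra L" and M: "lie_superbialgebra M"
    and f: "lie_superbialgebra_iso L M f"
    by (auto simp: lie_superbialgebras_isomorphic_def)
  interpret L: lie_superbialgebra L by fact
  interpret M: lie_superbialgebra M by fact
  have bij: "bij_betw f (carrier L) (carrier M)"
    and add: "x \<in> carrier L \<Longrightarrow> y \<in> carrier L \<Longrightarrow> f (x \<oplus>\<^bsub>L\<^esub> y) = f x \<oplus>\<^bsub>M\<^esub> f y"
    and smult: "x \<in> carrier L \<Longrightarrow> f (k \<odot>\<^bsub>L\<^esub> x) = k \<odot>\<^bsub>M\<^esub> f x"
    and part: "x \<in> part L p \<Longrightarrow> f x \<in> part M p"
    and bracket: "x \<in> carrier L \<Longrightarrow> y \<in> carrier L \<Longrightarrow> f (bracket L x y) = bracket M (f x) (f y)"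
    and cobracket: "x \<in> carrier L \<Longrightarrow>
      tensor2_eq M (tensor_map f (cobracket L x)) (cobracket M (f x))"
    for x y k p
    using f by (simp_all add: lie_superbialgebra_iso_def image_subset_iff)
  define g where "g = the_inv_into (carrier L) f"
  have g: "y \<in> carrier M \<Longrightarrow> g y \<in> carrier L" "y \<in> carrier M \<Longrightarrow> f (g y) = y"
    "x \<in> carrier L \<Longrightarrow> g (f x) = x" for x y
    using bij unfolding g_def bij_betw_def
    by (simp_all add: f_the_inv_into_f the_inv_into_f_f the_inv_into_into)
  have "lie_superbialgebra_iso M L g"
    unfolding lie_superbialgebra_iso_def
  proof (intro conjI ballI allI)
    show "bij_betw g (carrier M) (carrier L)"
      unfolding g_def by (rule bij_betw_the_inv_into[OF bij])
    \<comment> \<open>If \<open>f x\<close> is homogeneous, then \<open>f\<close> kills the component of \<open>x\<close> of the other parity.\<close>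
    have zero: "f \<zero>\<^bsub>L\<^esub> = \<zero>\<^bsub>M\<^esub>"
    proof -
      have "f \<zero>\<^bsub>L\<^esub> \<in> carrier M" using bij L.zero_closed by (rule bij_betwE[THEN bspec])
      moreover have "f \<zero>\<^bsub>L\<^esub> \<oplus>\<^bsub>M\<^esub> f \<zero>\<^bsub>L\<^esub> = f \<zero>\<^bsub>L\<^esub>"
        using add[OF L.zero_closed L.zero_closed] L.l_zero[OF L.zero_closed] by (simp only:)
      ultimately show ?thesis using M.add.l_cancel_one by blast
    qed
    show "g ` part M p \<subseteq> part L p" for p
    proof
      fix x assume "x \<in> g ` part M p"
      then obtain y where y: "y \<in> part M p" "x = g y" by blast
      have x: "x \<in> carrier L" "f x = y"
        using g(1,2)[OF M.part_carrier[OF y(1)]] by (simp_all add: y(2))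
      obtain a b where ab: "a \<in> part L 0" "b \<in> part L 1" "x = a \<oplus>\<^bsub>L\<^esub> b"
        using L.part_direct_sum[OF x(1)] by blast
      have fab: "f a \<in> part M 0" "f b \<in> part M 1" "y = f a \<oplus>\<^bsub>M\<^esub> f b"
        using part[OF ab(1)] part[OF ab(2)] x(2) ab(3)
          add[OF L.part_carrier[OF ab(1)] L.part_carrier[OF ab(2)]] by simp_all
      have carr: "a \<in> carrier L" "b \<in> carrier L" "y \<in> carrier M"
        using ab y L.part_carrier M.part_carrier by blast+
      show "x \<in> part L p"
      proof (cases "p = 0")
        case True
        have "f b = \<zero>\<^bsub>M\<^esub>"
          by (rule M.part_unique(2)[OF fab(1,2) y(1)[unfolded True] M.part_zero])
            (simp only: fab(3)[symmetric] M.r_zero[OF carr(3)])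
        then have "b = \<zero>\<^bsub>L\<^esub>" using g(3)[OF carr(2)] g(3)[OF L.zero_closed] zero by metis
        then show ?thesis using ab(1) L.r_zero[OF carr(1)] by (simp only: ab(3) True)
      next
        case False
        then have p: "p = 1" by simp
        have "f a = \<zero>\<^bsub>M\<^esub>"
          by (rule M.part_unique(1)[OF fab(1,2) M.part_zero y(1)[unfolded p]])
            (simp only: fab(3)[symmetric] M.l_zero[OF carr(3)])
        then have "a = \<zero>\<^bsub>L\<^esub>" using g(3)[OF carr(1)] g(3)[OF L.zero_closed] zero by metis
        then show ?thesis using ab(2) L.l_zero[OF carr(2)] by (simp only: ab(3) p)
      qed
    qed
    fix y assume y: "y \<in> carrier M"
    then show "g (k \<odot>\<^bsub>M\<^esub> y) = k \<odot>\<^bsub>L\<^esub> g y" for k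
      using smult[of "g y" k] g(3)[of "k \<odot>\<^bsub>L\<^esub> g y"] g(1,2)[OF y] L.smult_closed[of k "g y"]
      by (simp add: ring_of_type_algebra_def)
    show "tensor2_eq L (tensor_map g (cobracket M y)) (cobracket L (g y))"
      unfolding tensor2_eq_iff
    proof (intro allI impI)
      fix B assume B: "bilinear_form L B"
      have "bilinear_form M (\<lambda>v w. B (g v) (g w))"
      proof -
        have "g (v \<oplus>\<^bsub>M\<^esub> w) = g v \<oplus>\<^bsub>L\<^esub> g w" if "v \<in> carrier M" "w \<in> carrier M" for v w
          using add[of "g v" "g w"] g(3)[of "g v \<oplus>\<^bsub>L\<^esub> g w"] g(1,2) that by simp
        moreover have "g (k \<odot>\<^bsub>M\<^esub> v) = k \<odot>\<^bsub>L\<^esub> g v" if "v \<in> carrier M" for k v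
          using smult[of "g v" k] g(3)[of "k \<odot>\<^bsub>L\<^esub> g v"] g(1,2)[OF that]
            L.smult_closed[of k "g v"]
          by (simp add: ring_of_type_algebra_def)
        ultimately show ?thesis
          using bilinear_formD[OF B] g(1) by (simp add: bilinear_form_def)
      qed
      then have "pair (\<lambda>(v, w). B (g v) (g w)) (tensor_map f (cobracket L (g y)))
          = pair (\<lambda>(v, w). B (g v) (g w)) (cobracket M (f (g y)))"
        using cobracket[OF g(1)[OF y]] by (simp only: tensor2_eq_iff)
      moreover have "pair (\<lambda>(v, w). B (g v) (g w)) (tensor_map f (cobracket L (g y)))
          = pair (\<lambda>(v, w). B v w) (cobracket L (g y))"
        unfolding tensor_map_def pair_lin_ext
        by (rule pair_cong) (use L.cobracket_closed[OF g(1)[OF y]] g(3) in auto)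
      ultimately show "pair (\<lambda>(v, w). B v w) (tensor_map g (cobracket M y))
          = pair (\<lambda>(v, w). B v w) (cobracket L (g y))"
        using g(2)[OF y] by (simp add: tensor_map_def case_prod_beta')
    qed
    fix z assume z: "z \<in> carrier M"
    show "g (y \<oplus>\<^bsub>M\<^esub> z) = g y \<oplus>\<^bsub>L\<^esub> g z"
      using add[of "g y" "g z"] g(3)[of "g y \<oplus>\<^bsub>L\<^esub> g z"] g(1,2) y z by simp
    show "g (bracket M y z) = bracket L (g y) (g z)"
      using bracket[of "g y" "g z"] g(3)[of "bracket L (g y) (g z)"] g(1,2) y z
        L.bracket_closed by simp
  qed
  with L M show ?thesis by (auto simp: lie_superbialgebras_isomorphic_def)
qed

section \<open>The superbialgebra of a Cartan matrix of rank two\<close>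

lemma free_bracket_mon: "free_bracket (mon u) (mon v) = mon (Br u v)"
  by (simp add: eq_iff_pair)

lemma pair_half_wedge [simp]:
  "pair \<phi> (half_wedge x y) = 1 / 2 * (\<phi> (Gen x, Gen y) - \<phi> (Gen y, Gen x))"
  by (simp add: half_wedge_def)

lemma keys_half_wedge: "keys (half_wedge x y) \<subseteq> {(Gen x, Gen y), (Gen y, Gen x)}"
proof
  fix t assume t: "t \<in> keys (half_wedge x y :: _ \<Rightarrow>\<^sub>0 'a)"
  show "t \<in> {(Gen x, Gen y), (Gen y, Gen x)}"
  proof (rule ccontr)
    assume "t \<notin> {(Gen x, Gen y), (Gen y, Gen x)}"
    then have "pair (\<lambda>r. if r = t then 1 else 0) (half_wedge x y :: _ \<Rightarrow>\<^sub>0 'a) = 0"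
      by auto
    with t show False by (simp add: pair_coefficient in_keys_iff)
  qed
qed

text \<open>The properties of the Cartan data of \<open>sl(2|1)\<close> that make the standard cobracket compatible with the
  relations. The symmetry of the matrix is what makes the mixed relations \<open>[e\<^sub>i, f\<^sub>j]\<close> compatible.\<close>

locale dynkin_superbialgebra =
  fixes A :: "vertex \<Rightarrow> vertex \<Rightarrow> int" and par :: "vertex \<Rightarrow> bit"
    and R :: "(generator monomial \<Rightarrow>\<^sub>0 'k::field_char_0) set"
  assumes R_def: "R = relators A par"
    and symmetric: "A i j = A j i"
    and grey: "par i = 1 \<Longrightarrow> A i i = 0"
    and white: "par i = 0 \<Longrightarrow> A i i = 2" "par i = 0 \<Longrightarrow> i \<noteq> j \<Longrightarrow> A i j = - 1"
begin

abbreviation "hh i \<equiv> Gen (H i)"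
abbreviation "ee i \<equiv> Gen (E i)"
abbreviation "ff i \<equiv> Gen (F i)"
abbreviation a :: "vertex \<Rightarrow> vertex \<Rightarrow> 'k" where "a i j \<equiv> of_int (A i j)"

text \<open>The entry \<open>-1\<close> next to a white vertex makes its Serre relations quadratic in that root vector.\<close>

lemma R_eq: "R =
    {mon (Br (hh i) (hh j)) |i j. True} \<union>
    {mon (Br (hh i) (ee j)) - fscale (a i j) (mon (ee j)) |i j. True} \<union>
    {mon (Br (hh i) (ff j)) + fscale (a i j) (mon (ff j)) |i j. True} \<union>
    {mon (Br (ee i) (ff j)) - (if i = j then mon (hh i) else 0) |i j. True} \<union>
    {mon (Br (ee i) (ee i)) |i. par i = 1} \<union>
    {mon (Br (ff i) (ff i)) |i. par i = 1} \<union>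
    {mon (Br (ee i) (Br (ee i) (ee j))) |i j. i \<noteq> j \<and> par i = 0} \<union>
    {mon (Br (ff i) (Br (ff i) (ff j))) |i j. i \<noteq> j \<and> par i = 0}"
proof -
  have Serre: "(free_bracket (mon u) ^^ nat (1 + \<bar>A i j\<bar>)) (mon v) = mon (Br u (Br u v))"
    if "par i = 0" "i \<noteq> j" for i j u and v :: "generator monomial"
    using white(2)[OF that] by (simp add: free_bracket_mon numeral_2_eq_2)
  have "({(free_bracket (mon (u i)) ^^ nat (1 + \<bar>A i j\<bar>)) (mon (u j)) |i j. i \<noteq> j \<and> par i = 0}
      :: (generator monomial \<Rightarrow>\<^sub>0 'k) set) = {mon (Br (u i) (Br (u i) (u j))) |i j. i \<noteq> j \<and> par i = 0}"
    for u :: "vertex \<Rightarrow> generator monomial"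
    by (intro Collect_cong ex_cong1) (auto simp: Serre)
  from this[of ee] this[of ff] show ?thesis
    unfolding R_def relators_def free_bracket_mon by (simp only:)
qed

lemma R_cases:
  assumes "x \<in> R"
  obtains (HH) i j where "x = mon (Br (hh i) (hh j))"
  | (HE) i j where "x = mon (Br (hh i) (ee j)) - fscale (a i j) (mon (ee j))"
  | (HF) i j where "x = mon (Br (hh i) (ff j)) + fscale (a i j) (mon (ff j))"
  | (EF) i j where "x = mon (Br (ee i) (ff j)) - (if i = j then mon (hh i) else 0)"
  | (EE) i where "par i = 1" "x = mon (Br (ee i) (ee i))"
  | (FF) i where "par i = 1" "x = mon (Br (ff i) (ff i))"
  | (SE) i j where "par i = 0" "i \<noteq> j" "x = mon (Br (ee i) (Br (ee i) (ee j)))"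
  | (SF) i j where "par i = 0" "i \<noteq> j" "x = mon (Br (ff i) (Br (ff i) (ff j)))"
  using assms unfolding R_eq by blast

lemma R_intros:
  "mon (Br (hh i) (hh j)) \<in> R"
  "mon (Br (hh i) (ee j)) - fscale (a i j) (mon (ee j)) \<in> R"
  "mon (Br (hh i) (ff j)) + fscale (a i j) (mon (ff j)) \<in> R"
  "mon (Br (ee i) (ff j)) - (if i = j then mon (hh i) else 0) \<in> R"
  "par i = 1 \<Longrightarrow> mon (Br (ee i) (ee i)) \<in> R"
  "par i = 1 \<Longrightarrow> mon (Br (ff i) (ff i)) \<in> R"
  "par i = 0 \<Longrightarrow> i \<noteq> j \<Longrightarrow> mon (Br (ee i) (Br (ee i) (ee j))) \<in> R"
  "par i = 0 \<Longrightarrow> i \<noteq> j \<Longrightarrow> mon (Br (ff i) (Br (ff i) (ff j))) \<in> R"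
  unfolding R_eq by blast+

end

sublocale dynkin_superbialgebra \<subseteq> cobracket_presentation "gen_parity par" R gen_cobracket
proof (unfold_locales)
  fix x assume "x \<in> R"
  then show "\<exists>p. x \<in> free_part (gen_parity par) p"
  proof (cases rule: R_cases)
    case (EF i j)
    then show ?thesis
      by (intro exI[of _ "par i + par j"]) (auto intro!: free_part_linear)
  next
    case (HE i j)
    then show ?thesis
      by (intro exI[of _ "par j"]) (auto intro!: free_part_linear free_part_fscale)
  next
    case (HF i j)
    then show ?thesis
      by (intro exI[of _ "par j"]) (auto intro!: free_part_linear free_part_fscale)
  qed auto
next
  fix u v g assume "(u, v) \<in> keys (gen_cobracket g :: _ \<Rightarrow>\<^sub>0 'k)"
  then show "mparity (gen_parity par) u + mparity (gen_parity par) v = gen_parity par g"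
    by (cases g) (auto dest!: subsetD[OF keys_half_wedge])
next
  fix B :: "generator monomial \<Rightarrow> generator monomial \<Rightarrow> 'k" and g
  show "pair (\<lambda>(u, v). B u v) (gen_cobracket g) =
      - pair (\<lambda>(u, v). psign (mparity (gen_parity par) u * mparity (gen_parity par) v) * B v u)
          (gen_cobracket g)"
    by (cases g) (simp_all add: field_simps)
qed

context dynkin_superbialgebra
begin

lemma relations:
  assumes "\<phi> \<in> Ann"
  shows "\<phi> (Br (hh i) (hh j)) = 0"
    "\<phi> (Br (hh i) (ee j)) = a i j * \<phi> (ee j)" "\<phi> (Br (ee j) (hh i)) = - a i j * \<phi> (ee j)"
    "\<phi> (Br (hh i) (ff j)) = - a i j * \<phi> (ff j)" "\<phi> (Br (ff j) (hh i)) = a i j * \<phi> (ff j)"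
    "\<phi> (Br (ee i) (ff j)) = (if i = j then \<phi> (hh i) else 0)"
    "\<phi> (Br (ff j) (ee i)) = (if i = j then - psign (par i) * \<phi> (hh i) else 0)"
    "par i = 1 \<Longrightarrow> \<phi> (Br (ee i) (ee i)) = 0" "par i = 1 \<Longrightarrow> \<phi> (Br (ff i) (ff i)) = 0"
    "par i = 0 \<Longrightarrow> i \<noteq> j \<Longrightarrow> \<phi> (Br (ee i) (Br (ee i) (ee j))) = 0"
    "par i = 0 \<Longrightarrow> i \<noteq> j \<Longrightarrow> \<phi> (Br (ff i) (Br (ff i) (ff j))) = 0"
proof -
  note rel = annihilator_relator[OF assms]
  show HH: "\<phi> (Br (hh i) (hh j)) = 0" using rel[OF R_intros(1)] by simp
  show HE: "\<phi> (Br (hh i) (ee j)) = a i j * \<phi> (ee j)" using rel[OF R_intros(2)] by simp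
  then show "\<phi> (Br (ee j) (hh i)) = - a i j * \<phi> (ee j)"
    using annihilator_skew[OF assms, of "ee j" "hh i"] by simp
  show HF: "\<phi> (Br (hh i) (ff j)) = - a i j * \<phi> (ff j)"
    using rel[OF R_intros(3)] by (simp add: eq_neg_iff_add_eq_0)
  then show "\<phi> (Br (ff j) (hh i)) = a i j * \<phi> (ff j)"
    using annihilator_skew[OF assms, of "ff j" "hh i"] by simp
  show EF: "\<phi> (Br (ee i) (ff j)) = (if i = j then \<phi> (hh i) else 0)"
    using rel[OF R_intros(4)] by (auto split: if_splits)
  show "\<phi> (Br (ff j) (ee i)) = (if i = j then - psign (par i) * \<phi> (hh i) else 0)"
    using annihilator_skew[OF assms, of "ff j" "ee i"] EF by (cases "par i") auto
qed (use annihilator_relator[OF assms R_intros(5)] annihilator_relator[OF assms R_intros(6)]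
    annihilator_relator[OF assms R_intros(7)] annihilator_relator[OF assms R_intros(8)]
    in simp_all)

lemma cob_generators:
  "cob (hh i) B = 0"
  "cob (ee i) B = 1 / 2 * (B (hh i) (ee i) - B (ee i) (hh i))"
  "cob (ff i) B = 1 / 2 * (B (hh i) (ff i) - B (ff i) (hh i))"
  by (simp_all add: cob_Gen)

text \<open>The Serre element \<open>[x, [x, y]]\<close> for an even simple root vector \<open>x\<close>, with \<open>e = 1\<close> for the positive and
  \<open>e = - 1\<close> for the negative root vectors; \<open>h\<close> and \<open>k\<close> are the Cartan elements of \<open>x\<close> and \<open>y\<close>. Its
  cobracket is computed from the values \<open>2\<close> and \<open>- 1\<close> of the Cartan matrix.\<close>

lemma cob_Serre:
  fixes e :: 'k
  assumes B: "B \<in> Ann2"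
    and deg: "deg x = 0" "deg h = 0" "deg k = 0"
    and x: "\<And>B. cob x B = 1 / 2 * (B h x - B x h)"
    and y: "\<And>B. cob y B = 1 / 2 * (B k y - B y k)"
    and rel: "\<And>\<phi>. \<phi> \<in> Ann \<Longrightarrow> \<phi> (Br x h) = - 2 * e * \<phi> x"
      "\<And>\<phi>. \<phi> \<in> Ann \<Longrightarrow> \<phi> (Br x k) = e * \<phi> x"
      "\<And>\<phi>. \<phi> \<in> Ann \<Longrightarrow> \<phi> (Br y h) = e * \<phi> y"
      "\<And>\<phi>. \<phi> \<in> Ann \<Longrightarrow> \<phi> (Br x (Br x y)) = 0"
  shows "cob (Br x (Br x y)) B = 0"
proof -
  let ?z = "Br x y"
  have xx: "\<phi> (Br x x) = 0" if "\<phi> \<in> Ann" for \<phi>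
  proof -
    have "2 * \<phi> (Br x x) = 0" using annihilator_skew[OF that, of x x] by (simp add: deg)
    then show ?thesis by simp
  qed
  have yx: "\<phi> (Br y x) = - \<phi> ?z" "\<phi> (Br ?z x) = 0" if "\<phi> \<in> Ann" for \<phi>
    using annihilator_skew[OF that, of y x] annihilator_skew[OF that, of ?z x] rel(4)[OF that]
    by (simp_all add: deg)
  have zh: "\<phi> (Br ?z h) = - e * \<phi> ?z" if \<phi>: "\<phi> \<in> Ann" for \<phi>
    using annihilator_jacobi[OF \<phi>, of x y h] rel(3)[OF annihilator_Br(1)[OF \<phi>, of x]]
      rel(1)[OF annihilator_Br(1)[OF \<phi>, of y]] yx(1)[OF \<phi>]
    by (simp add: deg add_eq_0_iff)
  note rels = rel xx yx zh
  note B1 = rels[OF Ann2D(1)[OF B]] rels[OF annihilator_Br(1)[OF Ann2D(1)[OF B]]]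
    and B2 = rels[OF Ann2D(2)[OF B]] rels[OF annihilator_Br(1)[OF Ann2D(2)[OF B]]]
  show ?thesis
    by (simp add: cob_Br act_def x y deg B1 B2 algebra_simps)
qed

lemma superbialgebra: "superbialgebra_presentation (gen_parity par) R gen_cobracket"
proof unfold_locales
  fix g T show "cojacobiator (Gen g) T = 0"
    by (cases g) (simp_all add: cojacobiator_def cojacobi_left_def cojacobi_right_def
        cob_generators flip23_def algebra_simps)
next
  fix x and B assume x: "x \<in> R" and B: "B \<in> Ann2"
  note B_rel = relations[OF Ann2D(1)[OF B]] relations[OF Ann2D(2)[OF B]]
  from x show "pair (\<lambda>u. cob u B) x = 0"
  proof (cases rule: R_cases)
    case (SE i j)
    have "A j i = - 1" using white(2)[OF SE(1,2)] symmetric[of j i] by simp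
    with SE have "cob (Br (ee i) (Br (ee i) (ee j))) B = 0"
      by (intro cob_Serre[OF B, where e = 1 and h = "hh i" and k = "hh j"])
        (simp_all add: cob_generators relations white)
    with SE show ?thesis by simp
  next
    case (SF i j)
    have "A j i = - 1" using white(2)[OF SF(1,2)] symmetric[of j i] by simp
    with SF have "cob (Br (ff i) (Br (ff i) (ff j))) B = 0"
      by (intro cob_Serre[OF B, where e = "- 1" and h = "hh i" and k = "hh j"])
        (simp_all add: cob_generators relations white)
    with SF show ?thesis by simp
  next
    case (EF i j)
    have "cob (Br (ee i) (ff j)) B = 0"
      unfolding cob_Br cob_generators act_def B_rel using symmetric[of j i]
      by (cases "i = j"; cases "par i"; cases "par j")
        (simp_all add: B_rel algebra_simps)
    with EF show ?thesis by (simp add: cob_generators)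
  next
    case (EE i)
    then show ?thesis
      by (simp add: cob_Br cob_generators act_def B_rel grey)
  next
    case (FF i)
    then show ?thesis
      by (simp add: cob_Br cob_generators act_def B_rel grey)
  next
    case (HE i j)
    show ?thesis
      unfolding HE by (simp add: cob_Br cob_generators act_def B_rel algebra_simps)
  next
    case (HF i j)
    show ?thesis
      unfolding HF by (simp add: cob_Br cob_generators act_def B_rel algebra_simps)
  qed (simp add: cob_Br cob_generators)
qed

end

sublocale dynkin_superbialgebra \<subseteq> superbialgebra_presentation "gen_parity par" R gen_cobracket
  by (rule superbialgebra)

section \<open>The natural representation\<close>

definition mat_mul :: "(letter \<Rightarrow> letter \<Rightarrow> 'k::field) \<Rightarrow> (letter \<Rightarrow> letter \<Rightarrow> 'k) \<Rightarrow> (letter \<Rightarrow> letter \<Rightarrow> 'k)"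
  where "mat_mul M N = (\<lambda>x y. M x Eps1 * N Eps1 y + M x Eps2 * N Eps2 y + M x Del1 * N Del1 y)"

definition mat_unit :: "letter \<Rightarrow> letter \<Rightarrow> (letter \<Rightarrow> letter \<Rightarrow> 'k::field)"
  where "mat_unit x y = (\<lambda>v w. if v = x \<and> w = y then 1 else 0)"

definition letter_parity :: "letter \<Rightarrow> bit"
  where "letter_parity x = (if x = Del1 then 1 else 0)"

lemma mat_mul_assoc: "mat_mul (mat_mul M N) L = mat_mul M (mat_mul N L)"
  by (simp add: mat_mul_def algebra_simps)

lemma mat_mul_linear:
  "mat_mul (\<lambda>x y. M x y - k * N x y) L = (\<lambda>x y. mat_mul M L x y - k * mat_mul N L x y)"
  "mat_mul L (\<lambda>x y. M x y - k * N x y) = (\<lambda>x y. mat_mul L M x y - k * mat_mul L N x y)"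
  by (simp_all add: mat_mul_def algebra_simps)

text \<open>Matrices with rows and columns indexed by letters form a Lie superalgebra under the supercommutator,
  with parities of positions given by \<open>letter_parity\<close>; \<open>mat_rep\<close> extends an assignment of matrices to
  generators to all monomials.\<close>

primrec mat_rep :: "('x \<Rightarrow> bit) \<Rightarrow> ('x \<Rightarrow> letter \<Rightarrow> letter \<Rightarrow> 'k::field) \<Rightarrow> 'x monomial \<Rightarrow> letter \<Rightarrow> letter \<Rightarrow> 'k"
  where
    "mat_rep par \<rho> (Gen a) = \<rho> a"
  | "mat_rep par \<rho> (Br u v) = (\<lambda>x y. mat_mul (mat_rep par \<rho> u) (mat_rep par \<rho> v) x y
      - psign (mparity par u * mparity par v) * mat_mul (mat_rep par \<rho> v) (mat_rep par \<rho> u) x y)"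

lemma mat_rep_parity:
  assumes "\<And>a x y. \<rho> a x y \<noteq> 0 \<Longrightarrow> par a = letter_parity x + letter_parity y"
  shows "mat_rep par \<rho> u x y \<noteq> 0 \<Longrightarrow> mparity par u = letter_parity x + letter_parity y"
proof (induction u arbitrary: x y)
  case (Gen a)
  then show ?case using assms by simp
next
  case (Br u v)
  have nonzero: "\<exists>z. M x z \<noteq> 0 \<and> N z y \<noteq> 0" if "mat_mul M N x y \<noteq> 0"
    for M N :: "letter \<Rightarrow> letter \<Rightarrow> 'b"
  proof (rule ccontr)
    assume "\<nexists>z. M x z \<noteq> 0 \<and> N z y \<noteq> 0"
    then have "M x z * N z y = 0" for z by auto
    with that show False by (simp add: mat_mul_def)
  qed
  from Br.prems consider "mat_mul (mat_rep par \<rho> u) (mat_rep par \<rho> v) x y \<noteq> 0"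
    | "mat_mul (mat_rep par \<rho> v) (mat_rep par \<rho> u) x y \<noteq> 0"
    by fastforce
  then obtain z where "mat_rep par \<rho> u x z \<noteq> 0 \<and> mat_rep par \<rho> v z y \<noteq> 0
      \<or> mat_rep par \<rho> v x z \<noteq> 0 \<and> mat_rep par \<rho> u z y \<noteq> 0"
    using nonzero by cases blast+
  then show ?case
    using Br.IH(1)[of x z] Br.IH(2)[of z y] Br.IH(2)[of x z] Br.IH(1)[of z y]
    by (auto simp: ac_simps)
qed

text \<open>If the matrices of the generators satisfy the relations, matrix coefficients are functionals on the
  quotient: the skew-symmetry and Jacobi relators vanish as in every associative superalgebra. The sign in
  the supercommutator depends on the parity of the argument, which is determined by the position
  of a nonzero entry, so each coefficient of a bracket is a fixed combination of coefficients of
  its argument.\<close>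

lemma mat_rep_annihilator:
  fixes \<rho> :: "'x \<Rightarrow> letter \<Rightarrow> letter \<Rightarrow> 'k::field"
  assumes \<rho>: "\<And>a x y. \<rho> a x y \<noteq> 0 \<Longrightarrow> par a = letter_parity x + letter_parity y"
    and R: "\<And>r x y. r \<in> R \<Longrightarrow> pair (\<lambda>u. mat_rep par \<rho> u x y) r = 0"
  shows "(\<lambda>u. mat_rep par \<rho> u x y) \<in> annihilator par R"
proof -
  let ?M = "mat_rep par \<rho>"
  have sign: "psign (mparity par u * mparity par v) * ?M v x y
      = psign (mparity par u * (letter_parity x + letter_parity y)) * ?M v x y" for u v x y
    using mat_rep_parity[of \<rho> par v x y] \<rho> by (cases "?M v x y = 0") auto
  have sign': "psign (mparity par v * mparity par u) * ?M v x y
      = psign (mparity par u * (letter_parity x + letter_parity y)) * ?M v x y" for u v x y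
    using sign[of u v x y] by (simp only: mult.commute[of "mparity par v"])
  have distrib: "k * (n1 * m1 + n2 * m2 + n3 * m3) = m1 * (k * n1) + m2 * (k * n2) + m3 * (k * n3)"
    "k * (m1 * n1 + m2 * n2 + m3 * n3) = m1 * (k * n1) + m2 * (k * n2) + m3 * (k * n3)"
    for k m1 m2 m3 n1 n2 n3 :: 'k
    by (simp_all add: algebra_simps)
  have Br_left: "?M (Br u v) x y =
      (?M u x Eps1 * ?M v Eps1 y + ?M u x Eps2 * ?M v Eps2 y + ?M u x Del1 * ?M v Del1 y)
      - (?M u Eps1 y * (psign (mparity par u * (letter_parity x + letter_parity Eps1)) * ?M v x Eps1)
      + ?M u Eps2 y * (psign (mparity par u * (letter_parity x + letter_parity Eps2)) * ?M v x Eps2)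
      + ?M u Del1 y * (psign (mparity par u * (letter_parity x + letter_parity Del1)) * ?M v x Del1))"
    for u v x y
    unfolding mat_rep.simps mat_mul_def distrib(1) sign ..
  have Br_right: "?M (Br v u) x y =
      (?M u Eps1 y * ?M v x Eps1 + ?M u Eps2 y * ?M v x Eps2 + ?M u Del1 y * ?M v x Del1)
      - (?M u x Eps1 * (psign (mparity par u * (letter_parity Eps1 + letter_parity y)) * ?M v Eps1 y)
      + ?M u x Eps2 * (psign (mparity par u * (letter_parity Eps2 + letter_parity y)) * ?M v Eps2 y)
      + ?M u x Del1 * (psign (mparity par u * (letter_parity Del1 + letter_parity y)) * ?M v Del1 y))"
    for u v x y
    unfolding mat_rep.simps mat_mul_def distrib(2) sign' by (simp only: mult.commute)
  have "pair (\<lambda>u. ?M u x y) z = 0" if "z \<in> presented_ideal par R" for z x y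
    using that
  proof (induction arbitrary: x y rule: presented_ideal.induct)
    case (relator r)
    then show ?case by (rule R)
  next
    case (skew v p w q)
    have rel: "?M (Br u v) x y + psign (mparity par u * mparity par v) * ?M (Br v u) x y = 0" for u v
      by (cases "mparity par u"; cases "mparity par v") simp_all
    have "pair (\<lambda>u. pair (\<lambda>v. ?M (Br u v) x y + psign (p * q) * ?M (Br v u) x y) w) v
        = pair (\<lambda>u. pair (\<lambda>v. ?M (Br u v) x y
            + psign (mparity par u * mparity par v) * ?M (Br v u) x y) w) v"
      by (intro free_part_pair_cong[OF skew(1)] free_part_pair_cong[OF skew(2)])
        (simp del: mat_rep.simps)
    then show ?case
      by (simp add: rel pair_add_left pair_scale_left
          pair_swap[of "\<lambda>u v. ?M (Br v u) x y"] del: mat_rep.simps)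
  next
    case (jacobi u p v q w r)
    have rel: "?M (Br u (Br v w)) x y - ?M (Br (Br u v) w) x y
        - psign (mparity par u * mparity par v) * ?M (Br v (Br u w)) x y = 0" for u v w
      unfolding mat_rep.simps mat_mul_linear mat_mul_assoc
      by (cases "mparity par u"; cases "mparity par v"; cases "mparity par w") simp_all
    have "pair (\<lambda>u. pair (\<lambda>v. pair (\<lambda>w. ?M (Br u (Br v w)) x y - ?M (Br (Br u v) w) x y
          - psign (p * q) * ?M (Br v (Br u w)) x y) w) v) u
        = pair (\<lambda>u. pair (\<lambda>v. pair (\<lambda>w. ?M (Br u (Br v w)) x y - ?M (Br (Br u v) w) x y
          - psign (mparity par u * mparity par v) * ?M (Br v (Br u w)) x y) w) v) u"
      by (intro free_part_pair_cong[OF jacobi(1)] free_part_pair_cong[OF jacobi(2)])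
        (simp del: mat_rep.simps)
    then show ?case
      by (simp add: rel pair_minus_left pair_scale_left
          pair_swap[of "\<lambda>u v. pair (\<lambda>w. ?M (Br v (Br u w)) x y) w"] del: mat_rep.simps)
  next
    case (left z w)
    have "pair (\<lambda>v. ?M (Br u v) x y) z = 0" for u
      unfolding Br_left by (simp add: pair_add_left pair_minus_left pair_scale_left left.IH)
    then show ?case by (simp del: mat_rep.simps)
  next
    case (right z w)
    have "pair (\<lambda>v. ?M (Br v u) x y) z = 0" for u
      unfolding Br_right by (simp add: pair_add_left pair_minus_left pair_scale_left right.IH)
    then show ?case by (simp add: pair_swap[of _ w] del: mat_rep.simps)
  qed simp_all
  then show ?thesis by (simp add: annihilator_def)
qed

section \<open>The even part when both simple roots are odd\<close>

locale grey_dynkin = dynkin_superbialgebra +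
  assumes par_grey: "par i = 1" and A_grey: "A i j = (if i = j then 0 else 1)"
begin

abbreviation "e12 \<equiv> Br (ee V1) (ee V2)"
abbreviation "f12 \<equiv> Br (ff V1) (ff V2)"

definition spanning :: "generator monomial set"
  where "spanning = {hh V1, hh V2, ee V1, ee V2, ff V1, ff V2, e12, f12}"

text \<open>The vectors congruent modulo the ideal to a combination of the spanning monomials.\<close>

definition spanned :: "(generator monomial \<Rightarrow>\<^sub>0 'a) set"
  where "spanned = {x. \<exists>c. keys c \<subseteq> spanning \<and> (\<forall>\<phi>\<in>Ann. pair \<phi> x = pair \<phi> c)}"

lemma spanned_mon: "u \<in> spanning \<Longrightarrow> mon u \<in> spanned"
  unfolding spanned_def by (auto intro!: exI[of _ "mon u"])

lemma spanned_cong: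
  "y \<in> spanned \<Longrightarrow> (\<And>\<phi>. \<phi> \<in> Ann \<Longrightarrow> pair \<phi> x = pair \<phi> y) \<Longrightarrow> x \<in> spanned"
  unfolding spanned_def by auto

lemma spanned_zero: "0 \<in> spanned"
  unfolding spanned_def by (auto intro!: exI[of _ 0])

lemma spanned_add: "x \<in> spanned \<Longrightarrow> y \<in> spanned \<Longrightarrow> x + y \<in> spanned"
proof -
  assume "x \<in> spanned" "y \<in> spanned"
  then obtain c d where "keys c \<subseteq> spanning" "\<forall>\<phi>\<in>Ann. pair \<phi> x = pair \<phi> c"
    "keys d \<subseteq> spanning" "\<forall>\<phi>\<in>Ann. pair \<phi> y = pair \<phi> d"
    unfolding spanned_def by auto
  then show ?thesis
    unfolding spanned_def using Poly_Mapping.keys_add[of c d]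
    by (intro CollectI exI[of _ "c + d"]) auto
qed

lemma spanned_scale: "x \<in> spanned \<Longrightarrow> fscale k x \<in> spanned"
proof -
  assume "x \<in> spanned"
  then obtain c where "keys c \<subseteq> spanning" "\<forall>\<phi>\<in>Ann. pair \<phi> x = pair \<phi> c"
    unfolding spanned_def by auto
  then show ?thesis
    unfolding spanned_def using keys_fscale[of k c]
    by (intro CollectI exI[of _ "fscale k c"]) auto
qed

lemma spanned_lin_ext: "(\<And>u. u \<in> keys p \<Longrightarrow> g u \<in> spanned) \<Longrightarrow> lin_ext g p \<in> spanned"
proof -
  assume g: "\<And>u. u \<in> keys p \<Longrightarrow> g u \<in> spanned"
  have "(\<Sum>u\<in>B. fscale (lookup p u) (g u)) \<in> spanned" if "finite B" "B \<subseteq> keys p" for B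
    using that by (induction B) (auto simp: spanned_zero g intro!: spanned_add spanned_scale)
  then show ?thesis unfolding lin_ext_def by simp
qed

lemma spanned_multiple:
  assumes "b \<in> spanning" "\<And>\<phi>. \<phi> \<in> Ann \<Longrightarrow> \<phi> u = k * \<phi> b"
  shows "mon u \<in> spanned"
  by (rule spanned_cong[OF spanned_scale[OF spanned_mon[OF assms(1)], of k]]) (simp add: assms(2))

lemma grey_relations:
  assumes \<phi>: "\<phi> \<in> Ann"
  shows "\<phi> (Br (hh i) (Br (ee j) (ee k))) = (a i j + a i k) * \<phi> (Br (ee j) (ee k))"
    "\<phi> (Br (hh i) (Br (ff j) (ff k))) = - (a i j + a i k) * \<phi> (Br (ff j) (ff k))"
    "\<phi> (Br (ee j) (ee i)) = \<phi> (Br (ee i) (ee j))"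
    "\<phi> (Br (ff j) (ff i)) = \<phi> (Br (ff i) (ff j))"
    "\<phi> (Br (ee i) (Br (ee i) (ee j))) = 0"
    "\<phi> (Br (ff i) (Br (ff i) (ff j))) = 0"
    "i \<noteq> j \<Longrightarrow> \<phi> (Br (ee i) (Br (ff i) (ff j))) = - \<phi> (ff j)"
    "i \<noteq> j \<Longrightarrow> \<phi> (Br (ff i) (Br (ee i) (ee j))) = \<phi> (ee j)"
proof -
  note rel = relations[OF \<phi>] and left = relations[OF annihilator_Br(1)[OF \<phi>]]
    and right = relations[OF annihilator_Br(2)[OF \<phi>]]
  note jac = annihilator_jacobi[OF \<phi>]
  show "\<phi> (Br (hh i) (Br (ee j) (ee k))) = (a i j + a i k) * \<phi> (Br (ee j) (ee k))"
    using jac[of "hh i" "ee j" "ee k"] by (simp add: left right distrib_right)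
  show "\<phi> (Br (hh i) (Br (ff j) (ff k))) = - (a i j + a i k) * \<phi> (Br (ff j) (ff k))"
    using jac[of "hh i" "ff j" "ff k"] by (simp add: left right algebra_simps)
  show "\<phi> (Br (ee j) (ee i)) = \<phi> (Br (ee i) (ee j))" "\<phi> (Br (ff j) (ff i)) = \<phi> (Br (ff i) (ff j))"
    using annihilator_skew[OF \<phi>, of "ee j" "ee i"] annihilator_skew[OF \<phi>, of "ff j" "ff i"]
    by (simp_all add: par_grey)
  \<comment> \<open>For odd \<open>x\<close> with \<open>[x, x] = 0\<close> the Jacobi identity reads \<open>[x, [x, y]] = - [x, [x, y]]\<close>.\<close>
  have double: "z = 0" if "z = - z" for z :: 'a
  proof -
    have "2 * z = 0" using that by (simp add: eq_neg_iff_add_eq_0 flip: mult_2)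
    then show ?thesis by simp
  qed
  show "\<phi> (Br (ee i) (Br (ee i) (ee j))) = 0"
    using jac[of "ee i" "ee i" "ee j"] by (intro double) (simp add: right(8)[OF par_grey] par_grey)
  show "\<phi> (Br (ff i) (Br (ff i) (ff j))) = 0"
    using jac[of "ff i" "ff i" "ff j"] by (intro double) (simp add: right(9)[OF par_grey] par_grey)
  show "\<phi> (Br (ee i) (Br (ff i) (ff j))) = - \<phi> (ff j)" if "i \<noteq> j"
    using jac[of "ee i" "ff i" "ff j"] that by (simp add: rel left right par_grey A_grey)
  show "\<phi> (Br (ff i) (Br (ee i) (ee j))) = \<phi> (ee j)" if "i \<noteq> j"
    using jac[of "ff i" "ee i" "ee j"] that by (simp add: rel left right par_grey A_grey)
qed

text \<open>Each bracket of a generator with a spanning monomial is a multiple of a single spanning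
  monomial.\<close>

lemma generator_times_spanning:
  assumes "b \<in> spanning"
  shows "mon (Br (Gen g) b) \<in> spanned"
proof -
  have ex: "\<exists>b'\<in>spanning. \<exists>k. \<forall>\<phi>\<in>Ann. \<phi> (Br (Gen g) b) = k * \<phi> b'"
  proof -
    have S: "hh i \<in> spanning" "ee i \<in> spanning" "ff i \<in> spanning" for i
      by (cases i; simp add: spanning_def)+
    have S': "e12 \<in> spanning" "f12 \<in> spanning" by (simp_all add: spanning_def)
    have swap: "\<phi> (Br (ee V2) (Br (ee V1) (ee V2))) = 0" "\<phi> (Br (ff V2) (Br (ff V1) (ff V2))) = 0"
      "\<phi> (Br (ee V2) (Br (ff V1) (ff V2))) = - \<phi> (ff V1)"
      "\<phi> (Br (ff V2) (Br (ee V1) (ee V2))) = \<phi> (ee V1)" if "\<phi> \<in> Ann" for \<phi>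
      using grey_relations(3,4)[OF annihilator_Br(1)[OF that]]
        grey_relations(5-8)[OF that] by (metis vertex.distinct(1))+
    consider i where "b = hh i" | i where "b = ee i" | i where "b = ff i" | "b = e12" | "b = f12"
      using assms by (auto simp: spanning_def)
    then show ?thesis
    proof cases
      case (1 i)
      show ?thesis
      proof (cases g)
        case (H j)
        then show ?thesis unfolding 1
          by (intro bexI[OF _ S(1)[of i]] exI[of _ 0]) (simp add: relations)
      next
        case (E j)
        then show ?thesis unfolding 1
          by (intro bexI[OF _ S(2)[of j]] exI[of _ "- a i j"]) (simp add: relations)
      next
        case (F j)
        then show ?thesis unfolding 1
          by (intro bexI[OF _ S(3)[of j]] exI[of _ "a i j"]) (simp add: relations)
      qed
    next
      case (2 i)
      show ?thesis
      proof (cases g)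
        case (H j)
        then show ?thesis unfolding 2
          by (intro bexI[OF _ S(2)[of i]] exI[of _ "a j i"]) (simp add: relations)
      next
        case (E j)
        then show ?thesis unfolding 2
          by (intro bexI[OF _ S'(1)] exI[of _ "if i = j then 0 else 1"], cases i; cases j)
            (simp_all add: relations par_grey grey_relations(3)[of _ V2 V1])
      next
        case (F j)
        then show ?thesis unfolding 2
          by (intro bexI[OF _ S(1)[of i]] exI[of _ "if i = j then 1 else 0"])
            (auto simp: relations par_grey)
      qed
    next
      case (3 i)
      show ?thesis
      proof (cases g)
        case (H j)
        then show ?thesis unfolding 3
          by (intro bexI[OF _ S(3)[of i]] exI[of _ "- a j i"]) (simp add: relations)
      next
        case (E j)
        then show ?thesis unfolding 3
          by (intro bexI[OF _ S(1)[of i]] exI[of _ "if i = j then 1 else 0"])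
            (auto simp: relations)
      next
        case (F j)
        then show ?thesis unfolding 3
          by (intro bexI[OF _ S'(2)] exI[of _ "if i = j then 0 else 1"], cases i; cases j)
            (simp_all add: relations par_grey grey_relations(4)[of _ V2 V1])
      qed
    next
      case 4
      show ?thesis
      proof (cases g)
        case (H j)
        then show ?thesis unfolding 4
          by (intro bexI[OF _ S'(1)] exI[of _ "a j V1 + a j V2"]) (simp add: grey_relations(1))
      next
        case (E j)
        then show ?thesis unfolding 4
          by (intro bexI[OF _ S'(1)] exI[of _ 0], cases j) (simp_all add: swap grey_relations(5))
      next
        case (F j)
        then show ?thesis unfolding 4
          by (intro bexI[OF _ S(2)[of "if j = V1 then V2 else V1"]] exI[of _ 1], cases j)
            (simp_all add: swap grey_relations(8))
      qed
    next
      case 5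
      show ?thesis
      proof (cases g)
        case (H j)
        then show ?thesis unfolding 5
          by (intro bexI[OF _ S'(2)] exI[of _ "- (a j V1 + a j V2)"]) (simp add: grey_relations(2))
      next
        case (E j)
        then show ?thesis unfolding 5
          by (intro bexI[OF _ S(3)[of "if j = V1 then V2 else V1"]] exI[of _ "- 1"], cases j)
            (simp_all add: swap grey_relations(7))
      next
        case (F j)
        then show ?thesis unfolding 5
          by (intro bexI[OF _ S'(2)] exI[of _ 0], cases j) (simp_all add: swap grey_relations(6))
      qed
    qed
  qed
  then show ?thesis by (blast intro: spanned_multiple)
qed

text \<open>By the Jacobi identity the elements whose adjoint action preserves the span form a subalgebra,
  and it contains the generators.\<close>

lemma monomial_times_spanned: "w \<in> spanned \<Longrightarrow> free_bracket (mon u) w \<in> spanned"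
proof (induction u arbitrary: w)
  case (Gen g)
  then obtain c where c: "keys c \<subseteq> spanning" "\<forall>\<phi>\<in>Ann. pair \<phi> w = pair \<phi> c"
    unfolding spanned_def by auto
  have "lin_ext (\<lambda>b. mon (Br (Gen g) b)) c \<in> spanned"
    using c(1) by (auto intro!: spanned_lin_ext generator_times_spanning)
  then show ?case
    by (rule spanned_cong) (simp add: c(2) annihilator_Br)
next
  case (Br u v)
  have "free_bracket (mon u) (free_bracket (mon v) w)
      + fscale (- s u v) (free_bracket (mon v) (free_bracket (mon u) w)) \<in> spanned"
    by (intro spanned_add spanned_scale Br)
  then show ?case
  proof (rule spanned_cong)
    fix \<phi> assume \<phi>: "\<phi> \<in> Ann"
    have "\<phi> (Br (Br u v) t) = \<phi> (Br u (Br v t)) + - s u v * \<phi> (Br v (Br u t))" for t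
      using annihilator_jacobi[OF \<phi>, of u v t] by simp
    then show "pair \<phi> (free_bracket (mon (Br u v)) w)
        = pair \<phi> (free_bracket (mon u) (free_bracket (mon v) w)
            + fscale (- s u v) (free_bracket (mon v) (free_bracket (mon u) w)))"
      by (simp add: pair_minus_left pair_scale_left)
  qed
qed

lemma all_spanned: "x \<in> spanned"
proof -
  have "mon u \<in> spanned" for u
  proof (induction u)
    case (Gen g)
    show ?case
    proof (cases g)
      case (H i) then show ?thesis by (cases i) (auto intro!: spanned_mon simp: spanning_def)
    next
      case (E i) then show ?thesis by (cases i) (auto intro!: spanned_mon simp: spanning_def)
    next
      case (F i) then show ?thesis by (cases i) (auto intro!: spanned_mon simp: spanning_def)
    qed
  next
    case (Br u v)
    then show ?case using monomial_times_spanned[of "mon v" u] by (simp add: free_bracket_mon)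
  qed
  then have "lin_ext mon x \<in> spanned" by (intro spanned_lin_ext)
  then show ?thesis by (rule spanned_cong) simp
qed

text \<open>Truncating a functional to even monomials removes the odd spanning monomials.\<close>

lemma even_part_spanned:
  assumes x: "x \<in> free_part (gen_parity par) 0"
  shows "\<exists>k1 k2 k3 k4. \<forall>\<phi>\<in>Ann. pair \<phi> x =
    k1 * \<phi> (hh V1) + k2 * \<phi> (hh V2) + k3 * \<phi> e12 + k4 * \<phi> f12"
proof -
  obtain c where c: "keys c \<subseteq> spanning" "\<forall>\<phi>\<in>Ann. pair \<phi> x = pair \<phi> c"
    using all_spanned[of x] unfolding spanned_def by auto
  have "pair \<phi> x = lookup c (hh V1) * \<phi> (hh V1) + lookup c (hh V2) * \<phi> (hh V2)
      + lookup c e12 * \<phi> e12 + lookup c f12 * \<phi> f12" if \<phi>: "\<phi> \<in> Ann" for \<phi>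
  proof -
    let ?\<phi> = "\<lambda>u. if deg u = 0 then \<phi> u else 0"
    have "pair \<phi> x = pair ?\<phi> x" by (rule free_part_pair_cong[OF x]) simp
    also have "\<dots> = pair ?\<phi> c"
      using c(2) annihilator_homogeneous[OF relators_homogeneous \<phi>] by blast
    also have "\<dots> = (\<Sum>u\<in>spanning. lookup c u * ?\<phi> u)"
      by (rule pair_superset[OF _ c(1)]) (simp add: spanning_def)
    finally show ?thesis by (simp add: spanning_def par_grey add.assoc)
  qed
  then show ?thesis by blast
qed

end

section \<open>Diagrams with the same numbers of dots\<close>

primrec map_vertex :: "(vertex \<Rightarrow> vertex) \<Rightarrow> generator \<Rightarrow> generator"
  where
    "map_vertex \<sigma> (H i) = H (\<sigma> i)"
  | "map_vertex \<sigma> (E i) = E (\<sigma> i)"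
  | "map_vertex \<sigma> (F i) = F (\<sigma> i)"

lemma relators_map_vertex:
  fixes R R' :: "(generator monomial \<Rightarrow>\<^sub>0 'k::field_char_0) set"
  assumes "dynkin_superbialgebra A par R" "dynkin_superbialgebra A' par' R'"
    and \<sigma>: "inj \<sigma>" "\<And>i j. A' (\<sigma> i) (\<sigma> j) = A i j" "\<And>i. par' (\<sigma> i) = par i"
    and x: "x \<in> R"
  shows "relabel (map_vertex \<sigma>) x \<in> R'"
proof -
  interpret L: dynkin_superbialgebra A par R by fact
  interpret M: dynkin_superbialgebra A' par' R' by fact
  note inj = inj_eq[OF \<sigma>(1)]
  from x show ?thesis
  proof (cases rule: L.R_cases)
    case (HE i j)
    then show ?thesis using M.R_intros(2)[of "\<sigma> i" "\<sigma> j"] by (simp add: relabel_linear \<sigma>)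
  next
    case (HF i j)
    then show ?thesis using M.R_intros(3)[of "\<sigma> i" "\<sigma> j"] by (simp add: relabel_linear \<sigma>)
  next
    case (EF i j)
    then show ?thesis using M.R_intros(4)[of "\<sigma> i" "\<sigma> j"] by (cases "i = j") (simp_all add: relabel_linear inj)
  qed (simp_all add: relabel_linear M.R_intros \<sigma> inj)
qed

lemma equal_Cartan_data_isomorphic:
  fixes R R' :: "(generator monomial \<Rightarrow>\<^sub>0 'k::field_char_0) set"
  assumes L: "dynkin_superbialgebra A par R" and M: "dynkin_superbialgebra A' par' R'"
    and inverse: "\<And>i. \<rho> (\<sigma> i) = i" "\<And>i. \<sigma> (\<rho> i) = i"
    and A: "\<And>i j. A' (\<sigma> i) (\<sigma> j) = A i j" and par: "\<And>i. par' (\<sigma> i) = par i"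
  shows "lie_superbialgebras_isomorphic
    (presented_superbialgebra (gen_parity par) R gen_cobracket)
    (presented_superbialgebra (gen_parity par') R' gen_cobracket)"
proof (rule relabelled_presentations_isomorphic)
  show "superbialgebra_presentation (gen_parity par) R gen_cobracket"
    "superbialgebra_presentation (gen_parity par') R' gen_cobracket"
    by (rule dynkin_superbialgebra.superbialgebra, fact)+
  show "map_vertex \<rho> (map_vertex \<sigma> g) = g" "map_vertex \<sigma> (map_vertex \<rho> g) = g" for g
    by (cases g; simp add: inverse)+
  show "gen_parity par' (map_vertex \<sigma> g) = gen_parity par g" for g
    by (cases g) (simp_all add: par)
  have A': "A (\<rho> i) (\<rho> j) = A' i j" and par': "par (\<rho> i) = par' i" for i j
    using A[of "\<rho> i" "\<rho> j"] par[of "\<rho> i"] by (simp_all add: inverse)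
  show "relabel (map_vertex \<sigma>) x \<in> R'" if "x \<in> R" for x
    using relators_map_vertex[OF L M _ A par that] inverse(1) by (metis injI)
  show "relabel (map_vertex \<rho>) x \<in> R" if "x \<in> R'" for x
    using relators_map_vertex[OF M L _ A' par' that] inverse(2) by (metis injI)
  show "pair (\<lambda>(u, v). B u v) (gen_cobracket (map_vertex \<sigma> g)) =
      pair (\<lambda>(u, v). B (map_monomial (map_vertex \<sigma>) u) (map_monomial (map_vertex \<sigma>) v))
        (gen_cobracket g)" for g and B :: "_ \<Rightarrow> _ \<Rightarrow> 'k"
    by (cases g) simp_all
qed

section \<open>Diagrams with different numbers of dots\<close>

lemma (in dynkin_superbialgebra) white_root_vector_nonzero:
  assumes ij: "i \<noteq> j" "par i = 0" "par j = 1"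
  shows "\<exists>\<phi>\<in>Ann. \<phi> (ee i) \<noteq> 0"
proof -
  \<comment> \<open>The natural representation in the ordering \<open>\<epsilon>\<^sub>1, \<epsilon>\<^sub>2, \<delta>\<^sub>1\<close>, where \<open>i\<close> is the vertex of
    \<open>\<epsilon>\<^sub>1 - \<epsilon>\<^sub>2\<close>.\<close>
  define \<rho> :: "generator \<Rightarrow> letter \<Rightarrow> letter \<Rightarrow> 'k" where
    "\<rho> g = (case g of
        H v \<Rightarrow> if v = i then (\<lambda>x y. mat_unit Eps1 Eps1 x y - mat_unit Eps2 Eps2 x y)
          else (\<lambda>x y. mat_unit Eps2 Eps2 x y + mat_unit Del1 Del1 x y)
      | E v \<Rightarrow> if v = i then mat_unit Eps1 Eps2 else mat_unit Eps2 Del1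
      | F v \<Rightarrow> if v = i then mat_unit Eps2 Eps1 else mat_unit Del1 Eps2)" for g
  have v: "v = i \<or> v = j" for v using ij(1) by (cases v; cases i; cases j) auto
  have A: "A i i = 2" "A i j = - 1" "A j i = - 1" "A j j = 0"
    using white(1)[OF ij(2)] white(2)[OF ij(2,1)] symmetric[of j i] grey[OF ij(3)] by simp_all
  have "(\<lambda>u. mat_rep (gen_parity par) \<rho> u Eps1 Eps2) \<in> Ann"
  proof (rule mat_rep_annihilator)
    fix g x y assume "\<rho> g x y \<noteq> 0"
    moreover obtain w where "g = H w \<or> g = E w \<or> g = F w" by (cases g) auto
    ultimately show "gen_parity par g = letter_parity x + letter_parity y"
      using ij v[of w] by (auto simp: \<rho>_def mat_unit_def letter_parity_def split: if_splits)
  next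
    fix r x y assume "r \<in> R"
    then show "pair (\<lambda>u. mat_rep (gen_parity par) \<rho> u x y) r = 0"
    proof (cases rule: R_cases)
      case (HH v w)
      then show ?thesis using v[of v] v[of w] ij
        by (cases x; cases y) (auto simp: \<rho>_def mat_mul_def mat_unit_def)
    next
      case (HE v w)
      then show ?thesis using v[of v] v[of w] ij A
        by (cases x; cases y) (auto simp: \<rho>_def mat_mul_def mat_unit_def)
    next
      case (HF v w)
      then show ?thesis using v[of v] v[of w] ij A
        by (cases x; cases y) (auto simp: \<rho>_def mat_mul_def mat_unit_def)
    next
      case (EF v w)
      then show ?thesis using v[of v] v[of w] ij A
        by (cases x; cases y) (auto simp: \<rho>_def mat_mul_def mat_unit_def)
    next
      case (EE v)
      then show ?thesis using v[of v] ij
        by (cases x; cases y) (auto simp: \<rho>_def mat_mul_def mat_unit_def)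
    next
      case (FF v)
      then show ?thesis using v[of v] ij
        by (cases x; cases y) (auto simp: \<rho>_def mat_mul_def mat_unit_def)
    next
      case (SE v w)
      then show ?thesis using v[of v] v[of w] ij
        by (cases x; cases y) (auto simp: \<rho>_def mat_mul_def mat_unit_def)
    next
      case (SF v w)
      then show ?thesis using v[of v] v[of w] ij
        by (cases x; cases y) (auto simp: \<rho>_def mat_mul_def mat_unit_def)
    qed
  qed
  then show ?thesis
    by (rule bexI[rotated]) (simp add: \<rho>_def mat_unit_def)
qed

text \<open>The coordinate functionals of \<open>e\<^sub>1, e\<^sub>2\<close> and of \<open>f\<^sub>1, f\<^sub>2\<close> vanish on the even part, and their products
  detect \<open>e\<^sub>1 \<otimes> e\<^sub>2\<close> in the cobracket of \<open>[e\<^sub>1, e\<^sub>2]\<close> and \<open>f\<^sub>1 \<otimes> f\<^sub>2\<close> in that of \<open>[f\<^sub>1, f\<^sub>2]\<close>.\<close>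

lemma (in grey_dynkin) odd_functionals:
  shows "\<exists>\<phi>\<in>Ann. \<exists>\<psi>\<in>Ann. (\<forall>u. deg u = 0 \<longrightarrow> \<phi> u = 0) \<and>
      cob e12 (\<lambda>u v. \<phi> u * \<psi> v) \<noteq> 0 \<and> cob f12 (\<lambda>u v. \<phi> u * \<psi> v) = 0"
    and "\<exists>\<phi>\<in>Ann. \<exists>\<psi>\<in>Ann. (\<forall>u. deg u = 0 \<longrightarrow> \<phi> u = 0) \<and>
      cob e12 (\<lambda>u v. \<phi> u * \<psi> v) = 0 \<and> cob f12 (\<lambda>u v. \<phi> u * \<psi> v) \<noteq> 0"
proof -
  \<comment> \<open>The natural representation in the ordering \<open>\<epsilon>\<^sub>1, \<delta>\<^sub>1, \<epsilon>\<^sub>2\<close>; the signs of \<open>h\<^sub>2\<close> and \<open>f\<^sub>2\<close> come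
    from \<open>(\<delta>\<^sub>1, \<delta>\<^sub>1) = - 1\<close>.\<close>
  define \<rho> :: "generator \<Rightarrow> letter \<Rightarrow> letter \<Rightarrow> 'a" where
    "\<rho> g = (case g of
        H V1 \<Rightarrow> (\<lambda>x y. mat_unit Eps1 Eps1 x y + mat_unit Del1 Del1 x y)
      | H V2 \<Rightarrow> (\<lambda>x y. - mat_unit Eps2 Eps2 x y - mat_unit Del1 Del1 x y)
      | E V1 \<Rightarrow> mat_unit Eps1 Del1
      | E V2 \<Rightarrow> mat_unit Del1 Eps2
      | F V1 \<Rightarrow> mat_unit Del1 Eps1
      | F V2 \<Rightarrow> (\<lambda>x y. - mat_unit Eps2 Del1 x y))" for g
  define M where "M = mat_rep (gen_parity par) \<rho>"
  have parity: "gen_parity par g = letter_parity x + letter_parity y" if "\<rho> g x y \<noteq> 0" for g x y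
    using that
    by (cases g) (auto simp: \<rho>_def mat_unit_def letter_parity_def par_grey split: vertex.splits if_splits)
  have M_Ann: "(\<lambda>u. M u x y) \<in> Ann" for x y
    unfolding M_def
  proof (rule mat_rep_annihilator[OF parity])
    fix r x y assume "r \<in> R"
    then show "pair (\<lambda>u. mat_rep (gen_parity par) \<rho> u x y) r = 0"
    proof (cases rule: R_cases)
      case (HH v w)
      then show ?thesis
        by (cases v; cases w; cases x; cases y) (auto simp: \<rho>_def mat_mul_def mat_unit_def)
    next
      case (HE v w)
      then show ?thesis
        by (cases v; cases w; cases x; cases y)
          (auto simp: \<rho>_def mat_mul_def mat_unit_def A_grey)
    next
      case (HF v w)
      then show ?thesis
        by (cases v; cases w; cases x; cases y)
          (auto simp: \<rho>_def mat_mul_def mat_unit_def A_grey)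
    next
      case (EF v w)
      then show ?thesis
        by (cases v; cases w; cases x; cases y)
          (auto simp: \<rho>_def mat_mul_def mat_unit_def par_grey)
    next
      case (EE v)
      then show ?thesis
        by (cases v; cases x; cases y) (auto simp: \<rho>_def mat_mul_def mat_unit_def)
    next
      case (FF v)
      then show ?thesis
        by (cases v; cases x; cases y) (auto simp: \<rho>_def mat_mul_def mat_unit_def)
    qed (simp_all add: par_grey)
  qed
  have even: "M u x y = 0" if "deg u = 0" "letter_parity x + letter_parity y = 1" for u x y
    using mat_rep_parity[of \<rho> "gen_parity par" u x y] parity that unfolding M_def by auto
  have e: "(\<forall>u. deg u = 0 \<longrightarrow> M u Eps1 Del1 = 0) \<and>
      cob e12 (\<lambda>u v. M u Eps1 Del1 * M v Del1 Eps2) \<noteq> 0 \<and>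
      cob f12 (\<lambda>u v. M u Eps1 Del1 * M v Del1 Eps2) = 0"
    and f: "(\<forall>u. deg u = 0 \<longrightarrow> M u Del1 Eps1 = 0) \<and>
      cob e12 (\<lambda>u v. M u Del1 Eps1 * M v Eps2 Del1) = 0 \<and>
      cob f12 (\<lambda>u v. M u Del1 Eps1 * M v Eps2 Del1) \<noteq> 0"
    by (simp_all add: even letter_parity_def cob_Br cob_generators act_def par_grey)
      (simp_all add: M_def \<rho>_def mat_mul_def mat_unit_def par_grey)
  from e show "\<exists>\<phi>\<in>Ann. \<exists>\<psi>\<in>Ann. (\<forall>u. deg u = 0 \<longrightarrow> \<phi> u = 0) \<and>
      cob e12 (\<lambda>u v. \<phi> u * \<psi> v) \<noteq> 0 \<and> cob f12 (\<lambda>u v. \<phi> u * \<psi> v) = 0"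
    by (intro bexI[OF _ M_Ann[of Eps1 Del1]] bexI[OF _ M_Ann[of Del1 Eps2]])
  from f show "\<exists>\<phi>\<in>Ann. \<exists>\<psi>\<in>Ann. (\<forall>u. deg u = 0 \<longrightarrow> \<phi> u = 0) \<and>
      cob e12 (\<lambda>u v. \<phi> u * \<psi> v) = 0 \<and> cob f12 (\<lambda>u v. \<phi> u * \<psi> v) \<noteq> 0"
    by (intro bexI[OF _ M_Ann[of Del1 Eps1]] bexI[OF _ M_Ann[of Eps2 Del1]])
qed

theorem white_grey_not_isomorphic:
  fixes R R' :: "(generator monomial \<Rightarrow>\<^sub>0 'k::field_char_0) set"
  assumes "dynkin_superbialgebra A par R" "grey_dynkin A' par' R'"
    and ij: "i \<noteq> j" "par i = 0" "par j = 1"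
  shows "\<not> lie_superbialgebras_isomorphic
    (presented_superbialgebra (gen_parity par) R gen_cobracket)
    (presented_superbialgebra (gen_parity par') R' gen_cobracket)"
proof
  interpret L: dynkin_superbialgebra A par R by fact
  interpret M: grey_dynkin A' par' R' by fact
  assume "lie_superbialgebras_isomorphic L.Q M.Q"
  then obtain f where f: "lie_superbialgebra_iso L.Q M.Q f"
    by (auto simp: lie_superbialgebras_isomorphic_def)
  then have bij: "bij_betw f (carrier L.Q) (carrier M.Q)"
    and add: "f (L.cl x \<oplus>\<^bsub>L.Q\<^esub> L.cl y) = f (L.cl x) \<oplus>\<^bsub>M.Q\<^esub> f (L.cl y)"
    and smult: "f (k \<odot>\<^bsub>L.Q\<^esub> L.cl x) = k \<odot>\<^bsub>M.Q\<^esub> f (L.cl x)"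
    and part: "x \<in> free_part (gen_parity par) p \<Longrightarrow> f (L.cl x) \<in> part M.Q p"
    and bracket: "f (bracket L.Q (L.cl x) (L.cl y)) = bracket M.Q (f (L.cl x)) (f (L.cl y))"
    and cobracket: "tensor2_eq M.Q (tensor_map f (cobracket L.Q (L.cl x)))
      (cobracket M.Q (f (L.cl x)))"
    for x y k p
    by (simp_all add: lie_superbialgebra_iso_def image_subset_iff L.cl_in_part)
  have f_carrier: "f (L.cl x) \<in> carrier M.Q" for x
    using bij_betwE[OF bij] by simp
  obtain y where y: "y \<in> free_part (gen_parity par') 0" "f (L.cl (mon (L.ee i))) = M.cl y"
    using part[of "mon (L.ee i)" 0] ij(2) by (auto elim!: M.Q_partE)
  obtain k where k: "k \<in> free_part (gen_parity par') 0" "f (L.cl (mon (L.hh i))) = M.cl k"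
    using part[of "mon (L.hh i)" 0] by (auto elim!: M.Q_partE)
  \<comment> \<open>The cobrackets of \<open>f(e)\<close> and \<open>f(h)\<close> are tensors of even vectors, where \<open>e\<close> and \<open>h\<close> belong to the
    white vertex \<open>i\<close>.\<close>
  have cobracket_even: "pair (\<lambda>u. M.cob u (\<lambda>a b. \<phi> a * \<psi> b)) z = 0"
    if \<phi>: "\<phi> \<in> M.Ann" "\<And>u. M.deg u = 0 \<Longrightarrow> \<phi> u = 0" and \<psi>: "\<psi> \<in> M.Ann"
      and z: "f (L.cl (mon g)) = M.cl z" "g = L.ee i \<or> g = L.hh i" for \<phi> \<psi> z g
  proof -
    define B where "B S T = pair \<phi> (rep S) * pair \<psi> (rep T)" for S T
    have B_cl: "B (M.cl v) (M.cl w) = pair \<phi> v * pair \<psi> w" for v w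
      by (simp add: B_def M.pair_rep_cl \<phi> \<psi>)
    have B: "bilinear_form M.Q B"
      unfolding bilinear_form_def M.Q_simps by (auto simp: M.Q_ops B_cl algebra_simps)
    have B': "bilinear_form L.Q (\<lambda>S T. B (f S) (f T))"
      unfolding bilinear_form_def L.Q_simps
      by (auto simp: add smult bilinear_formD[OF B] f_carrier)
    have even: "pair \<phi> w = 0" if "w \<in> free_part (gen_parity par') 0" for w
      using free_part_pair_cong[OF that, of \<phi> "\<lambda>_. 0"] \<phi>(2) by simp
    have "pair (\<lambda>u. M.cob u (\<lambda>a b. \<phi> a * \<psi> b)) z = pair (\<lambda>(v, w). B v w) (cobracket M.Q (M.cl z))"
      using M.pair_cobracket[of "\<lambda>(v, w). B v w" z] M.bilinear_form_Ann2[OF B]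
      by (simp add: B_cl)
    also have "\<dots> = pair (\<lambda>(v, w). B v w) (tensor_map f (cobracket L.Q (L.cl (mon g))))"
      using cobracket[of "mon g"] B by (simp add: tensor2_eq_iff z)
    also have "\<dots> = pair (\<lambda>(v, w). B (f v) (f w)) (cobracket L.Q (L.cl (mon g)))"
      by (simp add: tensor_map_def case_prod_beta')
    also have "\<dots> = L.cob g (\<lambda>a b. B (f (L.cl (mon a))) (f (L.cl (mon b))))"
      using L.pair_cobracket[of "\<lambda>(v, w). B (f v) (f w)" "mon g"] L.bilinear_form_Ann2[OF B']
      by simp
    also have "\<dots> = 0"
      using z(2) even[OF y(1)] even[OF k(1)] by (auto simp: L.cob_generators y k B_cl)
    finally show ?thesis .
  qed
  \<comment> \<open>Hence the components along \<open>[e\<^sub>1, e\<^sub>2]\<close> and \<open>[f\<^sub>1, f\<^sub>2]\<close> vanish.\<close>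
  have Cartan: "\<exists>c1 c2. \<forall>\<chi>\<in>M.Ann. pair \<chi> z = c1 * \<chi> (M.hh V1) + c2 * \<chi> (M.hh V2)"
    if z: "z \<in> free_part (gen_parity par') 0" "f (L.cl (mon g)) = M.cl z"
      "g = L.ee i \<or> g = L.hh i" for z g
  proof -
    obtain c1 c2 c3 c4 where c: "\<forall>\<chi>\<in>M.Ann. pair \<chi> z =
        c1 * \<chi> (M.hh V1) + c2 * \<chi> (M.hh V2) + c3 * \<chi> M.e12 + c4 * \<chi> M.f12"
      using M.even_part_spanned[OF z(1)] by blast
    obtain \<phi> \<psi> where \<phi>\<psi>: "\<phi> \<in> M.Ann" "\<psi> \<in> M.Ann" "\<forall>u. M.deg u = 0 \<longrightarrow> \<phi> u = 0"
      and e: "M.cob M.e12 (\<lambda>u v. \<phi> u * \<psi> v) \<noteq> 0" "M.cob M.f12 (\<lambda>u v. \<phi> u * \<psi> v) = 0"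
      using M.odd_functionals(1) by blast
    obtain \<phi>' \<psi>' where \<phi>\<psi>': "\<phi>' \<in> M.Ann" "\<psi>' \<in> M.Ann" "\<forall>u. M.deg u = 0 \<longrightarrow> \<phi>' u = 0"
      and f: "M.cob M.e12 (\<lambda>u v. \<phi>' u * \<psi>' v) = 0" "M.cob M.f12 (\<lambda>u v. \<phi>' u * \<psi>' v) \<noteq> 0"
      using M.odd_functionals(2) by blast
    have "(\<lambda>u v. \<alpha> u * \<beta> v) \<in> M.Ann2" if "\<alpha> \<in> M.Ann" "\<beta> \<in> M.Ann" for \<alpha> \<beta>
    proof -
      have "(\<lambda>u. \<alpha> u * l) \<in> M.Ann" for l
        using annihilator_scale(1)[OF that(1), of l] by (simp only: mult.commute[of _ l])
      then show ?thesis by (simp add: M.Ann2_def annihilator_scale that)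
    qed
    from this[OF \<phi>\<psi>(1,2)] this[OF \<phi>\<psi>'(1,2)]
    have "(\<lambda>w. M.cob w (\<lambda>u v. \<phi> u * \<psi> v)) \<in> M.Ann"
      "(\<lambda>w. M.cob w (\<lambda>u v. \<phi>' u * \<psi>' v)) \<in> M.Ann"
      by (simp_all add: M.cob_annihilator)
    from c[rule_format, OF this(1)] c[rule_format, OF this(2)]
    have "c3 = 0" "c4 = 0"
      using cobracket_even[OF \<phi>\<psi>(1) _ \<phi>\<psi>(2) z(2,3)] \<phi>\<psi>(3)
        cobracket_even[OF \<phi>\<psi>'(1) _ \<phi>\<psi>'(2) z(2,3)] \<phi>\<psi>'(3) e f
      by (simp_all add: M.cob_generators)
    with c show ?thesis by auto
  qed
  obtain a1 a2 where a: "\<And>\<chi>. \<chi> \<in> M.Ann \<Longrightarrow> pair \<chi> y = a1 * \<chi> (M.hh V1) + a2 * \<chi> (M.hh V2)"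
    using Cartan[OF y] by blast
  obtain b1 b2 where b: "\<And>\<chi>. \<chi> \<in> M.Ann \<Longrightarrow> pair \<chi> k = b1 * \<chi> (M.hh V1) + b2 * \<chi> (M.hh V2)"
    using Cartan[OF k] by blast
  have commute: "pair \<chi> (free_bracket k y) = 0" if \<chi>: "\<chi> \<in> M.Ann" for \<chi>
  proof -
    have "pair \<chi> (free_bracket k y)
        = pair (\<lambda>u. a1 * \<chi> (Br u (M.hh V1)) + a2 * \<chi> (Br u (M.hh V2))) k"
      by (simp add: a annihilator_Br[OF \<chi>])
    also have "\<dots> = 0"
      by (simp add: pair_add_left pair_scale_left b annihilator_Br[OF \<chi>] M.relations(1)[OF \<chi>])
    finally show ?thesis .
  qed
  \<comment> \<open>Applying \<open>f\<close> to \<open>[h, e] = 2 e\<close> gives \<open>0 = 2 f(e)\<close>.\<close>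
  have "L.cl (free_bracket (mon (L.hh i)) (mon (L.ee i))) = L.cl (fscale 2 (mon (L.ee i)))"
    using L.relations(2)[of _ i i] L.white(1)[OF ij(2)] by (simp add: L.cl_eq_iff_pair)
  then have "M.cl (free_bracket k y) = M.cl (fscale 2 y)"
    using bracket[of "mon (L.hh i)" "mon (L.ee i)"] smult[of 2 "mon (L.ee i)"]
    by (simp add: y k L.Q_ops M.Q_ops)
  then have "\<forall>\<chi>\<in>M.Ann. pair \<chi> y = 0"
    using commute by (simp add: M.cl_eq_iff_pair del: pair_free_bracket)
  then have "f (L.cl (mon (L.ee i))) = f (L.cl 0)"
    using smult[of 0 "mon (L.ee i)"] by (simp add: y L.Q_ops M.Q_ops M.cl_eq_iff_pair)
  then have "L.cl (mon (L.ee i)) = L.cl 0"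
    using bij_betw_imp_inj_on[OF bij] by (auto dest: inj_onD)
  then show False
    using L.white_root_vector_nonzero[OF ij] by (simp add: L.cl_eq_iff_pair)
qed

section \<open>The six diagrams\<close>

lemma orderings_eq:
  "orderings = {[Eps1, Eps2, Del1], [Eps2, Eps1, Del1], [Del1, Eps1, Eps2], [Del1, Eps2, Eps1],
    [Eps1, Del1, Eps2], [Eps2, Del1, Eps1]}"
proof -
  have UNIV: "(UNIV :: letter set) = {Eps1, Eps2, Del1}" using letter.exhaust by blast
  have "d \<in> {[Eps1, Eps2, Del1], [Eps2, Eps1, Del1], [Del1, Eps1, Eps2], [Del1, Eps2, Eps1],
    [Eps1, Del1, Eps2], [Eps2, Del1, Eps1]}" if "d \<in> orderings" for d
  proof -
    have d: "distinct d" "set d = {Eps1, Eps2, Del1}" using that by (auto simp: orderings_def UNIV)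
    then have "length d = 3" using distinct_card[OF d(1)] by simp
    then obtain x y z where xyz: "d = [x, y, z]"
      by (auto simp: numeral_3_eq_3 length_Suc_conv)
    show ?thesis using d(1) unfolding xyz by (cases x; cases y; cases z) simp_all
  qed
  then show ?thesis by (auto simp: orderings_def UNIV)
qed

lemma root_parity_basis_diff:
  assumes "x \<noteq> y"
  shows "root_parity (basis_diff x y) = (if x = Del1 \<or> y = Del1 then 1 else 0)"
proof -
  have "basis_diff x y \<noteq> basis_diff v w"
    if "x = Del1 \<or> y = Del1" "v \<in> {Eps1, Eps2}" "w \<in> {Eps1, Eps2}" for v w
  proof
    assume "basis_diff x y = basis_diff v w"
    then have "basis_diff x y Del1 = basis_diff v w Del1" by simp
    then show False using that assms by (auto simp: basis_diff_def split: if_splits)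
  qed
  moreover have "x \<in> {Eps1, Eps2} \<and> y \<in> {Eps1, Eps2}" if "\<not> (x = Del1 \<or> y = Del1)"
    using that by (cases x; cases y) auto
  ultimately show ?thesis unfolding root_parity_def by auto
qed

text \<open>The two possible forms of the Cartan data: a white vertex \<open>i\<close> and a grey vertex \<open>j\<close>, or two grey
  vertices.\<close>

definition mixed_at :: "letter list \<Rightarrow> vertex \<Rightarrow> vertex \<Rightarrow> bool"
  where "mixed_at d i j \<longleftrightarrow> i \<noteq> j \<and> simple_parity d i = 0 \<and> simple_parity d j = 1 \<and>
    cartan_matrix d i i = 2 \<and> cartan_matrix d j j = 0 \<and>
    cartan_matrix d i j = - 1 \<and> cartan_matrix d j i = - 1"

definition all_grey :: "letter list \<Rightarrow> bool"
  where "all_grey d \<longleftrightarrow> (\<forall>i. simple_parity d i = 1 \<and> cartan_matrix d i i = 0) \<and>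
    (\<forall>i j. i \<noteq> j \<longrightarrow> cartan_matrix d i j = 1)"


lemma all_vertex: "(\<forall>v. P v) \<longleftrightarrow> P V1 \<and> P V2"
  by (metis vertex.exhaust)

lemma mixed_or_grey:
  assumes "d \<in> orderings"
  shows "(\<exists>i j. mixed_at d i j) \<or> all_grey d"
proof -
  have parity: "simple_parity [x, y, z] V1 = (if x = Del1 \<or> y = Del1 then 1 else 0)"
    "simple_parity [x, y, z] V2 = (if y = Del1 \<or> z = Del1 then 1 else 0)"
    if "x \<noteq> y" "y \<noteq> z" for x y z
    using that by (simp_all add: simple_parity_def root_parity_basis_diff)
  have mixed: "mixed_at [Eps1, Eps2, Del1] V1 V2" "mixed_at [Eps2, Eps1, Del1] V1 V2"
    "mixed_at [Del1, Eps1, Eps2] V2 V1" "mixed_at [Del1, Eps2, Eps1] V2 V1"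
    by (simp_all add: mixed_at_def parity cartan_matrix_def inner_def basis_diff_def)
  have "all_grey [Eps1, Del1, Eps2]" "all_grey [Eps2, Del1, Eps1]"
    unfolding all_grey_def all_vertex
    by (simp_all add: parity cartan_matrix_def inner_def basis_diff_def)
  with mixed assms show ?thesis unfolding orderings_eq by auto
qed

lemma vertex_cases: "i \<noteq> j \<Longrightarrow> v = i \<or> v = (j :: vertex)"
  by (cases i; cases j; cases v) auto

lemma dynkin_superbialgebra_ordering:
  assumes "d \<in> orderings"
  shows "dynkin_superbialgebra (cartan_matrix d) (simple_parity d)
    (relators (cartan_matrix d) (simple_parity d) :: (_ \<Rightarrow>\<^sub>0 'k::field_char_0) set)"
proof
  have "cartan_matrix d v w = cartan_matrix d w v
      \<and> (simple_parity d v = 1 \<longrightarrow> cartan_matrix d v v = 0)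
      \<and> (simple_parity d v = 0 \<longrightarrow> cartan_matrix d v v = 2)
      \<and> (simple_parity d v = 0 \<longrightarrow> v \<noteq> w \<longrightarrow> cartan_matrix d v w = - 1)" for v w
    using mixed_or_grey[OF assms]
  proof (elim disjE exE)
    fix i j assume d: "mixed_at d i j"
    then have "v = i \<or> v = j" "w = i \<or> w = j"
      using vertex_cases unfolding mixed_at_def by blast+
    with d show ?thesis unfolding mixed_at_def by auto
  next
    assume "all_grey d"
    then show ?thesis by (cases "v = w") (auto simp: all_grey_def)
  qed
  then show "cartan_matrix d v w = cartan_matrix d w v"
    "simple_parity d v = 1 \<Longrightarrow> cartan_matrix d v v = 0"
    "simple_parity d v = 0 \<Longrightarrow> cartan_matrix d v v = 2"
    "simple_parity d v = 0 \<Longrightarrow> v \<noteq> w \<Longrightarrow> cartan_matrix d v w = - 1" for v w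
    by blast+
qed simp

lemma grey_dynkin_ordering:
  assumes "d \<in> orderings" "all_grey d"
  shows "grey_dynkin (cartan_matrix d) (simple_parity d)
    (relators (cartan_matrix d) (simple_parity d) :: (_ \<Rightarrow>\<^sub>0 'k::field_char_0) set)"
  using assms
  by (intro grey_dynkin.intro grey_dynkin_axioms.intro dynkin_superbialgebra_ordering)
    (auto simp: all_grey_def)

lemma dots_mixed:
  assumes "mixed_at d i j"
  shows "{v. colour_of (dynkin d) v = White} = {i}" "{v. colour_of (dynkin d) v = Grey} = {j}"
proof -
  have "simple_parity d v = 0 \<longleftrightarrow> v = i" "v = j \<longleftrightarrow> v \<noteq> i" for v
    using assms vertex_cases[of i j v] unfolding mixed_at_def by auto
  then show "{v. colour_of (dynkin d) v = White} = {i}" "{v. colour_of (dynkin d) v = Grey} = {j}"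
    by (auto simp: dynkin_def)
qed

lemma dots_grey:
  assumes "all_grey d"
  shows "{v. colour_of (dynkin d) v = White} = {}"
    "{v. colour_of (dynkin d) v = Grey} = UNIV"
  using assms unfolding all_grey_def dynkin_def by auto

theorem theorem3p4:
  fixes d1 d2 :: "letter list"
  assumes "d1 \<in> orderings" and "d2 \<in> orderings"
  shows "dynkin_isomorphic (dynkin d1) (dynkin d2) \<longleftrightarrow>
    lie_superbialgebras_isomorphic
      (g_superbialgebra d1 ::
        ('k::{alg_closed_field, field_char_0}, (generator monomial \<Rightarrow>\<^sub>0 'k) set) superbialgebra)
      (g_superbialgebra d2)"
proof -
  note L = dynkin_superbialgebra_ordering[OF assms(1), where 'k = 'k]
    and M = dynkin_superbialgebra_ordering[OF assms(2), where 'k = 'k]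
  note grey1 = grey_dynkin_ordering[OF assms(1), where 'k = 'k]
    and grey2 = grey_dynkin_ordering[OF assms(2), where 'k = 'k]
  note iso = equal_Cartan_data_isomorphic[OF L M, folded g_superbialgebra_def]
  note white_grey = white_grey_not_isomorphic[OF L, folded g_superbialgebra_def]
    and grey_white = white_grey_not_isomorphic[OF M, folded g_superbialgebra_def]
  consider (mixed) i j i' j' where "mixed_at d1 i j" "mixed_at d2 i' j'"
    | (grey) "all_grey d1" "all_grey d2"
    | (mixed_grey) i j where "mixed_at d1 i j" "all_grey d2"
    | (grey_mixed) i j where "all_grey d1" "mixed_at d2 i j"
    using mixed_or_grey[OF assms(1)] mixed_or_grey[OF assms(2)] by blast
  then show ?thesis
  proof cases
    case mixed
    have "dynkin_isomorphic (dynkin d1) (dynkin d2)"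
      by (simp add: dynkin_isomorphic_def dots_mixed[OF mixed(1)] dots_mixed[OF mixed(2)])
    moreover have "lie_superbialgebras_isomorphic (g_superbialgebra d1 ::
        ('k, (generator monomial \<Rightarrow>\<^sub>0 'k) set) superbialgebra) (g_superbialgebra d2)"
    proof (rule iso[where \<sigma> = "\<lambda>v. if v = i then i' else j'" and \<rho> = "\<lambda>v. if v = i' then i else j"])
      fix v w :: vertex
      note v = vertex_cases[of i j v] vertex_cases[of i' j' v] vertex_cases[of i j w]
      show "(if (if v = i then i' else j') = i' then i else j) = v"
        "(if (if v = i' then i else j) = i then i' else j') = v"
        "simple_parity d2 (if v = i then i' else j') = simple_parity d1 v"
        using mixed v by (auto simp: mixed_at_def)
      show "cartan_matrix d2 (if v = i then i' else j') (if w = i then i' else j')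
          = cartan_matrix d1 v w"
        using mixed v by (auto simp: mixed_at_def)
    qed
    ultimately show ?thesis by simp
  next
    case grey
    have "dynkin_isomorphic (dynkin d1) (dynkin d2)"
      by (simp add: dynkin_isomorphic_def dots_grey[OF grey(1)] dots_grey[OF grey(2)])
    moreover have "lie_superbialgebras_isomorphic (g_superbialgebra d1 ::
        ('k, (generator monomial \<Rightarrow>\<^sub>0 'k) set) superbialgebra) (g_superbialgebra d2)"
    proof (rule iso[where \<sigma> = "\<lambda>v. v" and \<rho> = "\<lambda>v. v"])
      show "cartan_matrix d2 v w = cartan_matrix d1 v w" for v w
        using grey by (cases "v = w") (auto simp: all_grey_def)
    qed (use grey in \<open>auto simp: all_grey_def\<close>)
    ultimately show ?thesis by simp
  next
    case mixed_grey
    have "\<not> dynkin_isomorphic (dynkin d1) (dynkin d2)"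
      by (simp add: dynkin_isomorphic_def dots_mixed[OF mixed_grey(1)] dots_grey[OF mixed_grey(2)])
    moreover have "\<not> lie_superbialgebras_isomorphic (g_superbialgebra d1 ::
        ('k, (generator monomial \<Rightarrow>\<^sub>0 'k) set) superbialgebra) (g_superbialgebra d2)"
      using white_grey[OF grey2[OF mixed_grey(2)], folded g_superbialgebra_def] mixed_grey(1)
      by (auto simp: mixed_at_def)
    ultimately show ?thesis by simp
  next
    case grey_mixed
    have "\<not> dynkin_isomorphic (dynkin d1) (dynkin d2)"
      by (simp add: dynkin_isomorphic_def dots_mixed[OF grey_mixed(2)] dots_grey[OF grey_mixed(1)])
    moreover have "\<not> lie_superbialgebras_isomorphic (g_superbialgebra d2 ::
        ('k, (generator monomial \<Rightarrow>\<^sub>0 'k) set) superbialgebra) (g_superbialgebra d1)"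
      using grey_white[OF grey1[OF grey_mixed(1)], folded g_superbialgebra_def] grey_mixed(2)
      by (auto simp: mixed_at_def)
    ultimately show ?thesis using lie_superbialgebras_isomorphic_sym by blast
  qed
qed

end
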